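(* Let $0<q<1$, let $\mathcal{A}^\infty$ be the Hopf $*$-algebra of $SU_q(2)$, and let $[\tau_{\rm odd}]\in HC^1(\mathcal{A}^\infty)$ be the Chern character of a generator of the odd K-homology group $K^1(\mathcal{A}^\infty)\cong\mathbb{Z}$. Then $[\tau_{\rm odd}]$ is not invariant; that is, there is no cyclic 1-cocycle $\phi$ on $\mathcal{A}^\infty$ which is an invariant bilinear functional and satisfies $[\phi]=[\tau_{\rm odd}]$ in $HC^1(\mathcal{A}^\infty)$.
   Context: $\mathcal{A}^\infty$ is the unital $*$-algebra generated by $\alpha,\beta$ with relations $\alpha^*\alpha+\beta^*\beta=1$, $\alpha\alpha^*+q^2\beta\beta^*=1$, $\alpha\beta=q\beta\alpha$, $\alpha\beta^*=q\beta^*\alpha$, $\beta^*\beta=\beta\beta^*$. Its coproduct is the $*$-homomorphism $\Delta$ with $\Delta(\alpha)=\alpha\otimes\alpha-q\beta^*\otimes\beta$, $\Delta(\beta)=\beta\otimes\alpha+\alpha^*\otimes\beta$. Sweedler notation: $\Delta(a)=a^{(1)}\otimes a^{(2)}$ (summation implied). For an $m$-linear functional $\phi$ on $\mathcal{A}^\infty$ (viewed as a linear functional on the $m$-fold algebraic tensor product) and a linear functional $\psi:\mathcal{A}^\infty\to\mathbb{C}$, the convolution is $$(\phi*\psi)(a_1\otimes\cdots\otimes a_m)=\phi(a_1^{(1)}\otimes\cdots\otimes a_m^{(1)})\,\psi(a_1^{(2)}\cdots a_m^{(2)}).$$ An $m$-linear functional $\phi$ is called invariant if $\phi*\psi=\psi(1)\phi$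 for every linear functional $\psi$ on $\mathcal{A}^\infty$. $HC^n(\mathcal{A}^\infty)$ denotes the (algebraic) cyclic cohomology; its elements are classes of cyclic cocycles, which are $(n+1)$-linear functionals. A class $[\phi]\in HC^n(\mathcal{A}^\infty)$ is called invariant if there is an invariant $(n+1)$-linear functional $\phi'$ which is a cyclic cocycle with $[\phi']=[\phi]$. In degree 1, cyclic cocycles are bilinear functionals $\phi$ with $\phi(a_0,a_1)=-\phi(a_1,a_0)$ and $\phi(a_0a_1,a_2)-\phi(a_0,a_1a_2)+\phi(a_2a_0,a_1)=0$, and two of them are cohomologous iff they differ by $\partial\xi$, $(\partial\xi)(a,b)=\xi(ab)-\xi(ba)$, for some linear functional $\xi$ on $\mathcal{A}^\infty$. The Chern character in $HC^1(\mathcal{A}^\infty)$ of a K-homology class represented by an odd Fredholm module $(\mathcal{H},F)$ ($F=F^*$, $F^2=1$) with $[F,a]$ Hilbert–Schmidt for all $a\in\mathcal{A}^\infty$ is, up to a nonzero normalization constant, the class of the cyclic cocycle $(a_0,a_1)\mapsto\frac12{\rm Tr}(F[F,a_0][F,a_1])$. $K^1(\mathcal{A}^\infty)\cong\mathbb{Z}$ is the odd K-homology group of $SU_q(2)$ (i.e. of the universal enveloping $C^*$-algebra of $\mathcal{A}^\infty$). *)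

theory Defs
  imports
    "HOL-Analysis.Infinite_Sum"
    "HOL-Algebra.Free_Abelian_Groups"
    "HOL-Algebra.QuotRing"
    "HOL-Algebra.Module"
    "HOL-Library.Product_Plus"
    "HOL-Library.Nat_Bijection"
begin

section \<open>Complex \<open>*\<close>-algebras\<close>

record 'a star_alg = "(complex, 'a) module" +
  star :: "'a \<Rightarrow> 'a"

definition quotient_star_alg :: "'a star_alg \<Rightarrow> 'a set \<Rightarrow> 'a set star_alg" where
  "quotient_star_alg R J =
    \<lparr>carrier = carrier (R Quot J), mult = mult (R Quot J), one = one (R Quot J),
     zero = zero (R Quot J), add = add (R Quot J),
     smult = (\<lambda>c X. \<Union>x\<in>X. J +>\<^bsub>R\<^esub> smult R c x),
     star = (\<lambda>X. \<Union>x\<in>X. J +>\<^bsub>R\<^esub> star R x)\<rparr>"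

definition linear_functional :: "'a star_alg \<Rightarrow> ('a \<Rightarrow> complex) \<Rightarrow> bool" where
  "linear_functional A \<psi> \<longleftrightarrow>
    (\<forall>a\<in>carrier A. \<forall>b\<in>carrier A. \<psi> (a \<oplus>\<^bsub>A\<^esub> b) = \<psi> a + \<psi> b) \<and>
    (\<forall>c. \<forall>a\<in>carrier A. \<psi> (smult A c a) = c * \<psi> a)"

definition bilinear_functional :: "'a star_alg \<Rightarrow> ('a \<Rightarrow> 'a \<Rightarrow> complex) \<Rightarrow> bool" where
  "bilinear_functional A \<phi> \<longleftrightarrow>
    (\<forall>a\<in>carrier A. linear_functional A (\<phi> a)) \<and>
    (\<forall>b\<in>carrier A. linear_functional A (\<lambda>a. \<phi> a b))"

section \<open>Cyclic cohomology in degree one\<close>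

definition cyclic_1_cocycle :: "'a star_alg \<Rightarrow> ('a \<Rightarrow> 'a \<Rightarrow> complex) \<Rightarrow> bool" where
  "cyclic_1_cocycle A \<phi> \<longleftrightarrow>
    bilinear_functional A \<phi> \<and>
    (\<forall>a\<^sub>0\<in>carrier A. \<forall>a\<^sub>1\<in>carrier A. \<phi> a\<^sub>0 a\<^sub>1 = - \<phi> a\<^sub>1 a\<^sub>0) \<and>
    (\<forall>a\<^sub>0\<in>carrier A. \<forall>a\<^sub>1\<in>carrier A. \<forall>a\<^sub>2\<in>carrier A.
       \<phi> (a\<^sub>0 \<otimes>\<^bsub>A\<^esub> a\<^sub>1) a\<^sub>2 - \<phi> a\<^sub>0 (a\<^sub>1 \<otimes>\<^bsub>A\<^esub> a\<^sub>2) + \<phi> (a\<^sub>2 \<otimes>\<^bsub>A\<^esub> a\<^sub>0) a\<^sub>1 = 0)"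

definition cohomologous ::
    "'a star_alg \<Rightarrow> ('a \<Rightarrow> 'a \<Rightarrow> complex) \<Rightarrow> ('a \<Rightarrow> 'a \<Rightarrow> complex) \<Rightarrow> bool" where
  "cohomologous A \<phi> \<phi>' \<longleftrightarrow>
    (\<exists>\<xi>. linear_functional A \<xi> \<and>
      (\<forall>a\<in>carrier A. \<forall>b\<in>carrier A.
        \<phi> a b - \<phi>' a b = \<xi> (a \<otimes>\<^bsub>A\<^esub> b) - \<xi> (b \<otimes>\<^bsub>A\<^esub> a)))"

definition HC1_class ::
    "'a star_alg \<Rightarrow> ('a \<Rightarrow> 'a \<Rightarrow> complex) \<Rightarrow> ('a \<Rightarrow> 'a \<Rightarrow> complex) set" where
  "HC1_class A \<phi> = {\<phi>'. cyclic_1_cocycle A \<phi>' \<and> cohomologous A \<phi>' \<phi>}"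

section \<open>The Hopf \<open>*\<close>-algebra of \<open>SU\<^sub>q(2)\<close>\<close>

text \<open>Words form a monoid under concatenation, written additively, so that
  \<open>gen list \<Rightarrow>\<^sub>0 complex\<close> with the convolution product of \<^theory>\<open>HOL-Library.Poly_Mapping\<close>
  is the free unital complex algebra on the four letters, that is, the free unital
  \<open>*\<close>-algebra on \<open>\<alpha>\<close> and \<open>\<beta>\<close>.  Likewise \<open>gen list \<times> gen list \<Rightarrow>\<^sub>0 complex\<close> is its algebraic
  tensor square, the pair \<open>(u, v)\<close> standing for \<open>u \<otimes> v\<close>.\<close>

instantiation list :: (type) monoid_add
begin

definition zero_list :: "'a list" where "zero_list = []"

definition plus_list :: "'a list \<Rightarrow> 'a list \<Rightarrow> 'a list" where "plus_list = (@)"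

instance by standard (simp_all add: zero_list_def plus_list_def)

end

datatype gen = Alpha | Alpha_star | Beta | Beta_star

type_synonym free_alg = "gen list \<Rightarrow>\<^sub>0 complex"
type_synonym free_alg2 = "gen list \<times> gen list \<Rightarrow>\<^sub>0 complex"

fun gen_star :: "gen \<Rightarrow> gen" where
  "gen_star Alpha = Alpha_star"
| "gen_star Alpha_star = Alpha"
| "gen_star Beta = Beta_star"
| "gen_star Beta_star = Beta"

definition free_star :: "free_alg \<Rightarrow> free_alg" where
  "free_star x = (\<Sum>w\<in>Poly_Mapping.keys x.
     Poly_Mapping.single (rev (map gen_star w)) (cnj (Poly_Mapping.lookup x w)))"

definition free_star_alg :: "free_alg star_alg" where
  "free_star_alg =
    \<lparr>carrier = UNIV, mult = (*), one = 1, zero = 0, add = (+),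
     smult = (\<lambda>c. Poly_Mapping.map ((*) c)), star = free_star\<rparr>"

abbreviation word :: "gen list \<Rightarrow> free_alg" where
  "word w \<equiv> Poly_Mapping.single w 1"

definition suq2_relators :: "real \<Rightarrow> free_alg set" where
  "suq2_relators q =
    {word [Alpha_star, Alpha] + word [Beta_star, Beta] - 1,
     word [Alpha, Alpha_star] + Poly_Mapping.single [Beta, Beta_star] (of_real (q\<^sup>2)) - 1,
     word [Alpha, Beta] - Poly_Mapping.single [Beta, Alpha] (of_real q),
     word [Alpha, Beta_star] - Poly_Mapping.single [Beta_star, Alpha] (of_real q),
     word [Beta_star, Beta] - word [Beta, Beta_star]}"

definition suq2_ideal :: "real \<Rightarrow> free_alg set" where
  "suq2_ideal q = Idl\<^bsub>free_star_alg\<^esub> (suq2_relators q \<union> free_star ` suq2_relators q)"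

type_synonym suq2 = "free_alg set"

definition SUq2 :: "real \<Rightarrow> suq2 star_alg" where
  "SUq2 q = quotient_star_alg free_star_alg (suq2_ideal q)"

abbreviation suq2_class :: "real \<Rightarrow> free_alg \<Rightarrow> suq2" where
  "suq2_class q x \<equiv> suq2_ideal q +>\<^bsub>free_star_alg\<^esub> x"

text \<open>The last two of the following equations are forced by \<open>\<Delta>\<close> being a \<open>*\<close>-homomorphism,
  with \<open>(x \<otimes> y)* = x* \<otimes> y*\<close>.\<close>

fun coproduct_gen :: "real \<Rightarrow> gen \<Rightarrow> free_alg2" where
  "coproduct_gen q Alpha =
     Poly_Mapping.single ([Alpha], [Alpha]) 1
     - Poly_Mapping.single ([Beta_star], [Beta]) (of_real q)"
| "coproduct_gen q Beta =
     Poly_Mapping.single ([Beta], [Alpha]) 1 + Poly_Mapping.single ([Alpha_star], [Beta]) 1"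
| "coproduct_gen q Alpha_star =
     Poly_Mapping.single ([Alpha_star], [Alpha_star]) 1
     - Poly_Mapping.single ([Beta], [Beta_star]) (of_real q)"
| "coproduct_gen q Beta_star =
     Poly_Mapping.single ([Beta_star], [Alpha_star]) 1
     + Poly_Mapping.single ([Alpha], [Beta_star]) 1"

definition free_coproduct :: "real \<Rightarrow> free_alg \<Rightarrow> free_alg2" where
  "free_coproduct q x = (\<Sum>w\<in>Poly_Mapping.keys x.
     Poly_Mapping.map ((*) (Poly_Mapping.lookup x w)) (prod_list (map (coproduct_gen q) w)))"

text \<open>An element of \<open>A \<otimes> A\<close> is given by a formal linear combination of pairs of elements of \<open>A\<close>;
  the coproduct of a coset is read off from any of its representatives.  The formal combination
  depends on the representative, but the element of \<open>A \<otimes> A\<close> does not, and only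
  bilinear expressions in the two tensor factors are evaluated on it.\<close>

definition coproduct :: "real \<Rightarrow> suq2 \<Rightarrow> (suq2 \<times> suq2) \<Rightarrow>\<^sub>0 complex" where
  "coproduct q X =
    (let d = free_coproduct q (SOME x. x \<in> X)
     in \<Sum>(u, v)\<in>Poly_Mapping.keys d.
          Poly_Mapping.single (suq2_class q (word u), suq2_class q (word v))
            (Poly_Mapping.lookup d (u, v)))"

definition convolution ::
    "real \<Rightarrow> (suq2 \<Rightarrow> suq2 \<Rightarrow> complex) \<Rightarrow> (suq2 \<Rightarrow> complex) \<Rightarrow> suq2 \<Rightarrow> suq2 \<Rightarrow> complex" where
  "convolution q \<phi> \<psi> a b =
    (\<Sum>(a\<^sub>1, a\<^sub>2)\<in>Poly_Mapping.keys (coproduct q a).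
     \<Sum>(b\<^sub>1, b\<^sub>2)\<in>Poly_Mapping.keys (coproduct q b).
       Poly_Mapping.lookup (coproduct q a) (a\<^sub>1, a\<^sub>2) *
       Poly_Mapping.lookup (coproduct q b) (b\<^sub>1, b\<^sub>2) *
       (\<phi> a\<^sub>1 b\<^sub>1 * \<psi> (a\<^sub>2 \<otimes>\<^bsub>SUq2 q\<^esub> b\<^sub>2)))"

definition invariant_functional :: "real \<Rightarrow> (suq2 \<Rightarrow> suq2 \<Rightarrow> complex) \<Rightarrow> bool" where
  "invariant_functional q \<phi> \<longleftrightarrow>
    bilinear_functional (SUq2 q) \<phi> \<and>
    (\<forall>\<psi>. linear_functional (SUq2 q) \<psi> \<longrightarrow>
      (\<forall>a\<in>carrier (SUq2 q). \<forall>b\<in>carrier (SUq2 q).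
        convolution q \<phi> \<psi> a b = \<psi> \<one>\<^bsub>SUq2 q\<^esub> * \<phi> a b))"

definition invariant_class :: "real \<Rightarrow> (suq2 \<Rightarrow> suq2 \<Rightarrow> complex) set \<Rightarrow> bool" where
  "invariant_class q C \<longleftrightarrow>
    (\<exists>\<phi>. cyclic_1_cocycle (SUq2 q) \<phi> \<and> invariant_functional q \<phi> \<and> HC1_class (SUq2 q) \<phi> = C)"

section \<open>Operators on separable Hilbert spaces\<close>

text \<open>Every separable complex Hilbert space is unitarily equivalent to \<open>\<ell>\<^sup>2(I)\<close> for some
  \<open>I \<subseteq> \<nat>\<close>.  Operators are functions of which only the restriction to \<open>\<ell>\<^sup>2(I)\<close> matters.\<close>

type_synonym vec = "nat \<Rightarrow> complex"
type_synonym oper = "vec \<Rightarrow> vec"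

definition l2 :: "nat set \<Rightarrow> vec set" where
  "l2 I = {x. (\<forall>i. i \<notin> I \<longrightarrow> x i = 0) \<and> (\<lambda>i. (cmod (x i))\<^sup>2) summable_on UNIV}"

definition l2_inner :: "vec \<Rightarrow> vec \<Rightarrow> complex" where
  "l2_inner x y = (\<Sum>\<^sub>\<infinity>i. x i * cnj (y i))"

definition l2_norm :: "vec \<Rightarrow> real" where
  "l2_norm x = sqrt (\<Sum>\<^sub>\<infinity>i. (cmod (x i))\<^sup>2)"

definition l2_unit :: "nat \<Rightarrow> vec" where
  "l2_unit i = (\<lambda>j. if j = i then 1 else 0)"

definition bounded_op :: "nat set \<Rightarrow> nat set \<Rightarrow> oper \<Rightarrow> bool" where
  "bounded_op I J T \<longleftrightarrow>
    (\<forall>x\<in>l2 I. T x \<in> l2 J) \<and>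
    (\<forall>c. \<forall>x\<in>l2 I. \<forall>y\<in>l2 I. T (\<lambda>i. c * x i + y i) = (\<lambda>i. c * T x i + T y i)) \<and>
    (\<exists>K. \<forall>x\<in>l2 I. l2_norm (T x) \<le> K * l2_norm x)"

definition op_norm :: "nat set \<Rightarrow> oper \<Rightarrow> real" where
  "op_norm I T = (SUP x\<in>{x \<in> l2 I. l2_norm x \<le> 1}. l2_norm (T x))"

definition compact_op :: "nat set \<Rightarrow> oper \<Rightarrow> bool" where
  "compact_op I T \<longleftrightarrow> bounded_op I I T \<and>
    (\<forall>s. (\<forall>n. s n \<in> l2 I \<and> l2_norm (s n) \<le> 1) \<longrightarrow>
      (\<exists>r y. strict_mono (r :: nat \<Rightarrow> nat) \<and> y \<in> l2 I \<and>
        (\<lambda>n. l2_norm (T (s (r n)) - y)) \<longlonglongrightarrow> 0))"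

definition hilbert_schmidt_op :: "nat set \<Rightarrow> oper \<Rightarrow> bool" where
  "hilbert_schmidt_op I T \<longleftrightarrow> bounded_op I I T \<and>
    (\<lambda>i. (l2_norm (T (l2_unit i)))\<^sup>2) summable_on I"

definition op_trace :: "nat set \<Rightarrow> oper \<Rightarrow> complex" where
  "op_trace I T = (\<Sum>\<^sub>\<infinity>i\<in>I. l2_inner (T (l2_unit i)) (l2_unit i))"

definition commutator :: "oper \<Rightarrow> oper \<Rightarrow> oper" where
  "commutator S T = (\<lambda>x. S (T x) - T (S x))"

definition star_rep :: "'a star_alg \<Rightarrow> nat set \<Rightarrow> ('a \<Rightarrow> oper) \<Rightarrow> bool" where
  "star_rep A I \<rho> \<longleftrightarrow>
    (\<forall>a\<in>carrier A. bounded_op I I (\<rho> a)) \<and>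
    (\<forall>a\<in>carrier A. \<forall>b\<in>carrier A. \<forall>x\<in>l2 I. \<rho> (a \<oplus>\<^bsub>A\<^esub> b) x = (\<lambda>i. \<rho> a x i + \<rho> b x i)) \<and>
    (\<forall>c. \<forall>a\<in>carrier A. \<forall>x\<in>l2 I. \<rho> (smult A c a) x = (\<lambda>i. c * \<rho> a x i)) \<and>
    (\<forall>a\<in>carrier A. \<forall>b\<in>carrier A. \<forall>x\<in>l2 I. \<rho> (a \<otimes>\<^bsub>A\<^esub> b) x = \<rho> a (\<rho> b x)) \<and>
    (\<forall>a\<in>carrier A. \<forall>x\<in>l2 I. \<forall>y\<in>l2 I. l2_inner (\<rho> (star A a) x) y = l2_inner x (\<rho> a y))"

section \<open>The universal enveloping \<open>C*\<close>-algebra\<close>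

text \<open>For a \<open>*\<close>-algebra of countable dimension whose representations are uniformly bounded on
  every element, separable Hilbert spaces suffice for the supremum, because cyclic
  representations are separable.  The enveloping algebra is the Hausdorff completion.\<close>

definition universal_norm :: "'a star_alg \<Rightarrow> 'a \<Rightarrow> real" where
  "universal_norm A a = (SUP (I, \<rho>)\<in>{(I, \<rho>). star_rep A I \<rho>}. op_norm I (\<rho> a))"

definition cauchy_seqs :: "'a star_alg \<Rightarrow> (nat \<Rightarrow> 'a) set" where
  "cauchy_seqs A = {s. (\<forall>n. s n \<in> carrier A) \<and>
    (\<forall>e>0. \<exists>N. \<forall>m\<ge>N. \<forall>n\<ge>N. universal_norm A (s m \<ominus>\<^bsub>A\<^esub> s n) < e)}"

definition null_rel :: "'a star_alg \<Rightarrow> ((nat \<Rightarrow> 'a) \<times> (nat \<Rightarrow> 'a)) set" where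
  "null_rel A = {(s, t). s \<in> cauchy_seqs A \<and> t \<in> cauchy_seqs A \<and>
    (\<lambda>n. universal_norm A (s n \<ominus>\<^bsub>A\<^esub> t n)) \<longlonglongrightarrow> 0}"

definition enveloping :: "'a star_alg \<Rightarrow> (nat \<Rightarrow> 'a) set star_alg" where
  "enveloping A =
    \<lparr>carrier = cauchy_seqs A // null_rel A,
     mult = (\<lambda>X Y. \<Union>s\<in>X. \<Union>t\<in>Y. null_rel A `` {\<lambda>n. s n \<otimes>\<^bsub>A\<^esub> t n}),
     one = null_rel A `` {\<lambda>n. \<one>\<^bsub>A\<^esub>},
     zero = null_rel A `` {\<lambda>n. \<zero>\<^bsub>A\<^esub>},
     add = (\<lambda>X Y. \<Union>s\<in>X. \<Union>t\<in>Y. null_rel A `` {\<lambda>n. s n \<oplus>\<^bsub>A\<^esub> t n}),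
     smult = (\<lambda>c X. \<Union>s\<in>X. null_rel A `` {\<lambda>n. smult A c (s n)}),
     star = (\<lambda>X. \<Union>s\<in>X. null_rel A `` {\<lambda>n. star A (s n)})\<rparr>"

definition to_enveloping :: "'a star_alg \<Rightarrow> 'a \<Rightarrow> (nat \<Rightarrow> 'a) set" where
  "to_enveloping A a = null_rel A `` {\<lambda>n. a}"

section \<open>Odd K-homology\<close>

text \<open>A triple \<open>(I, \<rho>, F)\<close> is a representation \<open>\<rho>\<close> on \<open>\<ell>\<^sup>2(I)\<close>, not required to be unital,
  together with an operator \<open>F\<close>.\<close>

type_synonym 'a ktriple = "nat set \<times> ('a \<Rightarrow> oper) \<times> oper"

definition odd_fredholm_modules :: "'a star_alg \<Rightarrow> 'a ktriple set" where
  "odd_fredholm_modules B = {(I, \<rho>, F).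
    star_rep B I \<rho> \<and> bounded_op I I F \<and>
    (\<forall>x\<in>l2 I. \<forall>y\<in>l2 I. l2_inner (F x) y = l2_inner x (F y)) \<and>
    (\<forall>x\<in>l2 I. F (F x) = x) \<and>
    (\<forall>b\<in>carrier B. compact_op I (commutator F (\<rho> b)))}"

definition unitarily_equivalent :: "'a star_alg \<Rightarrow> 'a ktriple \<Rightarrow> 'a ktriple \<Rightarrow> bool" where
  "unitarily_equivalent B = (\<lambda>(I, \<rho>, F) (J, \<sigma>, G).
    \<exists>U. bounded_op I J U \<and> U ` l2 I = l2 J \<and>
      (\<forall>x\<in>l2 I. \<forall>y\<in>l2 I. l2_inner (U x) (U y) = l2_inner x y) \<and>
      (\<forall>x\<in>l2 I. U (F x) = G (U x)) \<and>
      (\<forall>b\<in>carrier B. \<forall>x\<in>l2 I. U (\<rho> b x) = \<sigma> b (U x)))"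

definition operator_homotopic :: "'a star_alg \<Rightarrow> 'a ktriple \<Rightarrow> 'a ktriple \<Rightarrow> bool" where
  "operator_homotopic B M N \<longleftrightarrow>
    (\<exists>I \<rho> H. M = (I, \<rho>, H (0::real)) \<and> N = (I, \<rho>, H 1) \<and>
      (\<forall>t\<in>{0..1}. (I, \<rho>, H t) \<in> odd_fredholm_modules B) \<and>
      (\<forall>t\<in>{0..1}. ((\<lambda>s. op_norm I (H s - H t)) \<longlongrightarrow> 0) (at t within {0..1})))"

text \<open>\<open>\<ell>\<^sup>2(I) \<oplus> \<ell>\<^sup>2(J)\<close> is \<open>\<ell>\<^sup>2\<close> of the disjoint union of \<open>I\<close> and \<open>J\<close>, encoded in \<open>\<nat>\<close>.\<close>

definition op_sum :: "oper \<Rightarrow> oper \<Rightarrow> oper" where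
  "op_sum S T = (\<lambda>x n. case sum_decode n of
      Inl i \<Rightarrow> S (\<lambda>k. x (sum_encode (Inl k))) i
    | Inr j \<Rightarrow> T (\<lambda>k. x (sum_encode (Inr k))) j)"

definition ktriple_sum :: "'a ktriple \<Rightarrow> 'a ktriple \<Rightarrow> 'a ktriple" where
  "ktriple_sum = (\<lambda>(I, \<rho>, F) (J, \<sigma>, G).
    (sum_encode ` (I <+> J), \<lambda>b. op_sum (\<rho> b) (\<sigma> b), op_sum F G))"

text \<open>\<open>K\<^sup>1(B)\<close> is the abelian group with a generator for every odd Fredholm module, subject to
  the relations that unitarily equivalent modules agree, operator homotopic modules agree,
  and the direct sum of modules is their sum.\<close>

definition K1_relators :: "'a star_alg \<Rightarrow> ('a ktriple \<Rightarrow>\<^sub>0 int) set" where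
  "K1_relators B =
    {frag_of M - frag_of N | M N. M \<in> odd_fredholm_modules B \<and> N \<in> odd_fredholm_modules B \<and>
       (unitarily_equivalent B M N \<or> operator_homotopic B M N)} \<union>
    {frag_of (ktriple_sum M N) - frag_of M - frag_of N | M N.
       M \<in> odd_fredholm_modules B \<and> N \<in> odd_fredholm_modules B}"

definition K1_subgroup :: "'a star_alg \<Rightarrow> ('a ktriple \<Rightarrow>\<^sub>0 int) set" where
  "K1_subgroup B = generate (free_Abelian_group (odd_fredholm_modules B)) (K1_relators B)"

definition K1 :: "'a star_alg \<Rightarrow> ('a ktriple \<Rightarrow>\<^sub>0 int) set monoid" where
  "K1 B = free_Abelian_group (odd_fredholm_modules B) Mod K1_subgroup B"

definition K1_class :: "'a star_alg \<Rightarrow> 'a ktriple \<Rightarrow> ('a ktriple \<Rightarrow>\<^sub>0 int) set" where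
  "K1_class B M = K1_subgroup B #>\<^bsub>free_Abelian_group (odd_fredholm_modules B)\<^esub> frag_of M"

section \<open>The Chern character in degree one\<close>

definition pullback :: "('a \<Rightarrow> 'b) \<Rightarrow> 'b ktriple \<Rightarrow> 'a ktriple" where
  "pullback f = (\<lambda>(I, \<rho>, F). (I, \<rho> \<circ> f, F))"

definition hilbert_schmidt_module :: "'a star_alg \<Rightarrow> 'a ktriple \<Rightarrow> bool" where
  "hilbert_schmidt_module A = (\<lambda>(I, \<rho>, F).
    \<forall>a\<in>carrier A. hilbert_schmidt_op I (commutator F (\<rho> a)))"

definition chern_cocycle :: "'a ktriple \<Rightarrow> 'a \<Rightarrow> 'a \<Rightarrow> complex" where
  "chern_cocycle = (\<lambda>(I, \<rho>, F) a\<^sub>0 a\<^sub>1.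
    1 / 2 * op_trace I (F \<circ> commutator F (\<rho> a\<^sub>0) \<circ> commutator F (\<rho> a\<^sub>1)))"

end

(*
Pairing the invariance identity with the vacuum state at (\<beta>, \<beta>\<^sup>\<star>) and (\<beta>\<^sup>\<star>, \<beta>) forces
\<phi>(\<beta>, \<beta>\<^sup>\<star>) = 0 for every invariant cyclic cocycle \<phi>. Coboundaries vanish at (\<beta>, \<beta>\<^sup>\<star>) because
\<beta> is normal, so an invariant Chern character \<tau> would satisfy \<tau>(\<beta>, \<beta>\<^sup>\<star>) = 0.

On the other hand, compress the fundamental unitary u of the quantum group to the positive part
of F. The compression has an inverse S modulo trace class operators, and tr (T S - 1) - tr (S T - 1)
is additive, invariant under unitary equivalence and homotopy, hence a homomorphism on K^1. For
modules with Hilbert-Schmidt commutators it equals (1 - q^2)/2 times the Chern cocycle at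
(\<beta>, \<beta>\<^sup>\<star>). So it would vanish at the generator, and therefore everywhere; but it is nonzero for the
module on l^2(\<nat> \<times> \<int>) in which F is the sign of the second coordinate.
*)
theory Submission
  imports Defs "HOL-Analysis.Bounded_Linear_Function" "HOL-Library.Diagonal_Subsequence"
begin

section \<open>The Hilbert space \<open>l\<^sup>2\<close>\<close>

text \<open>The generator of K^1 is given only abstractly, so its Chern cocycle cannot be computed.
  It is controlled through relations among all modules, most of which have merely compact
  commutators; for those no trace formula is available and only an index makes sense. The index is
  therefore set up for an ideal with a trace, without closedness or continuity: compact commutators
  give inverses modulo the closure, a Neumann series upgrades them to inverses modulo the ideal, and
  every invariance is an exact identity of traces. The factor 1 - q^2 is the asymmetry of the
  fundamental matrix, whose off-diagonal entries are \<beta> and -q times its adjoint: the two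
  \<beta> contributions enter with weights 1 and q^2 and opposite signs, while those of \<alpha>
  cancel. Modules live on different index sets and may be degenerate, so all operators are extended
  by zero to one algebra over l^2(N), the identity of a module being recorded as a projection; 2 x 2
  matrices over that algebra are folded back into it by even and odd coordinates.\<close>

lemma l2_summable: "x \<in> l2 I \<Longrightarrow> (\<lambda>i. (cmod (x i))\<^sup>2) summable_on UNIV"
  by (simp add: l2_def)

lemma l2_add: assumes "x \<in> l2 I" "y \<in> l2 I" shows "(\<lambda>i. x i + y i) \<in> l2 I"
proof -
  have "(\<lambda>i. 2 * (cmod (x i))\<^sup>2 + 2 * (cmod (y i))\<^sup>2) summable_on UNIV"
    using assms by (intro summable_on_add summable_on_cmult_right l2_summable)
  moreover have "(cmod (x i + y i))\<^sup>2 \<le> 2 * (cmod (x i))\<^sup>2 + 2 * (cmod (y i))\<^sup>2" for i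
  proof -
    have "(cmod (x i + y i))\<^sup>2 \<le> (cmod (x i) + cmod (y i))\<^sup>2"
      by (intro power_mono norm_triangle_ineq) auto
    also have "\<dots> \<le> 2 * (cmod (x i))\<^sup>2 + 2 * (cmod (y i))\<^sup>2"
      using sum_squares_bound[of "cmod (x i)" "cmod (y i)"] by (simp add: power2_sum)
    finally show ?thesis .
  qed
  ultimately have "(\<lambda>i. (cmod (x i + y i))\<^sup>2) summable_on UNIV"
    by (rule summable_on_comparison_test) auto
  then show ?thesis using assms by (auto simp: l2_def)
qed

lemma l2_cmul: assumes "x \<in> l2 I" shows "(\<lambda>i. c * x i) \<in> l2 I"
  using assms by (auto simp: l2_def norm_mult power_mult_distrib intro: summable_on_cmult_right)

lemma l2_zero: "(\<lambda>i. 0) \<in> l2 I"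
  by (simp add: l2_def)

lemma l2_mono: "x \<in> l2 I \<Longrightarrow> I \<subseteq> J \<Longrightarrow> x \<in> l2 J"
  by (auto simp: l2_def)

lemma l2_mult_summable:
  assumes "x \<in> l2 I" "y \<in> l2 J" shows "(\<lambda>i. x i * cnj (y i)) summable_on UNIV"
proof -
  have "(\<lambda>i. x i * cnj (y i)) abs_summable_on UNIV"
    by (rule abs_summable_product)
      (use l2_summable[OF assms(1)] l2_summable[OF assms(2)] in \<open>simp_all add: norm_mult power2_eq_square\<close>)
  then show ?thesis by (rule abs_summable_summable)
qed

text \<open>A type of its own gives access to the class hierarchy of normed spaces, and with it to
  bounded linear maps and limits. Index sets other than N are recovered later by coordinate
  projections.\<close>

typedef ell2 = "l2 UNIV" morphisms coord Ell2
  using l2_zero by blast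

lemma coord_Ell2 [simp]: "v \<in> l2 UNIV \<Longrightarrow> coord (Ell2 v) = v"
  by (simp add: Ell2_inverse)

lemma coord_Ell2': "v \<in> l2 I \<Longrightarrow> coord (Ell2 v) = v"
  using l2_mono[of v I UNIV] by simp

lemma ell2_eqI: "(\<And>i. coord x i = coord y i) \<Longrightarrow> x = y"
  by (metis coord_inject ext)

instantiation ell2 :: real_vector
begin

definition "0 = Ell2 (\<lambda>i. 0)"
definition "x + y = Ell2 (\<lambda>i. coord x i + coord y i)"
definition "- x = Ell2 (\<lambda>i. - coord x i)"
definition "x - y = Ell2 (\<lambda>i. coord x i - coord y i)"
definition "r *\<^sub>R x = Ell2 (\<lambda>i. of_real r * coord x i)"
lemma coord_zero [simp]: "coord 0 i = 0"
  by (simp add: zero_ell2_def l2_zero)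

lemma coord_add [simp]: "coord (x + y) i = coord x i + coord y i"
  using l2_add[OF coord[of x] coord[of y]] by (simp add: plus_ell2_def)

lemma coord_uminus [simp]: "coord (- x) i = - coord x i"
  using l2_cmul[OF coord[of x], of "-1"] by (simp add: uminus_ell2_def)

lemma coord_diff [simp]: "coord (x - y) i = coord x i - coord y i"
  using l2_add[OF coord[of x] l2_cmul[OF coord[of y], of "-1"]] by (simp add: minus_ell2_def)

lemma coord_scaleR [simp]: "coord (r *\<^sub>R x) i = of_real r * coord x i"
  using l2_cmul[OF coord[of x]] by (simp add: scaleR_ell2_def)

instance
  by standard (auto intro!: ell2_eqI simp: algebra_simps)

end

text \<open>The class knows only real scalars, so \<open>inner\<close> is the real part of the
  complex inner product; both induce the same norm.\<close>

instantiation ell2 :: real_inner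
begin

definition "inner x y = Re (l2_inner (coord x) (coord y))"
definition "norm x = l2_norm (coord x)"
definition "sgn (x::ell2) = x /\<^sub>R norm x"
definition "dist (x::ell2) y = norm (x - y)"
definition "uniformity = (INF e\<in>{0<..}. principal {(x::ell2, y). dist x y < e})"
definition "open (U::ell2 set) \<longleftrightarrow> (\<forall>x\<in>U. \<forall>\<^sub>F (x', y) in uniformity. x' = x \<longrightarrow> y \<in> U)"

lemma coord_summable: "(\<lambda>i. (cmod (coord x i))\<^sup>2) summable_on UNIV"
  by (rule l2_summable[OF coord])

lemma inner_ell2: "inner x y = (\<Sum>\<^sub>\<infinity>i. Re (coord x i * cnj (coord y i)))"
  unfolding inner_ell2_def l2_inner_def
  using infsum_Re[OF l2_mult_summable[OF coord[of x] coord[of y]]] by simp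

lemma inner_summable: "(\<lambda>i. Re (coord x i * cnj (coord y i))) summable_on UNIV"
  using summable_on_Re[OF l2_mult_summable[OF coord[of x] coord[of y]]] by simp

lemma norm_ell2_sq: "(norm x)\<^sup>2 = (\<Sum>\<^sub>\<infinity>i. (cmod (coord x i))\<^sup>2)"
  unfolding norm_ell2_def l2_norm_def
  using infsum_nonneg[of UNIV "\<lambda>i. (cmod (coord x i))\<^sup>2"] by (simp only: real_sqrt_pow2 zero_le_power2)

instance
proof
  fix x y z :: ell2 and r s :: real
  show "sgn x = x /\<^sub>R norm x" by (rule sgn_ell2_def)
  show "dist x y = norm (x - y)" by (rule dist_ell2_def)
  show "(uniformity :: (ell2 \<times> ell2) filter) = (INF e\<in>{0<..}. principal {(x, y). dist x y < e})"
    by (rule uniformity_ell2_def)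
  show "open U \<longleftrightarrow> (\<forall>x\<in>U. \<forall>\<^sub>F (x', y) in uniformity. x' = x \<longrightarrow> y \<in> U)" for U :: "ell2 set"
    by (rule open_ell2_def)
  show "inner x y = inner y x"
    unfolding inner_ell2 by (intro infsum_cong) simp
  have "(\<lambda>i. Re (coord (x+y) i * cnj (coord z i))) = 
     (\<lambda>i. Re (coord x i * cnj (coord z i)) + Re (coord y i * cnj (coord z i)))"
    by (simp add: algebra_simps)
  then show "inner (x + y) z = inner x z + inner y z"
    unfolding inner_ell2 by (simp only: infsum_add[OF inner_summable inner_summable])
  have "(\<lambda>i. Re (coord (r *\<^sub>R x) i * cnj (coord y i))) = (\<lambda>i. r * Re (coord x i * cnj (coord y i)))"
    by (simp add: algebra_simps)
  then show "inner (r *\<^sub>R x) y = r * inner x y"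
    unfolding inner_ell2 by (simp only: infsum_cmult_right')
  have sq: "Re (coord x i * cnj (coord x i)) = (cmod (coord x i))\<^sup>2" for i
    by (simp only: complex_norm_square[symmetric] Re_complex_of_real)
  show "0 \<le> inner x x" 
    unfolding inner_ell2 sq by (simp add: infsum_nonneg)
  show "norm x = sqrt (inner x x)"
    unfolding inner_ell2 sq by (simp add: norm_ell2_def l2_norm_def)
  show "(inner x x = 0) = (x = 0)"
  proof
    assume "inner x x = 0"
    then have "(cmod (coord x i))\<^sup>2 = 0" for i
      using nonneg_infsum_le_0D[OF _ coord_summable[of x], of i] unfolding inner_ell2 sq by simp
    then show "x = 0" by (auto intro!: ell2_eqI)
  qed (simp add: inner_ell2)
qed

end

lemma coord_sum: "coord (sum f A) i = (\<Sum>a\<in>A. coord (f a) i)"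
  by (induction A rule: infinite_finite_induct) auto

lemma norm_coord_le: "cmod (coord x i) \<le> norm x"
proof -
  have "(\<Sum>j\<in>{i}. (cmod (coord x j))\<^sup>2) \<le> (\<Sum>\<^sub>\<infinity>i. (cmod (coord x i))\<^sup>2)"
    by (rule finite_sum_le_infsum[OF coord_summable]) auto
  then have "(cmod (coord x i))\<^sup>2 \<le> (norm x)\<^sup>2" unfolding norm_ell2_sq by simp
  then show ?thesis by (rule power2_le_imp_le) simp
qed

lemma sum_coord_le: "finite A \<Longrightarrow> (\<Sum>i\<in>A. (cmod (coord x i))\<^sup>2) \<le> (norm x)\<^sup>2"
  unfolding norm_ell2_sq by (rule finite_sum_le_infsum[OF coord_summable]) auto

text \<open>Bounds on finite partial sums give membership and the norm estimate at once. This is how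
  coordinate formulas become vectors, in the completeness proof and in the construction of
  operators.\<close>

lemma l2_bounded_sums:
  assumes "\<And>A. finite A \<Longrightarrow> (\<Sum>i\<in>A. (cmod (v i))\<^sup>2) \<le> C\<^sup>2" and "C \<ge> 0"
  shows "v \<in> l2 UNIV" "norm (Ell2 v) \<le> C"
proof -
  have "(\<lambda>i. (cmod (v i))\<^sup>2) summable_on UNIV"
    using assms by (intro nonneg_bdd_above_summable_on) (auto simp: bdd_above_def)
  then show v: "v \<in> l2 UNIV" by (simp add: l2_def)
  have "(norm (Ell2 v))\<^sup>2 \<le> C\<^sup>2"
    unfolding norm_ell2_sq coord_Ell2[OF v]
    by (rule infsum_le_finite_sums) (use v assms in \<open>auto simp: l2_def\<close>)
  then show "norm (Ell2 v) \<le> C" using assms(2) by (rule power2_le_imp_le)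
qed

instance ell2 :: banach
proof
  fix X :: "nat \<Rightarrow> ell2" assume X: "Cauchy X"
  have "Cauchy (\<lambda>n. coord (X n) i)" for i
  proof (rule metric_CauchyI)
    fix e :: real assume "e > 0"
    with X obtain M where "\<forall>m\<ge>M. \<forall>n\<ge>M. dist (X m) (X n) < e" by (meson Cauchy_def)
    moreover have "dist (coord (X m) i) (coord (X n) i) \<le> dist (X m) (X n)" for m n
      using norm_coord_le[of "X m - X n" i] by (simp add: dist_norm)
    ultimately have "\<forall>m\<ge>M. \<forall>n\<ge>M. dist (coord (X m) i) (coord (X n) i) < e"
      by (meson le_less_trans)
    then show "\<exists>M. \<forall>m\<ge>M. \<forall>n\<ge>M. dist (coord (X m) i) (coord (X n) i) < e" ..
  qed
  then have "\<exists>L. (\<lambda>n. coord (X n) i) \<longlonglongrightarrow> L" for i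
    using Cauchy_convergent convergent_def by blast
  then obtain L where L: "\<And>i. (\<lambda>n. coord (X n) i) \<longlonglongrightarrow> L i" by metis
  \<comment> \<open>A Fatou argument: on finitely many coordinates the Cauchy estimate survives the
    limit in the second index, and the bound does not depend on the finite set.\<close>
  have tail: "(\<Sum>i\<in>A. (cmod (coord (X n) i - L i))\<^sup>2) \<le> e\<^sup>2" 
    if N: "\<forall>m\<ge>N. \<forall>n\<ge>N. dist (X m) (X n) < e" and n: "n \<ge> N" and A: "finite A" for e N n A
  proof (rule tendsto_upperbound)
    show "(\<lambda>m. \<Sum>i\<in>A. (cmod (coord (X n) i - coord (X m) i))\<^sup>2) \<longlonglongrightarrow> (\<Sum>i\<in>A. (cmod (coord (X n) i - L i))\<^sup>2)"
      by (intro tendsto_intros L)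
    show "\<forall>\<^sub>F m in sequentially. (\<Sum>i\<in>A. (cmod (coord (X n) i - coord (X m) i))\<^sup>2) \<le> e\<^sup>2"
    proof (rule eventually_sequentiallyI[of N])
      fix m assume "m \<ge> N"
      then have "norm (X n - X m) \<le> e" using N n by (auto simp: dist_norm less_imp_le)
      then have "(norm (X n - X m))\<^sup>2 \<le> e\<^sup>2" by (intro power_mono) auto
      then show "(\<Sum>i\<in>A. (cmod (coord (X n) i - coord (X m) i))\<^sup>2) \<le> e\<^sup>2"
        using sum_coord_le[OF A, of "X n - X m"] by simp
    qed
  qed simp
  have bd: "(\<lambda>i. coord (X n) i - L i) \<in> l2 UNIV" "norm (Ell2 (\<lambda>i. coord (X n) i - L i)) \<le> e"
    if "\<forall>m\<ge>N. \<forall>n\<ge>N. dist (X m) (X n) < e" "n \<ge> N" "e > 0" for e N n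
    using l2_bounded_sums[of "\<lambda>i. coord (X n) i - L i" e] tail[OF that(1,2)] that(3) by auto
  obtain N where "\<forall>m\<ge>N. \<forall>n\<ge>N. dist (X m) (X n) < 1" using X by (meson Cauchy_def zero_less_one)
  then have "(\<lambda>i. coord (X N) i - L i) \<in> l2 UNIV" by (rule bd) auto
  from l2_add[OF coord[of "X N"] l2_cmul[OF this, of "-1"]] have Ll2: "L \<in> l2 UNIV" by simp
  have eq: "Ell2 (\<lambda>i. coord (X n) i - L i) = X n - Ell2 L" for n
    using l2_add[OF coord[of "X n"] l2_cmul[OF Ll2, of "-1"]] Ll2 by (intro ell2_eqI) simp
  have "X \<longlonglongrightarrow> Ell2 L"
  proof (rule metric_LIMSEQ_I)
    fix e :: real assume "e > 0"
    then obtain N where "\<forall>m\<ge>N. \<forall>n\<ge>N. dist (X m) (X n) < e / 2" using X by (meson Cauchy_def half_gt_zero)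
    then have "norm (Ell2 (\<lambda>i. coord (X n) i - L i)) \<le> e / 2" if "n \<ge> N" for n
      using that \<open>e > 0\<close> by (intro bd(2)) auto
    then have "\<forall>n\<ge>N. dist (X n) (Ell2 L) < e"
      using \<open>e > 0\<close> unfolding eq dist_norm by fastforce
    then show "\<exists>N. \<forall>n\<ge>N. dist (X n) (Ell2 L) < e" ..
  qed
  then show "convergent X" by (auto simp: convergent_def)
qed

section \<open>Complex scalars and the standard basis\<close>

definition cscale :: "complex \<Rightarrow> ell2 \<Rightarrow> ell2" where
  "cscale c x = Ell2 (\<lambda>i. c * coord x i)"

lemma coord_cscale [simp]: "coord (cscale c x) i = c * coord x i"
  using l2_cmul[OF coord[of x]] by (simp add: cscale_def)

lemma norm_cscale: "norm (cscale c x) = cmod c * norm x"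
proof -
  have "(norm (cscale c x))\<^sup>2 = (cmod c * norm x)\<^sup>2"
    by (simp add: norm_ell2_sq norm_mult power_mult_distrib infsum_cmult_right')
  then show ?thesis by (rule power2_eq_imp_eq) simp_all
qed

lemma bounded_linear_cscale: "bounded_linear (cscale c)"
proof (rule bounded_linear_intro[where K="cmod c"])
  show "cscale c (x + y) = cscale c x + cscale c y" for x y
    by (rule ell2_eqI) (simp add: distrib_left)
  show "cscale c (r *\<^sub>R x) = r *\<^sub>R cscale c x" for r x
    by (rule ell2_eqI) simp
qed (simp add: norm_cscale mult.commute)

definition ket :: "nat \<Rightarrow> ell2" where "ket i = Ell2 (l2_unit i)"

lemma l2_unit_l2: "i \<in> I \<Longrightarrow> l2_unit i \<in> l2 I"
proof -
  assume "i \<in> I"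
  moreover have "(\<lambda>j. (cmod (l2_unit i j))\<^sup>2) summable_on UNIV"
    by (rule finite_nonzero_values_imp_summable_on) (simp add: l2_unit_def)
  ultimately show ?thesis by (auto simp: l2_def l2_unit_def)
qed

lemma coord_ket [simp]: "coord (ket i) j = (if j = i then 1 else 0)"
  using l2_unit_l2[of i UNIV] by (simp add: ket_def l2_unit_def)

lemma coord_ket' : "coord (ket i) = l2_unit i"
  by (rule ext) (simp add: l2_unit_def)

lemma norm_ket [simp]: "norm (ket i) = 1"
proof -
  have "(norm (ket i))\<^sup>2 = (\<Sum>\<^sub>\<infinity>j\<in>{i}. 1)"
    unfolding norm_ell2_sq by (rule infsum_cong_neutral) auto
  then show ?thesis using power2_eq_imp_eq[of "norm (ket i)" 1] by simp
qed

text \<open>The real Cauchy-Schwarz inequality sees only the real part; multiplying one argument by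
  a phase makes the inner product real and nonnegative.\<close>

lemma l2_inner_bound: assumes "x \<in> l2 I" "y \<in> l2 J"
  shows "cmod (l2_inner x y) \<le> l2_norm x * l2_norm y"
proof -
  define X Y where "X = Ell2 x" and "Y = Ell2 y"
  have c: "coord X = x" "coord Y = y"
    using assms by (simp_all add: X_def Y_def coord_Ell2')
  define z where "z = l2_inner x y"
  obtain c where c1: "cmod c = 1" "c * z = cmod z"
  proof (cases "z = 0")
    case False
    have "cmod (cnj z / cmod z) = 1" "cnj z / cmod z * z = cmod z"
      using False complex_norm_square[of z]
      by (auto simp: norm_divide field_simps power2_eq_square)
    then show ?thesis by (rule that)
  qed (auto intro: that[of 1])
  have "c * z = l2_inner (coord (cscale c X)) (coord Y)"
    unfolding z_def l2_inner_def c(1)[symmetric] c(2)[symmetric]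
    by (simp add: mult.assoc infsum_cmult_right')
  then have "cmod z = inner (cscale c X) Y"
    using c1 by (simp add: inner_ell2_def) (metis Re_complex_of_real)
  also have "\<dots> \<le> norm (cscale c X) * norm Y" by (rule norm_cauchy_schwarz)
  also have "\<dots> = l2_norm x * l2_norm y" unfolding norm_cscale using c1 c by (simp add: norm_ell2_def)
  finally show ?thesis by (simp add: z_def)
qed

section \<open>Bounded operators on \<open>l\<^sup>2\<close>\<close>

text \<open>Among real-linear bounded operators, those commuting with complex scalars are the
  complex-linear ones. As a subtype of the bounded linear functions they inherit norm and
  product.\<close>

typedef bop = "{T :: ell2 \<Rightarrow>\<^sub>L ell2. \<forall>c x. T (cscale c x) = cscale c (T x)}"
  morphisms blin Bop
  by (rule exI[of _ 0]) (auto intro: ell2_eqI)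

setup_lifting type_definition_bop

instantiation bop :: real_vector
begin
lift_definition zero_bop :: bop is 0 by (auto intro: ell2_eqI)
lift_definition plus_bop :: "bop \<Rightarrow> bop \<Rightarrow> bop" is "(+)"
  by (auto simp: blinfun.add_left intro!: ell2_eqI simp: algebra_simps)
lift_definition minus_bop :: "bop \<Rightarrow> bop \<Rightarrow> bop" is "(-)"
  by (auto simp: blinfun.diff_left intro!: ell2_eqI simp: algebra_simps)
lift_definition uminus_bop :: "bop \<Rightarrow> bop" is "uminus"
  by (auto simp: blinfun.minus_left intro!: ell2_eqI simp: algebra_simps)
lift_definition scaleR_bop :: "real \<Rightarrow> bop \<Rightarrow> bop" is "(*\<^sub>R)"
  by (auto simp: blinfun.scaleR_left intro!: ell2_eqI simp: algebra_simps)
instance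
  by standard (transfer; auto simp: algebra_simps)+
end

instantiation bop :: real_normed_algebra_1
begin
lift_definition one_bop :: bop is id_blinfun by auto
lift_definition times_bop :: "bop \<Rightarrow> bop \<Rightarrow> bop" is "(o\<^sub>L)"
  by auto
lift_definition norm_bop :: "bop \<Rightarrow> real" is norm .
definition "sgn (x::bop) = x /\<^sub>R norm x"
definition "dist (x::bop) y = norm (x - y)"
definition "uniformity = (INF e\<in>{0<..}. principal {(x::bop, y). dist x y < e})"
definition "open (U::bop set) \<longleftrightarrow> (\<forall>x\<in>U. \<forall>\<^sub>F (x', y) in uniformity. x' = x \<longrightarrow> y \<in> U)"
instance
proof
  fix x y z :: bop and r s :: real
  show "sgn x = x /\<^sub>R norm x" by (rule sgn_bop_def)
  show "dist x y = norm (x - y)" by (rule dist_bop_def)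
  show "(uniformity :: (bop \<times> bop) filter) = (INF e\<in>{0<..}. principal {(x, y). dist x y < e})"
    by (rule uniformity_bop_def)
  show "open U \<longleftrightarrow> (\<forall>x\<in>U. \<forall>\<^sub>F (x', y) in uniformity. x' = x \<longrightarrow> y \<in> U)" for U :: "bop set"
    by (rule open_bop_def)
  show "x * y * z = x * (y * z)" "(x + y) * z = x * z + y * z" "x * (y + z) = x * y + x * z"
    "1 * x = x" "x * 1 = x" "r *\<^sub>R x * y = r *\<^sub>R (x * y)" "x * r *\<^sub>R y = r *\<^sub>R (x * y)"
    by (transfer; auto intro!: blinfun_eqI simp: blinfun.bilinear_simps)+
  show "norm (x * y) \<le> norm x * norm y" by transfer (rule norm_blinfun_compose)
  show "norm (x + y) \<le> norm x + norm y" by transfer (rule norm_triangle_ineq)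
  show "norm (r *\<^sub>R x) = \<bar>r\<bar> * norm x" by transfer simp
  show "norm x = 0 \<longleftrightarrow> x = 0" by transfer simp
  show n1: "norm (1::bop) = 1"
  proof (transfer)
    have "norm (id_blinfun :: ell2 \<Rightarrow>\<^sub>L ell2) \<le> 1" by (rule norm_blinfun_id_le)
    moreover have "norm (ket 0) \<le> norm (id_blinfun :: ell2 \<Rightarrow>\<^sub>L ell2) * norm (ket 0)" 
      using norm_blinfun[of id_blinfun "ket 0"] by simp
    ultimately show "norm (id_blinfun :: ell2 \<Rightarrow>\<^sub>L ell2) = 1" by simp
  qed
  have "norm (0::bop) = 0" by transfer simp
  with n1 show "(0::bop) \<noteq> 1" by fastforce
qed
end

lift_definition app :: "bop \<Rightarrow> ell2 \<Rightarrow> ell2" is blinfun_apply .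

lemma bop_eqI: "(\<And>x. app S x = app T x) \<Longrightarrow> S = T"
  by transfer (rule blinfun_eqI)

lemma app_simps [simp]: "app 0 x = 0" "app 1 x = x" "app (S + T) x = app S x + app T x"
  "app (S - T) x = app S x - app T x" "app (- T) x = - app T x" "app (S * T) x = app S (app T x)"
  "app (r *\<^sub>R T) x = r *\<^sub>R app T x"
  "app T 0 = 0" "app T (x + y) = app T x + app T y" "app T (x - y) = app T x - app T y"
  "app T (- x) = - app T x" "app T (cscale c x) = cscale c (app T x)" "app T (r *\<^sub>R x) = r *\<^sub>R app T x"
  by (transfer; simp add: blinfun.bilinear_simps)+

lemma norm_app: "norm (app T x) \<le> norm T * norm x"
  by transfer (rule norm_blinfun)

lemma norm_bop_bound: "0 \<le> b \<Longrightarrow> (\<And>x. norm (app T x) \<le> b * norm x) \<Longrightarrow> norm T \<le> b"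
  by transfer (rule norm_blinfun_bound)

lemma bounded_linear_app: "bounded_linear (app T)"
  by transfer (rule blinfun.bounded_linear_right)

lemma bounded_linear_app_left: "bounded_linear (\<lambda>T. app T x)"
proof (rule bounded_linear_intro)
  show "norm (app T x) \<le> norm T * norm x" for T by (rule norm_app)
qed auto

instance bop :: banach
proof
  fix X :: "nat \<Rightarrow> bop" assume X: "Cauchy X"
  have d: "dist (blin S) (blin T) = dist S T" for S T
    unfolding dist_norm by transfer simp
  have "Cauchy (\<lambda>n. blin (X n))" using X unfolding Cauchy_def d .
  then obtain L where L: "(\<lambda>n. blin (X n)) \<longlonglongrightarrow> L" using Cauchy_convergent convergent_def by blast
  have lim: "(\<lambda>n. blin (X n) x) \<longlonglongrightarrow> L x" for x using L by (intro tendsto_intros)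
  \<comment> \<open>Complex linearity passes to the norm limit pointwise, so the subtype is
    closed.\<close>
  have "L (cscale c x) = cscale c (L x)" for c x
  proof (rule LIMSEQ_unique)
    show "(\<lambda>n. blin (X n) (cscale c x)) \<longlonglongrightarrow> L (cscale c x)" by (rule lim)
    have "(\<lambda>n. cscale c (blin (X n) x)) \<longlonglongrightarrow> cscale c (L x)"
      by (rule bounded_linear.tendsto[OF bounded_linear_cscale lim])
    moreover have "blin (X n) (cscale c x) = cscale c (blin (X n) x)" for n
      using blin[of "X n"] by auto
    ultimately show "(\<lambda>n. blin (X n) (cscale c x)) \<longlonglongrightarrow> cscale c (L x)" by simp
  qed
  then have "blin (Bop L) = L" by (simp add: Bop_inverse)
  moreover have "(\<lambda>n. dist (blin (X n)) L) \<longlonglongrightarrow> 0" using L by (rule tendsto_dist_iff[THEN iffD1])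
  ultimately have "(\<lambda>n. dist (X n) (Bop L)) \<longlonglongrightarrow> 0" using d[of "X _" "Bop L"] by simp
  then have "X \<longlonglongrightarrow> Bop L" by (rule tendsto_dist_iff[THEN iffD2])
  then show "convergent X" by (auto simp: convergent_def)
qed

lemma bop_of_linear:
  assumes "\<And>x y. f (x + y) = f x + f y" "\<And>c x. f (cscale c x) = cscale c (f x)"
    "\<And>x. norm (f x) \<le> K * norm x"
  shows "\<exists>T. app T = f"
proof -
  have sR: "r *\<^sub>R x = cscale (of_real r) x" for r x by (auto intro!: ell2_eqI)
  have "bounded_linear f"
    by (rule bounded_linear_intro[where K=K]) (use assms in \<open>auto simp: sR mult.commute\<close>)
  then have "blinfun_apply (Blinfun f) = f" by (rule bounded_linear_Blinfun_apply)
  then have "app (Bop (Blinfun f)) = f"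
    using assms(2) by (simp add: app.rep_eq Bop_inverse)
  then show ?thesis by blast
qed

section \<open>Index theory modulo an ideal with a trace\<close>

text \<open>The inverse is the geometric series in -E.\<close>

lemma inverse_one_plus:
  fixes E :: "'a::{real_normed_algebra_1,banach}"
  assumes "norm E < 1"
  obtains N where "N * (1 + E) = 1" "(1 + E) * N = 1"
proof -
  define x where "x = - E"
  have "norm x < 1" using assms by (simp add: x_def)
  then have s: "summable (\<lambda>n. x ^ n)" by (rule complete_algebra_summable_geometric)
  define N where "N = suminf (\<lambda>n. x ^ n)"
  have shift: "N - 1 = suminf (\<lambda>n. x ^ Suc n)"
    unfolding N_def using suminf_split_head[OF s] by simp
  have "x * N = suminf (\<lambda>n. x ^ Suc n)"
    unfolding N_def using suminf_mult[OF s, of x] by simp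
  moreover have "N * x = suminf (\<lambda>n. x ^ Suc n)"
    unfolding N_def using suminf_mult2[OF s, of x] by (simp add: power_commutes)
  ultimately have "N * (1 - x) = 1" "(1 - x) * N = 1"
    using shift by (simp_all add: algebra_simps)
  then show ?thesis by (intro that[of N]) (simp_all add: x_def)
qed

text \<open>Abstracts from the trace class operators. Neither closedness of J nor continuity of
  \<open>tr\<close> is available, so properties of the index have to come from exact
  algebra.\<close>

locale traced_ideal =
  fixes J :: "'a::{real_normed_algebra_1,banach} set" and tr :: "'a \<Rightarrow> complex"
  assumes zero_mem: "0 \<in> J"
    and add_mem: "x \<in> J \<Longrightarrow> y \<in> J \<Longrightarrow> x + y \<in> J"
    and left_mem: "x \<in> J \<Longrightarrow> a * x \<in> J"
    and right_mem: "x \<in> J \<Longrightarrow> x * a \<in> J"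
    and tr_add: "x \<in> J \<Longrightarrow> y \<in> J \<Longrightarrow> tr (x + y) = tr x + tr y"
    and tr_comm: "x \<in> J \<Longrightarrow> tr (x * a) = tr (a * x)"
begin

lemma uminus_mem: "x \<in> J \<Longrightarrow> - x \<in> J"
  using left_mem[of x "-1"] by simp

lemma diff_mem: "x \<in> J \<Longrightarrow> y \<in> J \<Longrightarrow> x - y \<in> J"
  using add_mem[of x "-y"] uminus_mem[of y] by simp

lemma tr_zero: "tr 0 = 0"
  using tr_add[OF zero_mem zero_mem] by simp

lemma tr_uminus: "x \<in> J \<Longrightarrow> tr (- x) = - tr x"
  using tr_add[of x "-x"] uminus_mem[of x] tr_zero by (simp add: add_eq_0_iff)

lemma tr_diff: "x \<in> J \<Longrightarrow> y \<in> J \<Longrightarrow> tr (x - y) = tr x - tr y"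
  using tr_add[of x "-y"] uminus_mem[of y] tr_uminus[of y] by simp

definition parametrix :: "'a \<Rightarrow> 'a \<Rightarrow> bool" where
  "parametrix T S \<longleftrightarrow> T * S - 1 \<in> J \<and> S * T - 1 \<in> J"

definition fredholm :: "'a \<Rightarrow> bool" where
  "fredholm T \<longleftrightarrow> (\<exists>S. parametrix T S)"

text \<open>Fedosov's formula: for the usual trace it is the dimension of the kernel minus that of
  the cokernel, but it makes sense without any dimension count.\<close>

definition index :: "'a \<Rightarrow> complex" where
  "index T = (let S = SOME S. parametrix T S in tr (T * S - 1) - tr (S * T - 1))"

text \<open>Two parametrices differ by some D in the ideal. The two defects then change by T D and D
  T, whose traces agree.\<close>

lemma index_unique:
  assumes "parametrix T S" "parametrix T S'"
  shows "tr (T * S - 1) - tr (S * T - 1) = tr (T * S' - 1) - tr (S' * T - 1)"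
proof -
  define D where "D = S' - S"
  have "D = (S' * T - 1) * S - S' * (T * S - 1)"
    by (simp add: D_def algebra_simps)
  moreover have "\<dots> \<in> J"
    using assms by (intro diff_mem[OF right_mem left_mem]) (auto simp: parametrix_def)
  ultimately have D: "D \<in> J" by simp
  have e: "T * S' - 1 = (T * S - 1) + T * D" "S' * T - 1 = (S * T - 1) + D * T"
    by (simp_all add: D_def algebra_simps)
  have "tr (T * S' - 1) = tr (T * S - 1) + tr (T * D)" "tr (S' * T - 1) = tr (S * T - 1) + tr (D * T)"
    unfolding e using assms
    by (auto intro!: tr_add left_mem[OF D] right_mem[OF D] simp: parametrix_def)
  then show ?thesis
    using tr_comm[OF D, of T] by simp
qed

lemma index_eq:
  assumes "parametrix T S" shows "index T = tr (T * S - 1) - tr (S * T - 1)"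
  unfolding index_def Let_def using someI[of "parametrix T", OF assms] assms
  by (rule index_unique)

text \<open>With N the inverse of 1 + E S, the product S N is a parametrix of T + E. Both defects
  acquire a correction, and the corrections have equal trace because R' S = S R.\<close>

lemma index_perturb:
  assumes P: "parametrix T S" and E: "norm E * norm S < 1"
  shows "index (T + E) = index T"
proof -
  have "norm (E * S) < 1" using norm_mult_ineq[of E S] E by simp
  then obtain N where N: "N * (1 + E * S) = 1" "(1 + E * S) * N = 1" by (rule inverse_one_plus)
  define R R' where "R = T * S - 1" and "R' = S * T - 1"
  have mem: "R \<in> J" "R' \<in> J" using P by (auto simp: parametrix_def R_def R'_def)
  have N1: "N * E * S = 1 - N" using N(1) by (simp add: algebra_simps)
  have N2: "E * S * N = 1 - N" using N(2) by (simp add: algebra_simps)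
  have "(T + E) * (S * N) - 1 = (R + (1 + E * S)) * N - 1"
    by (simp add: R_def algebra_simps)
  also have "\<dots> = R * N" using N(2) by (simp add: algebra_simps)
  also have "\<dots> = R * (1 - (1 - N))" by simp
  also have "\<dots> = R - R * N * E * S" unfolding N1[symmetric] by (simp add: algebra_simps)
  finally have e1: "(T + E) * (S * N) - 1 = R - R * N * E * S" .
  have "S * N = S * (1 - (1 - N))" by simp
  then have NS: "S * N = S - S * N * E * S" unfolding N1[symmetric] by (simp add: algebra_simps)
  have "S * N * (T + E) - 1 = (S - S * N * E * S) * T + S * N * E - 1"
    using NS by (simp add: distrib_left)
  also have "\<dots> = R' - S * N * E * R'"
    by (simp add: R'_def algebra_simps)
  finally have e2: "S * N * (T + E) - 1 = R' - S * N * E * R'" .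
  have P': "parametrix (T + E) (S * N)"
    unfolding parametrix_def e1 e2 using mem by (simp add: diff_mem right_mem left_mem)
  have RS: "R' * S = S * R" by (simp add: R_def R'_def algebra_simps)
  have m: "R * N * E \<in> J" using mem by (intro right_mem)
  have "tr (S * N * E * R') = tr (R' * (S * N * E))" using tr_comm[OF mem(2), of "S * N * E"] by simp
  also have "R' * (S * N * E) = S * (R * N * E)"
    using RS by (simp add: mult.assoc[symmetric])
  also have "tr \<dots> = tr (R * N * E * S)" using tr_comm[OF m] by simp
  finally have "tr (S * N * E * R') = tr (R * N * E * S)" .
  then show ?thesis
    unfolding index_eq[OF P'] index_eq[OF P] e1 e2 R_def[symmetric] R'_def[symmetric]
    using mem m by (simp add: tr_diff right_mem left_mem)
qed

text \<open>Continuity makes the index locally constant, on a neighbourhood of t governed by one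
  parametrix of T t, and the unit interval is connected.\<close>

lemma index_homotopy:
  fixes T :: "real \<Rightarrow> 'a"
  assumes F: "\<And>t. t \<in> {0..1} \<Longrightarrow> fredholm (T t)"
    and T: "\<And>t. t \<in> {0..1} \<Longrightarrow> (T \<longlongrightarrow> T t) (at t within {0..1})"
  shows "index (T 0) = index (T 1)"
proof -
  have "\<forall>\<^sub>F s in at t within {0..1}. index (T t) = index (T s)" if t: "t \<in> {0..1}" for t
  proof -
    obtain S where S: "parametrix (T t) S" using F[OF t] by (auto simp: fredholm_def)
    have "((\<lambda>s. norm (T s - T t) * norm S) \<longlongrightarrow> norm (T t - T t) * norm S) (at t within {0..1})"
      by (intro tendsto_intros T t)
    then have "\<forall>\<^sub>F s in at t within {0..1}. norm (T s - T t) * norm S < 1"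
      by (rule order_tendstoD(2)) simp
    then show ?thesis
    proof (rule eventually_mono)
      fix s assume "norm (T s - T t) * norm S < 1"
      from index_perturb[OF S this] show "index (T t) = index (T s)" by simp
    qed
  qed
  then show ?thesis
    using connected_local_const[of "{0..1::real}" 0 1 "\<lambda>t. index (T t)"] by simp
qed

section \<open>Fredholm elements from inverses modulo the closure of the ideal\<close>

lemma closure_left: "x \<in> closure J \<Longrightarrow> a * x \<in> closure J"
  unfolding closure_sequential
proof clarify
  fix f assume "\<forall>n. f n \<in> J" "f \<longlonglongrightarrow> x"
  then show "\<exists>h. (\<forall>n. h n \<in> J) \<and> h \<longlonglongrightarrow> a * x"
    by (intro exI[of _ "\<lambda>n. a * f n"] conjI allI tendsto_mult_left) (auto intro: left_mem)
qed

lemma closure_right: "x \<in> closure J \<Longrightarrow> x * a \<in> closure J"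
  unfolding closure_sequential
proof clarify
  fix f assume "\<forall>n. f n \<in> J" "f \<longlonglongrightarrow> x"
  then show "\<exists>h. (\<forall>n. h n \<in> J) \<and> h \<longlonglongrightarrow> x * a"
    by (intro exI[of _ "\<lambda>n. f n * a"] conjI allI tendsto_mult_right) (auto intro: right_mem)
qed

lemma closure_add: "x \<in> closure J \<Longrightarrow> y \<in> closure J \<Longrightarrow> x + y \<in> closure J"
  unfolding closure_sequential
proof clarify
  fix f g assume "\<forall>n. f n \<in> J" "f \<longlonglongrightarrow> x" "\<forall>n. g n \<in> J" "g \<longlonglongrightarrow> y"
  then show "\<exists>h. (\<forall>n. h n \<in> J) \<and> h \<longlonglongrightarrow> x + y"
    by (intro exI[of _ "\<lambda>n. f n + g n"]) (auto intro: tendsto_add add_mem)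
qed

lemma closure_diff: "x \<in> closure J \<Longrightarrow> y \<in> closure J \<Longrightarrow> x - y \<in> closure J"
  using closure_add[of x "-y"] closure_left[of y "-1"] by simp

text \<open>The defect is approximated by X in the ideal with an error E of norm below 1.
  Multiplying by the inverse N of 1 + E removes the error and leaves the defect X N.\<close>

lemma right_parametrix:
  assumes "T * S - 1 \<in> closure J" shows "\<exists>R. T * R - 1 \<in> J"
proof -
  obtain X where X: "X \<in> J" "dist X (T * S - 1) < 1"
    using assms by (meson closure_approachable zero_less_one)
  define E where "E = T * S - 1 - X"
  have "norm E < 1" using X(2) by (simp add: E_def dist_norm norm_minus_commute)
  then obtain N where N: "N * (1 + E) = 1" "(1 + E) * N = 1" by (rule inverse_one_plus)
  have "T * (S * N) - 1 = (1 + E + X) * N - 1" by (simp add: E_def mult.assoc)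
  also have "\<dots> = X * N" using N(2) by (simp add: algebra_simps)
  finally show ?thesis using X(1) right_mem by metis
qed

lemma left_parametrix:
  assumes "S * T - 1 \<in> closure J" shows "\<exists>R. R * T - 1 \<in> J"
proof -
  obtain X where X: "X \<in> J" "dist X (S * T - 1) < 1"
    using assms by (meson closure_approachable zero_less_one)
  define E where "E = S * T - 1 - X"
  have "norm E < 1" using X(2) by (simp add: E_def dist_norm norm_minus_commute)
  then obtain N where N: "N * (1 + E) = 1" "(1 + E) * N = 1" by (rule inverse_one_plus)
  have "N * S * T - 1 = N * (1 + E + X) - 1" by (simp add: E_def mult.assoc)
  also have "\<dots> = N * X" using N(1) by (simp add: algebra_simps)
  finally show ?thesis using X(1) left_mem by metis
qed

text \<open>A left inverse B and a right inverse A modulo the ideal coincide modulo it, since both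
  agree there with B T A; hence A is two-sided.\<close>

lemma fredholm_closure:
  assumes "T * S - 1 \<in> closure J" "S * T - 1 \<in> closure J" shows "fredholm T"
proof -
  obtain A B where A: "T * A - 1 \<in> J" and B: "B * T - 1 \<in> J"
    using right_parametrix[OF assms(1)] left_parametrix[OF assms(2)] by blast
  have "A * T - 1 = (B * T - 1) + ((B * (T * A - 1) - (B * T - 1) * A)) * T"
    by (simp add: algebra_simps)
  also have "\<dots> \<in> J" using A B by (intro add_mem[OF _ right_mem[OF diff_mem[OF left_mem right_mem]]])
  finally show ?thesis using A by (auto simp: fredholm_def parametrix_def)
qed

end

section \<open>Hilbert--Schmidt, trace class and compact operators\<close>

subsection \<open>Weighted coordinate substitutions\<close>

text \<open>One constructor for the concrete operators below: projections, scalars, isometries, the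
  generators and the sign operator. It prescribes the coordinates of the image, so basis vectors
  move against \<open>g\<close>.\<close>

definition wop :: "(nat \<Rightarrow> complex) \<Rightarrow> (nat \<Rightarrow> nat) \<Rightarrow> bop" where
  "wop w g = (SOME T. \<forall>x i. coord (app T x) i = w i * coord x (g i))"

text \<open>Where the weight is nonzero \<open>g\<close> is injective, so a finite sum of squared
  image coordinates uses each coordinate of x at most once.\<close>

lemma
  assumes C: "\<And>i. cmod (w i) \<le> C" and g: "inj_on g {i. w i \<noteq> 0}"
  shows coord_wop: "coord (app (wop w g) x) i = w i * coord x (g i)"
    and norm_wop: "norm (wop w g) \<le> C"
proof -
  have C0: "C \<ge> 0" using C[of 0] norm_ge_zero order_trans by blast
  have bd: "(\<Sum>i\<in>A. (cmod (w i * coord x (g i)))\<^sup>2) \<le> (C * norm x)\<^sup>2" if A: "finite A" for A x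
  proof -
    let ?B = "A \<inter> {i. w i \<noteq> 0}"
    have "(\<Sum>i\<in>A. (cmod (w i * coord x (g i)))\<^sup>2) = (\<Sum>i\<in>?B. (cmod (w i * coord x (g i)))\<^sup>2)"
      using A by (intro sum.mono_neutral_right) auto
    also have "\<dots> \<le> (\<Sum>i\<in>?B. C\<^sup>2 * (cmod (coord x (g i)))\<^sup>2)"
      using C by (intro sum_mono) (auto simp: norm_mult power_mult_distrib intro!: mult_right_mono power_mono)
    also have "\<dots> = C\<^sup>2 * (\<Sum>i\<in>g ` ?B. (cmod (coord x i))\<^sup>2)"
      using inj_on_subset[OF g, of ?B] by (simp add: sum.reindex sum_distrib_left)
    also have "\<dots> \<le> C\<^sup>2 * (norm x)\<^sup>2"
      using A by (intro mult_left_mono sum_coord_le) auto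
    finally show ?thesis by (simp add: power_mult_distrib)
  qed
  define f where "f x = Ell2 (\<lambda>i. w i * coord x (g i))" for x
  have l2: "(\<lambda>i. w i * coord x (g i)) \<in> l2 UNIV" and nf: "norm (f x) \<le> C * norm x" for x
    using l2_bounded_sums[OF bd] C0 unfolding f_def by auto
  have cf: "coord (f x) i = w i * coord x (g i)" for x i
    unfolding f_def by (simp add: l2)
  have "\<exists>T. app T = f"
  proof (rule bop_of_linear)
    show "f (x + y) = f x + f y" for x y by (rule ell2_eqI) (simp add: cf distrib_left)
    show "f (cscale c x) = cscale c (f x)" for c x by (rule ell2_eqI) (simp add: cf)
  qed (rule nf)
  then obtain T where T: "app T = f" ..
  then have "\<exists>T. \<forall>x i. coord (app T x) i = w i * coord x (g i)" using cf by auto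
  then have *: "\<forall>x i. coord (app (wop w g) x) i = w i * coord x (g i)"
    unfolding wop_def by (rule someI_ex)
  then show "coord (app (wop w g) x) i = w i * coord x (g i)" by blast
  have "app (wop w g) x = f x" for x using * by (intro ell2_eqI) (simp add: cf)
  then show "norm (wop w g) \<le> C" using nf C0 by (intro norm_bop_bound) auto
qed

definition cproj :: "nat set \<Rightarrow> bop" where
  "cproj I = wop (\<lambda>i. of_bool (i \<in> I)) id"

lemma coord_cproj [simp]: "coord (app (cproj I) x) i = (if i \<in> I then coord x i else 0)"
  unfolding cproj_def by (subst coord_wop[where C=1]) auto

lemma norm_cproj: "norm (cproj I) \<le> 1"
  unfolding cproj_def by (rule norm_wop) auto

lemma cproj_idem: "cproj I * cproj I = cproj I"
  by (intro bop_eqI ell2_eqI) simp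

subsection \<open>Matrix coefficients\<close>

definition matcoef :: "bop \<Rightarrow> nat \<Rightarrow> nat \<Rightarrow> complex" where
  "matcoef T i j = coord (app T (ket j)) i"

lemma coord_sum_ket:
  "finite F \<Longrightarrow> coord (\<Sum>j\<in>F. cscale (c j) (ket j)) i = (if i \<in> F then c i else 0)"
proof -
  assume F: "finite F"
  have "coord (\<Sum>j\<in>F. cscale (c j) (ket j)) i = (\<Sum>j\<in>F. if i = j then c j else 0)"
    unfolding coord_sum by (intro sum.cong) auto
  then show ?thesis using F by simp
qed

text \<open>By Pythagoras the squared distance of x from its truncation to F is the squared norm
  minus the partial sum over F, which tends to zero.\<close>

lemma ell2_has_sum: "((\<lambda>j. cscale (coord x j) (ket j)) has_sum x) UNIV"
proof -
  let ?f = "\<lambda>j. cscale (coord x j) (ket j)"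
  have sq: "(norm (x - sum ?f F))\<^sup>2 = (norm x)\<^sup>2 - (\<Sum>i\<in>F. (cmod (coord x i))\<^sup>2)" if F: "finite F" for F
  proof -
    have c: "coord (sum ?f F) i = (if i \<in> F then coord x i else 0)" for i
      using F by (simp add: coord_sum_ket)
    have s: "((\<lambda>i. if i \<in> F then (cmod (coord x i))\<^sup>2 else 0) has_sum (\<Sum>i\<in>F. (cmod (coord x i))\<^sup>2)) UNIV"
      using F by (intro has_sum_finite_neutralI[where B=F]) auto
    have "(norm x)\<^sup>2 = (\<Sum>\<^sub>\<infinity>i. (cmod (coord (x - sum ?f F) i))\<^sup>2 + (if i \<in> F then (cmod (coord x i))\<^sup>2 else 0))"
      unfolding norm_ell2_sq by (intro infsum_cong) (simp add: c)
    also have "\<dots> = (norm (x - sum ?f F))\<^sup>2 + (\<Sum>i\<in>F. (cmod (coord x i))\<^sup>2)"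
      unfolding norm_ell2_sq infsumI[OF s, symmetric]
      by (rule infsum_add[OF coord_summable has_sum_imp_summable[OF s]])
    finally show ?thesis by simp
  qed
  have "((\<lambda>F. sqrt ((norm x)\<^sup>2 - (\<Sum>i\<in>F. (cmod (coord x i))\<^sup>2))) \<longlongrightarrow> sqrt ((norm x)\<^sup>2 - (norm x)\<^sup>2))
      (finite_subsets_at_top UNIV)"
    by (intro tendsto_intros) (use infsum_tendsto[OF coord_summable[of x]] in \<open>simp add: norm_ell2_sq\<close>)
  moreover have "\<forall>\<^sub>F F in finite_subsets_at_top UNIV.
      sqrt ((norm x)\<^sup>2 - (\<Sum>i\<in>F. (cmod (coord x i))\<^sup>2)) = dist (sum ?f F) x"
    by (rule eventually_finite_subsets_at_top_weakI)
       (simp add: dist_norm norm_minus_commute sq[symmetric])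
  ultimately have "((\<lambda>F. dist (sum ?f F) x) \<longlongrightarrow> 0) (finite_subsets_at_top UNIV)"
    using Lim_transform_eventually by fastforce
  then show ?thesis unfolding has_sum_def by (rule tendsto_dist_iff[THEN iffD2])
qed

lemma bounded_linear_coord: "bounded_linear (\<lambda>x. coord x i)"
  by (rule bounded_linear_intro[where K=1]) (auto simp: norm_coord_le scaleR_conv_of_real)

lemma app_has_sum: "((\<lambda>j. cscale (coord x j) (app T (ket j))) has_sum app T x) UNIV"
  using has_sum_bounded_linear[OF bounded_linear_app ell2_has_sum[of x], of T] by simp

lemma coord_app: "((\<lambda>j. coord x j * matcoef T i j) has_sum coord (app T x) i) UNIV"
  using has_sum_bounded_linear[OF bounded_linear_coord app_has_sum[of x T], of i]
  by (simp add: matcoef_def)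

lemma mat_mult: "((\<lambda>k. matcoef S i k * matcoef T k j) has_sum matcoef (S * T) i j) UNIV"
  using coord_app[of "app T (ket j)" S i] by (simp add: matcoef_def mult.commute)

lemma mat_add: "matcoef (S + T) i j = matcoef S i j + matcoef T i j"
  by (simp add: matcoef_def)

subsection \<open>Hilbert--Schmidt operators\<close>

definition hs :: "bop \<Rightarrow> bool" where
  "hs T \<longleftrightarrow> (\<lambda>j. (norm (app T (ket j)))\<^sup>2) summable_on UNIV"

text \<open>The definition sums over columns. As a double series over the matrix entries the
  condition is symmetric in rows and columns, which replaces passing to the adjoint.\<close>

lemma hs_matrix: "hs T \<longleftrightarrow> (\<lambda>(i, j). (cmod (matcoef T i j))\<^sup>2) summable_on UNIV \<times> UNIV"
proof -
  have c: "(\<Sum>\<^sub>\<infinity>i. (cmod (matcoef T i j))\<^sup>2) = (norm (app T (ket j)))\<^sup>2" for j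
    by (simp add: norm_ell2_sq matcoef_def)
  have d: "(\<lambda>i. (cmod (matcoef T i j))\<^sup>2) summable_on UNIV" for j
    unfolding matcoef_def by (rule coord_summable)
  have "hs T \<longleftrightarrow> (\<lambda>p. norm (case p of (j, i) \<Rightarrow> (cmod (matcoef T i j))\<^sup>2)) summable_on UNIV \<times> UNIV"
    unfolding Infinite_Sum.abs_summable_on_Sigma_iff using c d by (simp add: hs_def)
  also have "\<dots> \<longleftrightarrow> (\<lambda>(j, i). (cmod (matcoef T i j))\<^sup>2) summable_on UNIV \<times> UNIV"
    by (simp add: case_prod_unfold)
  also have "\<dots> \<longleftrightarrow> (\<lambda>(i, j). (cmod (matcoef T i j))\<^sup>2) summable_on UNIV \<times> UNIV"
    using summable_on_swap[of "\<lambda>(j, i). (cmod (matcoef T i j))\<^sup>2" UNIV UNIV] by (simp add: case_prod_unfold)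
  finally show ?thesis .
qed

lemma hs_rows: "hs T \<longleftrightarrow> (\<forall>i. (\<lambda>j. (cmod (matcoef T i j))\<^sup>2) summable_on UNIV) \<and>
   (\<lambda>i. \<Sum>\<^sub>\<infinity>j. (cmod (matcoef T i j))\<^sup>2) summable_on UNIV"
proof -
  have "hs T \<longleftrightarrow> (\<lambda>p. norm (case p of (i, j) \<Rightarrow> (cmod (matcoef T i j))\<^sup>2)) summable_on UNIV \<times> UNIV"
    unfolding hs_matrix by (simp add: case_prod_unfold)
  also have "\<dots> \<longleftrightarrow> (\<forall>i. (\<lambda>j. (cmod (matcoef T i j))\<^sup>2) summable_on UNIV) \<and>
   (\<lambda>i. \<Sum>\<^sub>\<infinity>j. (cmod (matcoef T i j))\<^sup>2) summable_on UNIV"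
    unfolding Infinite_Sum.abs_summable_on_Sigma_iff by (simp add: infsum_nonneg)
  finally show ?thesis .
qed

text \<open>Row i is an l^2 vector, and Cauchy-Schwarz applies to its pairing with x.\<close>

lemma row_bound:
  assumes "(\<lambda>j. (cmod (matcoef T i j))\<^sup>2) summable_on UNIV"
  shows "(cmod (coord (app T x) i))\<^sup>2 \<le> (norm x)\<^sup>2 * (\<Sum>\<^sub>\<infinity>j. (cmod (matcoef T i j))\<^sup>2)"
proof -
  have r: "(\<lambda>j. cnj (matcoef T i j)) \<in> l2 UNIV" using assms by (simp add: l2_def)
  have "coord (app T x) i = l2_inner (coord x) (\<lambda>j. cnj (matcoef T i j))"
    using infsumI[OF coord_app[of x T i]] by (simp add: l2_inner_def)
  then have "cmod (coord (app T x) i) \<le> norm x * l2_norm (\<lambda>j. cnj (matcoef T i j))"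
    using l2_inner_bound[OF coord r, of x] by (simp add: norm_ell2_def)
  then have "(cmod (coord (app T x) i))\<^sup>2 \<le> (norm x * l2_norm (\<lambda>j. cnj (matcoef T i j)))\<^sup>2"
    by (intro power_mono) auto
  then show ?thesis by (simp add: power_mult_distrib l2_norm_def infsum_nonneg)
qed

lemma hs_add: assumes "hs S" "hs T" shows "hs (S + T)"
  unfolding hs_def
proof (rule summable_on_comparison_test)
  show "(\<lambda>j. 2 * (norm (app S (ket j)))\<^sup>2 + 2 * (norm (app T (ket j)))\<^sup>2) summable_on UNIV"
    using assms by (intro summable_on_add summable_on_cmult_right) (auto simp: hs_def)
  show "(norm (app (S + T) (ket j)))\<^sup>2 \<le> 2 * (norm (app S (ket j)))\<^sup>2 + 2 * (norm (app T (ket j)))\<^sup>2" for j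
  proof -
    have "(norm (app (S + T) (ket j)))\<^sup>2 \<le> (norm (app S (ket j)) + norm (app T (ket j)))\<^sup>2"
      by (intro power_mono) (auto intro: norm_triangle_ineq)
    then show ?thesis
      using sum_squares_bound[of "norm (app S (ket j))" "norm (app T (ket j))"] by (simp add: power2_sum)
  qed
qed auto

lemma hs_mult_left: assumes "hs T" shows "hs (A * T)"
  unfolding hs_def
proof (rule summable_on_comparison_test)
  show "(\<lambda>j. (norm A)\<^sup>2 * (norm (app T (ket j)))\<^sup>2) summable_on UNIV"
    using assms by (intro summable_on_cmult_right) (auto simp: hs_def)
  show "(norm (app (A * T) (ket j)))\<^sup>2 \<le> (norm A)\<^sup>2 * (norm (app T (ket j)))\<^sup>2" for j
    unfolding power_mult_distrib[symmetric] by (intro power_mono) (auto intro: norm_app)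
qed auto

text \<open>Adjoints are avoided by duality: the product is tested on the vector y made of the
  conjugates of finitely many entries of its own row. With s the sum to be bounded and R the squared
  row norm of T this gives s^2 \<le> s |A|^2 R, and s cancels.\<close>

lemma row_mult_bound:
  assumes r: "(\<lambda>j. (cmod (matcoef T i j))\<^sup>2) summable_on UNIV" and F: "finite F"
  shows "(\<Sum>j\<in>F. (cmod (matcoef (T * A) i j))\<^sup>2) \<le> (norm A)\<^sup>2 * (\<Sum>\<^sub>\<infinity>j. (cmod (matcoef T i j))\<^sup>2)"
proof -
  define R where "R = (\<Sum>\<^sub>\<infinity>j. (cmod (matcoef T i j))\<^sup>2)"
  define s where "s = (\<Sum>j\<in>F. (cmod (matcoef (T * A) i j))\<^sup>2)"
  define y where "y = (\<Sum>j\<in>F. cscale (cnj (matcoef (T * A) i j)) (ket j))"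
  have s0: "s \<ge> 0" "R \<ge> 0" unfolding s_def R_def by (auto intro: sum_nonneg infsum_nonneg)
  have cy: "coord y j = (if j \<in> F then cnj (matcoef (T * A) i j) else 0)" for j
    unfolding y_def using F by (simp add: coord_sum_ket)
  have "((\<lambda>j. (cmod (coord y j))\<^sup>2) has_sum s) UNIV"
    unfolding s_def using F by (intro has_sum_finite_neutralI[where B=F]) (auto simp: cy)
  then have ny: "(norm y)\<^sup>2 = s" unfolding norm_ell2_sq by (rule infsumI)
  have "((\<lambda>j. coord y j * matcoef (T * A) i j) has_sum (\<Sum>j\<in>F. coord y j * matcoef (T * A) i j)) UNIV"
    using F by (intro has_sum_finite_neutralI[where B=F]) (auto simp: cy)
  then have "coord (app (T * A) y) i = (\<Sum>j\<in>F. coord y j * matcoef (T * A) i j)"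
    using coord_app[of y "T * A" i] has_sum_unique by blast
  also have "\<dots> = (\<Sum>j\<in>F. of_real ((cmod (matcoef (T * A) i j))\<^sup>2))"
    by (intro sum.cong) (simp_all add: cy complex_norm_square mult.commute del: of_real_power)
  finally have "coord (app T (app A y)) i = of_real s" by (simp add: s_def)
  then have "s\<^sup>2 \<le> (norm (app A y))\<^sup>2 * R"
    using row_bound[OF r, of "app A y"] s0 by (simp add: R_def)
  also have "\<dots> \<le> (norm A * norm y)\<^sup>2 * R"
    using s0 by (intro mult_right_mono power_mono norm_app) auto
  also have "\<dots> = s * ((norm A)\<^sup>2 * R)" by (simp add: power_mult_distrib ny)
  finally have "s * s \<le> s * ((norm A)\<^sup>2 * R)" by (simp add: power2_eq_square)
  then have "s \<le> (norm A)\<^sup>2 * R"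
    using s0 by (cases "s = 0") auto
  then show ?thesis by (simp add: s_def R_def)
qed

lemma hs_mult_right: assumes "hs T" shows "hs (T * A)"
proof -
  have r: "(\<lambda>j. (cmod (matcoef T i j))\<^sup>2) summable_on UNIV" for i using assms by (simp add: hs_rows)
  have 1: "(\<lambda>j. (cmod (matcoef (T * A) i j))\<^sup>2) summable_on UNIV" for i
    using row_mult_bound[OF r]
    by (intro nonneg_bdd_above_summable_on) (auto simp: bdd_above_def)
  have "(\<lambda>i. \<Sum>\<^sub>\<infinity>j. (cmod (matcoef (T * A) i j))\<^sup>2) summable_on UNIV"
  proof (rule summable_on_comparison_test)
    show "(\<lambda>i. (norm A)\<^sup>2 * (\<Sum>\<^sub>\<infinity>j. (cmod (matcoef T i j))\<^sup>2)) summable_on UNIV"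
      using assms by (intro summable_on_cmult_right) (simp add: hs_rows)
    show "(\<Sum>\<^sub>\<infinity>j. (cmod (matcoef (T * A) i j))\<^sup>2) \<le> (norm A)\<^sup>2 * (\<Sum>\<^sub>\<infinity>j. (cmod (matcoef T i j))\<^sup>2)" for i
      by (rule infsum_le_finite_sums[OF 1]) (rule row_mult_bound[OF r])
  qed (auto intro: infsum_nonneg)
  with 1 show ?thesis by (simp add: hs_rows)
qed

subsection \<open>Trace class operators\<close>

text \<open>Scalars can be absorbed into a factor, so sums of products suffice. Both the ideal
  property and the trace identity reduce to products of two Hilbert-Schmidt operators.\<close>

inductive_set trace_class :: "bop set" where
  prod: "hs A \<Longrightarrow> hs B \<Longrightarrow> A * B \<in> trace_class"
| add: "X \<in> trace_class \<Longrightarrow> Y \<in> trace_class \<Longrightarrow> X + Y \<in> trace_class"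

definition trace :: "bop \<Rightarrow> complex" where
  "trace T = (\<Sum>\<^sub>\<infinity>i. matcoef T i i)"

lemma hs_pair_summable:
  assumes "hs A" "hs B"
  shows "(\<lambda>(i, k). matcoef A i k * matcoef B k i) summable_on UNIV \<times> UNIV"
proof -
  have "(\<lambda>(i, k). (cmod (matcoef B k i))\<^sup>2) summable_on UNIV \<times> UNIV"
    using assms(2) summable_on_swap[of "\<lambda>(i, j). (cmod (matcoef B i j))\<^sup>2" UNIV UNIV]
    by (simp add: hs_matrix case_prod_unfold)
  moreover have "(\<lambda>(i, k). (cmod (matcoef A i k))\<^sup>2) summable_on UNIV \<times> UNIV"
    using assms(1) by (simp add: hs_matrix)
  moreover note abs_summable_product[of "\<lambda>(i, k). matcoef A i k" "UNIV \<times> UNIV" "\<lambda>(i, k). matcoef B k i"]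
  ultimately have "(\<lambda>x. norm ((case x of (i, k) \<Rightarrow> matcoef A i k) * (case x of (i, k) \<Rightarrow> matcoef B k i))) summable_on UNIV \<times> UNIV"
    by (simp add: case_prod_unfold norm_mult power2_eq_square)
  then show ?thesis by (simp add: case_prod_unfold abs_summable_summable)
qed

text \<open>The double series of the entries is absolutely summable. This justifies reading the
  trace as one sum over pairs, and afterwards exchanging the order of summation.\<close>

lemma trace_prod:
  assumes "hs A" "hs B"
  shows "(\<lambda>i. matcoef (A * B) i i) summable_on UNIV"
    and "trace (A * B) = (\<Sum>\<^sub>\<infinity>(i, k)\<in>UNIV \<times> UNIV. matcoef A i k * matcoef B k i)"
proof -
  have "matcoef (A * B) i i = (\<Sum>\<^sub>\<infinity>k. matcoef A i k * matcoef B k i)" for i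
    using infsumI[OF mat_mult[of A i B i]] by simp
  then show "(\<lambda>i. matcoef (A * B) i i) summable_on UNIV"
    and "trace (A * B) = (\<Sum>\<^sub>\<infinity>(i, k)\<in>UNIV \<times> UNIV. matcoef A i k * matcoef B k i)"
    using summable_on_Sigma_banach[OF hs_pair_summable[OF assms]]
      infsum_Sigma'_banach[OF hs_pair_summable[OF assms]]
    unfolding trace_def by simp_all
qed

lemma trace_prod_comm:
  assumes "hs A" "hs B" shows "trace (A * B) = trace (B * A)"
proof -
  have "trace (A * B) = (\<Sum>\<^sub>\<infinity>i. \<Sum>\<^sub>\<infinity>k. matcoef A i k * matcoef B k i)"
    unfolding trace_prod(2)[OF assms] using infsum_Sigma'_banach[OF hs_pair_summable[OF assms]] by simp
  also have "\<dots> = (\<Sum>\<^sub>\<infinity>k. \<Sum>\<^sub>\<infinity>i. matcoef B k i * matcoef A i k)"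
    using infsum_swap_banach[OF hs_pair_summable[OF assms]] by (simp add: mult.commute)
  also have "\<dots> = trace (B * A)"
    unfolding trace_prod(2)[OF assms(2,1)]
    using infsum_Sigma'_banach[OF hs_pair_summable[OF assms(2,1)]] by simp
  finally show ?thesis .
qed

lemma trace_class_summable: "X \<in> trace_class \<Longrightarrow> (\<lambda>i. matcoef X i i) summable_on UNIV"
  by (induction rule: trace_class.induct) (auto simp: mat_add intro: trace_prod summable_on_add)

lemma trace_add: "X \<in> trace_class \<Longrightarrow> Y \<in> trace_class \<Longrightarrow> trace (X + Y) = trace X + trace Y"
  unfolding trace_def mat_add by (intro infsum_add trace_class_summable)

lemma hs_zero: "hs 0"
  by (simp add: hs_def)

lemma trace_class_mult:
  assumes "X \<in> trace_class"
  shows "A * X \<in> trace_class \<and> X * A \<in> trace_class \<and> trace (X * A) = trace (A * X)"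
  using assms
proof induction
  case (prod B C)
  \<comment> \<open>A travels around in two exchanges of Hilbert-Schmidt factors: first B with C A,
    then C with A B.\<close>
  have "trace (B * (C * A)) = trace (C * A * B)" using prod by (intro trace_prod_comm hs_mult_right)
  also have "\<dots> = trace (C * (A * B))" by (simp add: mult.assoc)
  also have "\<dots> = trace (A * B * C)" using prod by (intro trace_prod_comm hs_mult_left)
  finally have "trace (B * C * A) = trace (A * (B * C))" by (simp add: mult.assoc)
  moreover have "A * (B * C) \<in> trace_class" "B * C * A \<in> trace_class"
    using trace_class.prod[OF hs_mult_left[OF prod(1)] prod(2), of A]
      trace_class.prod[OF prod(1) hs_mult_right[OF prod(2)], of A] by (simp_all add: mult.assoc)
  ultimately show ?case by simp
next
  case (add X Y)
  then show ?case by (simp add: distrib_left distrib_right trace_add trace_class.add)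
qed

interpretation TC: traced_ideal trace_class trace
proof
  show "0 \<in> trace_class" using trace_class.prod[OF hs_zero hs_zero] by simp
qed (use trace_class_mult in \<open>auto intro: trace_class.add trace_add\<close>)

subsection \<open>Compactness\<close>

lemma hs_cproj: "finite I \<Longrightarrow> hs (cproj I)"
  unfolding hs_def
proof (rule finite_nonzero_values_imp_summable_on)
  assume "finite I"
  moreover have "app (cproj I) (ket j) = 0" if "j \<notin> I" for j
    using that by (intro ell2_eqI) simp
  then have "{j \<in> UNIV. (norm (app (cproj I) (ket j)))\<^sup>2 \<noteq> 0} \<subseteq> I" by auto
  ultimately show "finite {j \<in> UNIV. (norm (app (cproj I) (ket j)))\<^sup>2 \<noteq> 0}" by (rule finite_subset[rotated])
qed

lemma app_cproj_finite: "finite I \<Longrightarrow> app (cproj I) x = (\<Sum>j\<in>I. cscale (coord x j) (ket j))"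
  by (rule ell2_eqI) (simp add: coord_sum_ket)

lemma cproj_tendsto: "(\<lambda>n. app (cproj {..<n}) x) \<longlonglongrightarrow> x"
proof -
  have "filterlim lessThan (finite_subsets_at_top (UNIV :: nat set)) sequentially"
    by (rule filterlim_lessThan_at_top)
  with ell2_has_sum[of x] have "((\<lambda>n. \<Sum>j\<in>{..<n}. cscale (coord x j) (ket j)) \<longlongrightarrow> x) sequentially"
    unfolding has_sum_def by (rule filterlim_compose)
  then show ?thesis by (simp add: app_cproj_finite)
qed

text \<open>If T kept a distance from the trace class, it would keep it from all its truncations.
  Vectors in the unit ball witnessing this have a subsequence with convergent images; since the
  truncations of the limit y converge to y, this is a contradiction.\<close>

lemma compact_imp_closure:
  assumes T: "\<And>s. (\<And>n. norm (s n) \<le> 1) \<Longrightarrow> \<exists>r y. strict_mono (r :: nat \<Rightarrow> nat) \<and> (\<lambda>n. app T (s (r n))) \<longlonglongrightarrow> y"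
  shows "T \<in> closure trace_class"
proof (rule ccontr)
  assume "T \<notin> closure trace_class"
  then obtain e where e: "e > 0" "\<forall>X\<in>trace_class. \<not> dist X T < e"
    unfolding closure_approachable by blast
  have "\<exists>x. norm x \<le> 1 \<and> norm (app (T - cproj {..<n} * T) x) \<ge> e / 2" for n
  proof -
    let ?U = "T - cproj {..<n} * T"
    \<comment> \<open>Doubling the projection exhibits the truncation as a product of two
      Hilbert-Schmidt operators.\<close>
    have "cproj {..<n} * (cproj {..<n} * T) \<in> trace_class"
      by (intro trace_class.prod hs_mult_right hs_cproj) auto
    then have "cproj {..<n} * T \<in> trace_class" by (simp add: mult.assoc[symmetric] cproj_idem)
    then have "\<not> norm ?U \<le> e / 2" using e by (force simp: dist_norm norm_minus_commute)
    then obtain x where x: "norm (app ?U x) > e / 2 * norm x"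
      using norm_bop_bound[of "e / 2" ?U] e(1) by (meson half_gt_zero less_imp_le not_le)
    then have x0: "norm x > 0" using norm_app[of ?U x] by (cases "x = 0") auto
    let ?x = "(1 / norm x) *\<^sub>R x"
    have "norm ?x \<le> 1" using x0 by simp
    moreover have "norm (app ?U ?x) \<ge> e / 2" using x x0 by (simp add: field_simps del: app_simps(3,4,6))
    ultimately show ?thesis by blast
  qed
  then obtain s where s: "\<And>n. norm (s n) \<le> 1" "\<And>n. norm (app (T - cproj {..<n} * T) (s n)) \<ge> e / 2"
    by metis
  obtain r y where r: "strict_mono (r :: nat \<Rightarrow> nat)" "(\<lambda>n. app T (s (r n))) \<longlonglongrightarrow> y"
    using T[of s, OF s(1)] by blast
  \<comment> \<open>The tail projection is applied to y and to the difference from y separately; the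
    latter costs a factor of at most 2.\<close>
  have bd: "e / 2 \<le> 2 * norm (app T (s (r n)) - y) + norm (y - app (cproj {..<r n}) y)" for n
  proof -
    let ?P = "app (cproj {..<r n})" and ?z = "app T (s (r n))"
    have "app (T - cproj {..<r n} * T) (s (r n)) = (?z - y) - ?P (?z - y) + (y - ?P y)" by simp
    then have "e / 2 \<le> norm ((?z - y) - ?P (?z - y) + (y - ?P y))" using s(2)[of "r n"] by simp
    also have "\<dots> \<le> norm ((?z - y) - ?P (?z - y)) + norm (y - ?P y)" by (rule norm_triangle_ineq)
    also have "norm ((?z - y) - ?P (?z - y)) \<le> norm (?z - y) + norm (?P (?z - y))" by (rule norm_triangle_ineq4)
    also have "norm (?P (?z - y)) \<le> 1 * norm (?z - y)"
      using norm_app[of "cproj {..<r n}" "?z - y"] norm_cproj[of "{..<r n}"]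
      by (meson mult_right_mono norm_ge_zero order_trans)
    finally show ?thesis by simp
  qed
  have "(\<lambda>n. 2 * norm (app T (s (r n)) - y) + norm (y - app (cproj {..<r n}) y)) \<longlonglongrightarrow> 2 * norm (y - y) + norm (y - y)"
    by (intro tendsto_intros r(2) LIMSEQ_subseq_LIMSEQ[OF cproj_tendsto r(1), unfolded o_def])
  from tendsto_lowerbound[OF this always_eventually[OF allI[OF bd]]] show False using e(1) by simp
qed

text \<open>Deleting the first n rows leaves an operator whose norm is at most the root of the tail
  \<open>t n\<close> of the series of squared row norms.\<close>

lemma hs_cproj_tendsto: assumes "hs A" shows "(\<lambda>n. cproj {..<n} * A) \<longlonglongrightarrow> A"
proof -
  define r where "r i = (\<Sum>\<^sub>\<infinity>j. (cmod (matcoef A i j))\<^sup>2)" for i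
  have rs: "r summable_on UNIV" and row: "\<And>i. (\<lambda>j. (cmod (matcoef A i j))\<^sup>2) summable_on UNIV"
    using assms by (simp_all add: hs_rows r_def[abs_def])
  have r0: "r i \<ge> 0" for i unfolding r_def by (rule infsum_nonneg) auto
  define t where "t n = infsum r UNIV - (\<Sum>i<n. r i)" for n
  have t0: "t n \<ge> 0" for n
    using finite_sum_le_infsum[OF rs, of "{..<n}"] r0 by (simp add: t_def)
  have bd: "norm (A - cproj {..<n} * A) \<le> sqrt (t n)" for n
  proof (rule norm_bop_bound)
    fix x
    let ?y = "app (A - cproj {..<n} * A) x"
    have cy: "coord ?y i = (if i < n then 0 else coord (app A x) i)" for i by simp
    have "(\<Sum>i\<in>F. (cmod (coord ?y i))\<^sup>2) \<le> (sqrt (t n) * norm x)\<^sup>2" if F: "finite F" for F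
    proof -
      have "(\<Sum>i\<in>F. (cmod (coord ?y i))\<^sup>2) = (\<Sum>i\<in>F - {..<n}. (cmod (coord (app A x) i))\<^sup>2)"
        using F by (intro sum.mono_neutral_cong_right) (auto simp: cy)
      also have "\<dots> \<le> (\<Sum>i\<in>F - {..<n}. (norm x)\<^sup>2 * r i)"
        unfolding r_def by (intro sum_mono row_bound row)
      also have "\<dots> = (norm x)\<^sup>2 * (\<Sum>i\<in>F - {..<n}. r i)" by (simp add: sum_distrib_left)
      also have "\<dots> \<le> (norm x)\<^sup>2 * t n"
      proof (rule mult_left_mono)
        have "(\<Sum>i\<in>F - {..<n}. r i) + (\<Sum>i<n. r i) = sum r ((F - {..<n}) \<union> {..<n})"
          using F by (intro sum.union_disjoint[symmetric]) auto
        also have "\<dots> \<le> infsum r UNIV" using F r0 by (intro finite_sum_le_infsum[OF rs]) auto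
        finally show "(\<Sum>i\<in>F - {..<n}. r i) \<le> t n" by (simp add: t_def)
      qed simp
      also have "\<dots> = (sqrt (t n) * norm x)\<^sup>2" using t0[of n] by (simp add: power_mult_distrib)
      finally show ?thesis .
    qed
    then have "norm (Ell2 (coord ?y)) \<le> sqrt (t n) * norm x"
      using t0 by (intro l2_bounded_sums(2)) auto
    then show "norm ?y \<le> sqrt (t n) * norm x" by (simp add: coord_inverse)
  qed (use t0 in auto)
  have "(\<lambda>n. \<Sum>i<n. r i) \<longlonglongrightarrow> infsum r UNIV"
    using has_sum_imp_sums[OF has_sum_infsum[OF rs]] by (simp add: sums_def)
  then have "(\<lambda>n. sqrt (t n)) \<longlonglongrightarrow> sqrt (infsum r UNIV - infsum r UNIV)"
    unfolding t_def by (intro tendsto_intros)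
  then have "(\<lambda>n. sqrt (t n)) \<longlonglongrightarrow> 0" by simp
  then have "(\<lambda>n. A - cproj {..<n} * A) \<longlonglongrightarrow> 0"
    by (rule Lim_null_comparison[rotated]) (use bd in auto)
  then have "(\<lambda>n. A - (A - cproj {..<n} * A)) \<longlonglongrightarrow> A - 0" by (intro tendsto_intros)
  then show ?thesis by simp
qed

text \<open>On products of Hilbert-Schmidt operators the convergence is inherited from the left
  factor. Truncation is contractive, so it survives norm limits.\<close>

lemma closure_cproj_tendsto: assumes "T \<in> closure trace_class" shows "(\<lambda>n. cproj {..<n} * T) \<longlonglongrightarrow> T"
proof (rule metric_LIMSEQ_I)
  fix e :: real assume e: "e > 0"
  have tc: "(\<lambda>n. cproj {..<n} * X) \<longlonglongrightarrow> X" if "X \<in> trace_class" for X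
    using that
  proof induction
    case (prod A B)
    from tendsto_mult[OF hs_cproj_tendsto[OF prod(1)] tendsto_const[of B]]
    show ?case by (simp add: mult.assoc)
  next
    case (add X Y)
    from tendsto_add[OF add.IH] show ?case by (simp add: distrib_left)
  qed
  obtain X where X: "X \<in> trace_class" "dist X T < e / 3"
    using assms e by (meson closure_approachable divide_pos_pos zero_less_numeral)
  obtain N where N: "\<And>n. n \<ge> N \<Longrightarrow> dist (cproj {..<n} * X) X < e / 3"
    using metric_LIMSEQ_D[OF tc[OF X(1)], of "e / 3"] e by auto
  have "dist (cproj {..<n} * T) T < e" if "n \<ge> N" for n
  proof -
    have "dist (cproj {..<n} * T) (cproj {..<n} * X) \<le> norm (cproj {..<n}) * norm (T - X)"
      unfolding dist_norm right_diff_distrib[symmetric] by (rule norm_mult_ineq)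
    also have "\<dots> \<le> 1 * norm (T - X)" by (intro mult_right_mono norm_cproj) auto
    finally have "dist (cproj {..<n} * T) (cproj {..<n} * X) < e / 3"
      using X(2) by (simp add: dist_norm norm_minus_commute)
    then show ?thesis
      using N[OF that] X(2) dist_triangle[of "cproj {..<n} * T" T "cproj {..<n} * X"]
        dist_triangle[of "cproj {..<n} * X" T X] by linarith
  qed
  then show "\<exists>N. \<forall>n\<ge>N. dist (cproj {..<n} * T) T < e" by blast
qed

lemma bounded_coordinates_subsequence:
  fixes f :: "nat \<Rightarrow> nat \<Rightarrow> complex"
  assumes "\<And>n i. cmod (f n i) \<le> M"
  obtains k where "strict_mono (k :: nat \<Rightarrow> nat)" "\<And>i. \<exists>l. (\<lambda>n. f (k n) i) \<longlonglongrightarrow> l"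
proof -
  interpret subseqs "\<lambda>i s. \<exists>l. (\<lambda>n. f (s n) i) \<longlonglongrightarrow> l"
  proof
    fix i and s :: "nat \<Rightarrow> nat"
    have "bounded (range (\<lambda>n. f (s n) i))"
      using assms by (auto simp: bounded_iff)
    then show "\<exists>r. strict_mono r \<and> (\<exists>l. (\<lambda>n. f ((s \<circ> r) n) i) \<longlonglongrightarrow> l)"
      using bounded_imp_convergent_subsequence by (force simp: o_def)
  qed
  \<comment> \<open>The diagonal sequence is guaranteed to be a subsequence of the one selected for
    coordinate i only from position i + 1 on; the shift is undone afterwards.\<close>
  have "\<exists>l. (\<lambda>n. f ((diagseq \<circ> (+) (Suc i)) n) i) \<longlonglongrightarrow> l" for i
  proof (rule diagseq_holds)
    fix r s :: "nat \<Rightarrow> nat" and n assume "strict_mono r" "\<exists>l. (\<lambda>m. f (s m) n) \<longlonglongrightarrow> l"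
    then show "\<exists>l. (\<lambda>m. f ((s \<circ> r) m) n) \<longlonglongrightarrow> l"
      using LIMSEQ_subseq_LIMSEQ by (fastforce simp: o_def)
  qed
  then have "\<exists>l. (\<lambda>n. f (diagseq n) i) \<longlonglongrightarrow> l" for i
    using LIMSEQ_offset[of "\<lambda>n. f (diagseq n) i" "Suc i"] by (fastforce simp: o_def add.commute)
  then show ?thesis using that subseq_diagseq by blast
qed

text \<open>Coordinates of the images are bounded, so along a diagonal subsequence each converges.
  Finite truncations then converge in norm, and T is uniformly close to its truncations on the unit
  ball.\<close>

lemma closure_imp_compact:
  assumes T: "T \<in> closure trace_class" and s: "\<And>n. norm (s n) \<le> 1"
  shows "\<exists>r y. strict_mono (r :: nat \<Rightarrow> nat) \<and> (\<lambda>n. app T (s (r n))) \<longlonglongrightarrow> y"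
proof -
  have "cmod (coord (app T (s n)) i) \<le> norm T" for n i
  proof -
    have "cmod (coord (app T (s n)) i) \<le> norm T * norm (s n)"
      by (rule order_trans[OF norm_coord_le norm_app])
    also have "\<dots> \<le> norm T * 1" by (intro mult_left_mono s) auto
    finally show ?thesis by simp
  qed
  then obtain k where k: "strict_mono (k :: nat \<Rightarrow> nat)" "\<And>i. \<exists>l. (\<lambda>n. coord (app T (s (k n))) i) \<longlonglongrightarrow> l"
    using bounded_coordinates_subsequence[of "\<lambda>n i. coord (app T (s n)) i" "norm T"] by blast
  define y where "y n = app T (s (k n))" for n
  obtain l where l: "\<And>i. (\<lambda>n. coord (y n) i) \<longlonglongrightarrow> l i" using k(2) unfolding y_def by metis
  have cs: "bounded_linear (\<lambda>c. cscale c x)" for x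
    by (rule bounded_linear_intro[where K="norm x"])
       (auto intro!: ell2_eqI simp: norm_cscale distrib_right scaleR_conv_of_real)
  have "(\<lambda>n. app (cproj {..<m}) (y n)) \<longlonglongrightarrow> (\<Sum>j<m. cscale (l j) (ket j))" for m
    unfolding app_cproj_finite[OF finite_lessThan]
    by (intro tendsto_sum bounded_linear.tendsto[OF cs l])
  then have C: "Cauchy (\<lambda>n. app (cproj {..<m}) (y n))" for m by (rule LIMSEQ_imp_Cauchy)
  have "Cauchy y"
  proof (rule metric_CauchyI)
    fix e :: real assume e: "e > 0"
    then obtain m where m: "dist (cproj {..<m} * T) T < e / 3"
      using metric_LIMSEQ_D[OF closure_cproj_tendsto[OF T], of "e / 3"] by auto
    have *: "dist (y n) (app (cproj {..<m}) (y n)) < e / 3" for n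
    proof -
      have "dist (y n) (app (cproj {..<m}) (y n)) = norm (app (T - cproj {..<m} * T) (s (k n)))"
        by (simp add: y_def dist_norm)
      also have "\<dots> \<le> norm (T - cproj {..<m} * T) * norm (s (k n))" by (rule norm_app)
      also have "\<dots> \<le> norm (T - cproj {..<m} * T) * 1" by (intro mult_left_mono s) auto
      finally show ?thesis using m by (simp add: dist_norm norm_minus_commute)
    qed
    obtain M where M: "\<forall>p\<ge>M. \<forall>n\<ge>M. dist (app (cproj {..<m}) (y p)) (app (cproj {..<m}) (y n)) < e / 3"
      using C[of m] e by (meson Cauchy_def divide_pos_pos zero_less_numeral)
    have "dist (y p) (y n) < e" if "p \<ge> M" "n \<ge> M" for p n
      using spec[OF M, of p] that *[of p] *[of n] dist_commute[of "app (cproj {..<m}) (y n)" "y n"]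
        dist_triangle[of "y p" "y n" "app (cproj {..<m}) (y p)"]
        dist_triangle[of "app (cproj {..<m}) (y p)" "y n" "app (cproj {..<m}) (y n)"]
      by auto
    then show "\<exists>M. \<forall>p\<ge>M. \<forall>n\<ge>M. dist (y p) (y n) < e" by blast
  qed
  then obtain z where "y \<longlonglongrightarrow> z" using Cauchy_convergent convergent_def by blast
  then show ?thesis using k(1) unfolding y_def by blast
qed

section \<open>The free algebra and its quotient\<close>

subsection \<open>Linear extension from words\<close>

text \<open>The involution, the coproduct, evaluation on tensors and the index on formal sums of
  modules are all of this form. The coefficient is an argument of f rather than a factor, which
  admits conjugate-linear maps.\<close>

definition lin_ext :: "('a \<Rightarrow> 'b \<Rightarrow> 'c) \<Rightarrow> ('a \<Rightarrow>\<^sub>0 'b::zero) \<Rightarrow> 'c::comm_monoid_add" where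
  "lin_ext f x = (\<Sum>w\<in>Poly_Mapping.keys x. f w (Poly_Mapping.lookup x w))"

lemma lin_ext_superset:
  assumes "\<And>w. f w 0 = 0" "finite K" "Poly_Mapping.keys x \<subseteq> K"
  shows "lin_ext f x = (\<Sum>w\<in>K. f w (Poly_Mapping.lookup x w))"
  unfolding lin_ext_def using assms
  by (intro sum.mono_neutral_left) (auto simp: not_in_keys_iff_lookup_eq_zero)

lemma lin_ext_zero [simp]: "lin_ext f 0 = 0"
  by (simp add: lin_ext_def)

lemma lin_ext_single: "(\<And>w. f w 0 = 0) \<Longrightarrow> lin_ext f (Poly_Mapping.single w c) = f w c"
  by (subst lin_ext_superset[where K="{w}"]) auto

lemma lin_ext_add:
  assumes f: "\<And>w. f w 0 = 0" "\<And>w a b. f w (a + b) = f w a + f w b"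
  shows "lin_ext f (x + y) = lin_ext f x + lin_ext f y"
proof -
  let ?K = "Poly_Mapping.keys x \<union> Poly_Mapping.keys y"
  have "lin_ext f z = (\<Sum>w\<in>?K. f w (Poly_Mapping.lookup z w))" if "Poly_Mapping.keys z \<subseteq> ?K" for z
    using that by (intro lin_ext_superset f) auto
  then show ?thesis
    using Poly_Mapping.keys_add[of x y] by (simp add: lookup_add f sum.distrib)
qed

lemma lin_ext_sum:
  assumes f: "\<And>w. f w 0 = 0" "\<And>w a b. f w (a + b) = f w a + f w b"
  shows "lin_ext f (sum g K) = (\<Sum>k\<in>K. lin_ext f (g k))"
  by (induction K rule: infinite_finite_induct) (simp_all add: lin_ext_add[where f=f, OF f])

lemma poly_mapping_expand: "(x :: 'a \<Rightarrow>\<^sub>0 'b::comm_monoid_add) = (\<Sum>w\<in>Poly_Mapping.keys x. Poly_Mapping.single w (Poly_Mapping.lookup x w))"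
proof (rule poly_mapping_eqI)
  fix k
  have "(\<Sum>w\<in>Poly_Mapping.keys x. Poly_Mapping.lookup (Poly_Mapping.single w (Poly_Mapping.lookup x w)) k)
     = (\<Sum>w\<in>Poly_Mapping.keys x. if w = k then Poly_Mapping.lookup x k else 0)"
    by (intro sum.cong) (auto simp: lookup_single when_def)
  then show "Poly_Mapping.lookup x k = Poly_Mapping.lookup (\<Sum>w\<in>Poly_Mapping.keys x. Poly_Mapping.single w (Poly_Mapping.lookup x w)) k"
    by (simp add: lookup_sum not_in_keys_iff_lookup_eq_zero)
qed

lemma poly_mapping_induct [case_names zero single add]:
  assumes "P 0" "\<And>w c. P (Poly_Mapping.single w c)" "\<And>x y. P x \<Longrightarrow> P y \<Longrightarrow> P (x + y)"
  shows "P (x :: 'a \<Rightarrow>\<^sub>0 'b::comm_monoid_add)"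
proof -
  have "P (\<Sum>w\<in>K. Poly_Mapping.single w (Poly_Mapping.lookup x w))" for K
    by (induction K rule: infinite_finite_induct) (use assms in auto)
  then show ?thesis using poly_mapping_expand[of x] by metis
qed

text \<open>Cancellation in the target forces both maps to vanish at zero, the base case of the
  induction over monomials. Multiplicativity statements are reduced to words in this way.\<close>

lemma additive_ext:
  fixes F G :: "('a \<Rightarrow>\<^sub>0 'b::comm_monoid_add) \<Rightarrow> 'c::cancel_comm_monoid_add"
  assumes "\<And>x y. F (x + y) = F x + F y" "\<And>x y. G (x + y) = G x + G y"
    "\<And>w c. F (Poly_Mapping.single w c) = G (Poly_Mapping.single w c)"
  shows "F x = G x"
proof (induction x rule: poly_mapping_induct)
  case zero
  have "F 0 + F 0 = F 0 + 0" "G 0 + G 0 = G 0 + 0" using assms(1,2)[of 0 0] by simp_all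
  then show ?case by (metis add_left_cancel)
qed (use assms in simp_all)

lemma list_plus [simp]: "u + v = u @ v" for u v :: "'a list"
  by (simp add: plus_list_def)

lemma list_zero [simp]: "(0 :: 'a list) = []"
  by (simp add: zero_list_def)

subsection \<open>The involution\<close>

lemma free_star_lin: "free_star = lin_ext (\<lambda>w c. Poly_Mapping.single (rev (map gen_star w)) (cnj c))"
  by (rule ext) (simp add: free_star_def lin_ext_def)

lemma free_star_add: "free_star (x + y) = free_star x + free_star y"
  unfolding free_star_lin by (rule lin_ext_add) (auto simp: single_add)

lemma free_star_single:
  "free_star (Poly_Mapping.single w c) = Poly_Mapping.single (rev (map gen_star w)) (cnj c)"
  unfolding free_star_lin by (rule lin_ext_single) auto

lemma free_star_zero [simp]: "free_star 0 = 0"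
  by (simp add: free_star_lin)

lemma free_star_diff: "free_star (x - y) = free_star x - free_star y"
  using free_star_add[of "x - y" y] by (simp add: algebra_simps)

lemma free_star_one [simp]: "free_star 1 = 1"
  using free_star_single[of "[]" 1] single_one[where 'a="gen list" and 'b=complex] by simp

lemma free_star_mult: "free_star (x * y) = free_star y * free_star x"
proof -
  have "free_star (x * Poly_Mapping.single w c) = free_star (Poly_Mapping.single w c) * free_star x" for w c
    by (rule additive_ext[of "\<lambda>x. free_star (x * Poly_Mapping.single w c)"])
       (simp_all add: free_star_add distrib_left distrib_right mult_single free_star_single mult.commute)
  note single = this
  show ?thesis
    by (rule additive_ext[of "\<lambda>y. free_star (x * y)"])
       (simp_all add: free_star_add distrib_left distrib_right single)
qed

lemma gen_star_star [simp]: "gen_star (gen_star g) = g"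
  by (cases g) auto

lemma free_star_star [simp]: "free_star (free_star x) = x"
  by (rule additive_ext[of "\<lambda>x. free_star (free_star x)"])
     (simp_all add: free_star_add free_star_single rev_map comp_def)

subsection \<open>The defining ideal\<close>

lemma ring_free: "ring free_star_alg"
proof (rule ringI)
  show "abelian_group free_star_alg"
    by (rule abelian_groupI) (auto simp: free_star_alg_def algebra_simps intro: exI[of _ "- _"])
  show "Group.monoid free_star_alg"
    by (rule monoidI) (auto simp: free_star_alg_def algebra_simps)
qed (auto simp: free_star_alg_def algebra_simps)

lemma free_minus: "a \<ominus>\<^bsub>free_star_alg\<^esub> b = a - b"
proof -
  interpret ring free_star_alg by (rule ring_free)
  have "\<ominus>\<^bsub>free_star_alg\<^esub> b = - b"
    by (rule minus_equality) (auto simp: free_star_alg_def)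
  then show ?thesis by (simp add: a_minus_def) (simp add: free_star_alg_def)
qed

abbreviation relators :: "real \<Rightarrow> free_alg set" where
  "relators q \<equiv> suq2_relators q \<union> free_star ` suq2_relators q"

lemma suq2_ideal: "ideal (suq2_ideal q) free_star_alg"
  unfolding suq2_ideal_def
  by (rule ring.genideal_ideal[OF ring_free]) (simp add: free_star_alg_def)

text \<open>Turns claims about the whole ideal into checks on the relators. The set contains zero
  because there is a relator, and negatives because of multiplication by -1.\<close>

lemma suq2_ideal_minimal:
  assumes "\<And>x y. x \<in> I \<Longrightarrow> y \<in> I \<Longrightarrow> x + y \<in> I" "\<And>a x. x \<in> I \<Longrightarrow> a * x \<in> I" "\<And>a x. x \<in> I \<Longrightarrow> x * a \<in> I"
    "relators q \<subseteq> I"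
  shows "suq2_ideal q \<subseteq> I"
proof -
  have ne: "0 \<in> I" using assms(4) assms(2)[of _ 0] by (auto simp: suq2_relators_def)
  interpret ring free_star_alg by (rule ring_free)
  have "ideal I free_star_alg"
  proof (rule idealI[OF ring_free])
    show "subgroup I (add_monoid free_star_alg)"
    proof (rule group.subgroupI)
      show "group (add_monoid free_star_alg)" by (rule add.is_group)
      show "inv\<^bsub>add_monoid free_star_alg\<^esub> x \<in> I" if "x \<in> I" for x
      proof -
        have "inv\<^bsub>add_monoid free_star_alg\<^esub> x = 0 \<ominus>\<^bsub>free_star_alg\<^esub> x"
          unfolding a_minus_def a_inv_def[symmetric] using a_inv_closed[of x] l_zero[of "\<ominus>\<^bsub>free_star_alg\<^esub> x"]
          by (simp add: free_star_alg_def)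
        also have "\<dots> = (-1) * x" by (simp add: free_minus)
        finally show ?thesis using assms(2)[OF that, of "-1"] by simp
      qed
    qed (use assms ne in \<open>auto simp: free_star_alg_def\<close>)
  qed (use assms in \<open>auto simp: free_star_alg_def\<close>)
  then show ?thesis unfolding suq2_ideal_def using assms(4) by (rule genideal_minimal)
qed

lemma ideal_add: "x \<in> suq2_ideal q \<Longrightarrow> y \<in> suq2_ideal q \<Longrightarrow> x + y \<in> suq2_ideal q"
  and ideal_left: "x \<in> suq2_ideal q \<Longrightarrow> a * x \<in> suq2_ideal q"
  and ideal_right: "x \<in> suq2_ideal q \<Longrightarrow> x * a \<in> suq2_ideal q"
  and ideal_zero: "0 \<in> suq2_ideal q"
  and relators_ideal: "relators q \<subseteq> suq2_ideal q"
proof -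
  interpret ideal "suq2_ideal q" free_star_alg by (rule suq2_ideal)
  show "x \<in> suq2_ideal q \<Longrightarrow> y \<in> suq2_ideal q \<Longrightarrow> x + y \<in> suq2_ideal q"
    using additive_subgroup.a_closed[OF additive_subgroup_axioms, of x y] by (simp add: free_star_alg_def)
  show "x \<in> suq2_ideal q \<Longrightarrow> a * x \<in> suq2_ideal q" "x \<in> suq2_ideal q \<Longrightarrow> x * a \<in> suq2_ideal q"
    using I_l_closed[of x a] I_r_closed[of x a] by (simp_all add: free_star_alg_def)
  show "0 \<in> suq2_ideal q" using additive_subgroup.zero_closed[OF additive_subgroup_axioms] by (simp add: free_star_alg_def)
  show "relators q \<subseteq> suq2_ideal q"
    unfolding suq2_ideal_def by (rule genideal_self) (simp add: free_star_alg_def)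
qed

lemma ideal_uminus: "x \<in> suq2_ideal q \<Longrightarrow> - x \<in> suq2_ideal q"
  using ideal_left[of x q "-1"] by simp

lemma ideal_diff: "x \<in> suq2_ideal q \<Longrightarrow> y \<in> suq2_ideal q \<Longrightarrow> x - y \<in> suq2_ideal q"
  using ideal_add[of x q "-y"] ideal_uminus[of y q] by simp

text \<open>The generating set is closed under the involution, which exchanges left and right
  multiplication.\<close>

lemma ideal_star: "x \<in> suq2_ideal q \<Longrightarrow> free_star x \<in> suq2_ideal q"
proof -
  have "suq2_ideal q \<subseteq> {x. free_star x \<in> suq2_ideal q}"
    using relators_ideal[of q]
    by (intro suq2_ideal_minimal) (auto simp: free_star_add free_star_mult ideal_add ideal_left ideal_right)
  then show "x \<in> suq2_ideal q \<Longrightarrow> free_star x \<in> suq2_ideal q" by auto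
qed

subsection \<open>The quotient algebra\<close>

lemma mem_class: "y \<in> suq2_class q x \<longleftrightarrow> y - x \<in> suq2_ideal q"
  unfolding a_r_coset_def' by (auto simp: free_star_alg_def intro!: bexI[of _ "y - x"])

lemma class_eq_iff: "suq2_class q x = suq2_class q y \<longleftrightarrow> x - y \<in> suq2_ideal q"
proof
  assume "suq2_class q x = suq2_class q y"
  moreover have "x \<in> suq2_class q x" by (simp add: mem_class ideal_zero)
  ultimately show "x - y \<in> suq2_ideal q" by (simp add: mem_class)
next
  assume xy: "x - y \<in> suq2_ideal q"
  have "z - x \<in> suq2_ideal q \<longleftrightarrow> z - y \<in> suq2_ideal q" for z
    using ideal_add[OF _ xy, of "z - x"] ideal_diff[OF _ xy, of "z - y"] by auto
  then show "suq2_class q x = suq2_class q y" by (auto simp: mem_class)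
qed

text \<open>Quotient operations are defined as unions over a coset; all representatives contribute
  the same coset, so the union collapses.\<close>

lemma class_const: assumes "\<And>y. y \<in> suq2_class q x \<Longrightarrow> f y = c" shows "(\<Union>y\<in>suq2_class q x. f y) = c"
proof -
  have "x \<in> suq2_class q x" by (simp add: mem_class ideal_zero)
  then show ?thesis using assms by blast
qed

lemma carrier_SUq2: "carrier (SUq2 q) = range (suq2_class q)"
  by (auto simp: SUq2_def quotient_star_alg_def FactRing_def A_RCOSETS_def' free_star_alg_def)

lemma class_carrier [simp, intro]: "suq2_class q x \<in> carrier (SUq2 q)"
  by (simp add: carrier_SUq2)

lemma class_mult [simp]: "suq2_class q x \<otimes>\<^bsub>SUq2 q\<^esub> suq2_class q y = suq2_class q (x * y)"
proof -
  interpret ideal "suq2_ideal q" free_star_alg by (rule suq2_ideal)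
  show ?thesis using rcoset_mult_add[of x y]
    by (simp add: SUq2_def quotient_star_alg_def FactRing_def) (simp add: free_star_alg_def)
qed

lemma class_add [simp]: "suq2_class q x \<oplus>\<^bsub>SUq2 q\<^esub> suq2_class q y = suq2_class q (x + y)"
proof -
  interpret ideal "suq2_ideal q" free_star_alg by (rule suq2_ideal)
  show ?thesis using a_rcos_sum[of x y]
    by (simp add: SUq2_def quotient_star_alg_def FactRing_def) (simp add: free_star_alg_def)
qed

lemma class_one: "\<one>\<^bsub>SUq2 q\<^esub> = suq2_class q 1"
  by (simp add: SUq2_def quotient_star_alg_def FactRing_def) (simp add: free_star_alg_def)

lemma class_zero: "\<zero>\<^bsub>SUq2 q\<^esub> = suq2_class q 0"
proof -
  have "suq2_ideal q = suq2_class q 0" by (auto simp: mem_class)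
  then show ?thesis by (simp add: SUq2_def quotient_star_alg_def FactRing_def)
qed

lemma class_smult [simp]:
  "smult (SUq2 q) c (suq2_class q x) = suq2_class q (Poly_Mapping.single [] c * x)"
proof -
  have "smult free_star_alg c y = Poly_Mapping.single [] c * y" for y
    by (simp add: free_star_alg_def mult_map_scale_conv_mult)
  then show ?thesis
    by (simp add: SUq2_def quotient_star_alg_def) 
       (rule class_const, simp add: class_eq_iff mem_class right_diff_distrib[symmetric] ideal_left)
qed

lemma class_star [simp]: "star (SUq2 q) (suq2_class q x) = suq2_class q (free_star x)"
proof -
  have "star free_star_alg y = free_star y" for y
    by (simp add: free_star_alg_def)
  then show ?thesis
    by (simp add: SUq2_def quotient_star_alg_def) 
       (rule class_const, simp add: class_eq_iff mem_class free_star_diff[symmetric] ideal_star)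
qed

lemma ring_SUq2: "ring (SUq2 q)"
proof (rule ringI)
  show "abelian_group (SUq2 q)"
  proof (rule abelian_groupI)
    fix X assume "X \<in> carrier (SUq2 q)"
    then obtain x where "X = suq2_class q x" by (auto simp: carrier_SUq2)
    then show "\<exists>Y\<in>carrier (SUq2 q). Y \<oplus>\<^bsub>SUq2 q\<^esub> X = \<zero>\<^bsub>SUq2 q\<^esub>"
      by (intro bexI[of _ "suq2_class q (- x)"]) (auto simp: class_zero)
  qed (auto simp: carrier_SUq2 class_zero algebra_simps)
  show "Group.monoid (SUq2 q)"
    by (rule monoidI) (auto simp: carrier_SUq2 class_one algebra_simps)
qed (auto simp: carrier_SUq2 algebra_simps)

lemma class_minus [simp]: "suq2_class q x \<ominus>\<^bsub>SUq2 q\<^esub> suq2_class q y = suq2_class q (x - y)"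
proof -
  interpret ring "SUq2 q" by (rule ring_SUq2)
  have "\<ominus>\<^bsub>SUq2 q\<^esub> suq2_class q y = suq2_class q (- y)"
    by (rule minus_equality) (auto simp: class_zero)
  then show ?thesis by (simp add: a_minus_def)
qed

text \<open>Oriented as rewrite rules towards the order \<open>Alpha_star\<close>,
  \<open>Beta\<close>, \<open>Beta_star\<close>, \<open>Alpha\<close>, with products of \<alpha> and
  its adjoint eliminated. The last two are the adjoints of the third and fourth relators.\<close>

lemma class_relations:
  "suq2_class q (word [Alpha_star, Alpha]) = suq2_class q (1 - word [Beta, Beta_star])" (is ?r1)
  "suq2_class q (word [Alpha, Alpha_star]) = suq2_class q (1 - Poly_Mapping.single [Beta, Beta_star] (of_real (q\<^sup>2)))" (is ?r2)
  "suq2_class q (word [Alpha, Beta]) = suq2_class q (Poly_Mapping.single [Beta, Alpha] (of_real q))" (is ?r3)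
  "suq2_class q (word [Alpha, Beta_star]) = suq2_class q (Poly_Mapping.single [Beta_star, Alpha] (of_real q))" (is ?r4)
  "suq2_class q (word [Beta_star, Beta]) = suq2_class q (word [Beta, Beta_star])" (is ?r5)
  "suq2_class q (word [Beta_star, Alpha_star]) = suq2_class q (Poly_Mapping.single [Alpha_star, Beta_star] (of_real q))" (is ?r6)
  "suq2_class q (word [Beta, Alpha_star]) = suq2_class q (Poly_Mapping.single [Alpha_star, Beta] (of_real q))" (is ?r7)
proof -
  have R: "x \<in> suq2_relators q \<Longrightarrow> x \<in> suq2_ideal q" "x \<in> suq2_relators q \<Longrightarrow> free_star x \<in> suq2_ideal q" for x
    using relators_ideal[of q] by auto
  show r5: ?r5 by (auto simp: class_eq_iff intro!: R simp: suq2_relators_def)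
  have a: "word [Alpha_star, Alpha] + word [Beta_star, Beta] - 1 \<in> suq2_ideal q"
    by (rule R) (simp add: suq2_relators_def)
  show ?r1 using ideal_diff[OF a r5[unfolded class_eq_iff]] by (simp add: class_eq_iff algebra_simps)
  have "word [Alpha, Alpha_star] + Poly_Mapping.single [Beta, Beta_star] (of_real (q\<^sup>2)) - 1 \<in> suq2_ideal q"
    by (rule R) (simp add: suq2_relators_def)
  then show ?r2 by (simp add: class_eq_iff algebra_simps)
  show ?r3 ?r4 by (auto simp: class_eq_iff intro!: R simp: suq2_relators_def)
  have "free_star (word [Alpha, Beta] - Poly_Mapping.single [Beta, Alpha] (of_real q)) \<in> suq2_ideal q"
    "free_star (word [Alpha, Beta_star] - Poly_Mapping.single [Beta_star, Alpha] (of_real q)) \<in> suq2_ideal q"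
    by (rule R, simp add: suq2_relators_def)+
  then show ?r6 ?r7 by (simp_all add: class_eq_iff free_star_diff free_star_single)
qed

section \<open>The coproduct is well defined on the quotient\<close>

lemma free_coproduct_lin:
  "free_coproduct q = lin_ext (\<lambda>w c. Poly_Mapping.single 0 c * prod_list (map (coproduct_gen q) w))"
  by (rule ext) (simp add: free_coproduct_def lin_ext_def mult_map_scale_conv_mult)

lemma free_coproduct_add: "free_coproduct q (x + y) = free_coproduct q x + free_coproduct q y"
  unfolding free_coproduct_lin by (rule lin_ext_add) (auto simp: single_add distrib_right)

lemma free_coproduct_single:
  "free_coproduct q (Poly_Mapping.single w c) = Poly_Mapping.single 0 c * prod_list (map (coproduct_gen q) w)"
  unfolding free_coproduct_lin by (rule lin_ext_single) auto

lemma free_coproduct_diff: "free_coproduct q (x - y) = free_coproduct q x - free_coproduct q y"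
  using free_coproduct_add[of q "x - y" y] by (simp add: algebra_simps)

lemma single_zero_central:
  "Poly_Mapping.single 0 c * d = d * Poly_Mapping.single 0 (c :: complex)"
  by (rule additive_ext[of "\<lambda>d. Poly_Mapping.single 0 c * d"])
     (simp_all add: distrib_left distrib_right mult_single mult.commute)

lemma word_Nil: "word [] = 1"
  using single_one[where 'a="gen list" and 'b=complex] by simp

lemma free_coproduct_one: "free_coproduct q 1 = 1"
  using free_coproduct_single[of q "[]" 1] by (simp add: word_Nil)

lemma free_coproduct_mult: "free_coproduct q (x * y) = free_coproduct q x * free_coproduct q y"
proof -
  let ?P = "\<lambda>w. prod_list (map (coproduct_gen q) w)"
  have ss: "Poly_Mapping.single 0 (a * b) * (?P u * ?P v) = Poly_Mapping.single 0 a * ?P u * (Poly_Mapping.single 0 b * ?P v)"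
    for a b u v
  proof -
    have "Poly_Mapping.single 0 (a * b) * (?P u * ?P v)
       = Poly_Mapping.single 0 a * (Poly_Mapping.single 0 b * ?P u) * ?P v"
      using mult_single[of "0::gen list \<times> gen list" a 0 b] by (simp add: mult.assoc[symmetric])
    also have "\<dots> = Poly_Mapping.single 0 a * (?P u * Poly_Mapping.single 0 b) * ?P v"
      by (simp only: single_zero_central[of b "?P u"])
    finally show ?thesis by (simp only: mult.assoc)
  qed
  have single: "free_coproduct q (x * Poly_Mapping.single w c) = free_coproduct q x * free_coproduct q (Poly_Mapping.single w c)" for w c
    by (rule additive_ext[of "\<lambda>x. free_coproduct q (x * Poly_Mapping.single w c)"])
       (simp_all add: free_coproduct_add distrib_left distrib_right mult_single free_coproduct_single ss)
  show ?thesis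
    by (rule additive_ext[of "\<lambda>y. free_coproduct q (x * y)"])
       (simp_all add: free_coproduct_add distrib_left distrib_right single)
qed

section \<open>Bilinear functionals on the formal tensor square\<close>

definition ev :: "real \<Rightarrow> (suq2 \<Rightarrow> suq2 \<Rightarrow> complex) \<Rightarrow> free_alg2 \<Rightarrow> complex" where
  "ev q B = lin_ext (\<lambda>(u, v) c. c * B (suq2_class q (word u)) (suq2_class q (word v)))"

lemma ev_add: "ev q B (x + y) = ev q B x + ev q B y"
  unfolding ev_def by (rule lin_ext_add) (auto simp: distrib_right)

lemma ev_diff: "ev q B (x - y) = ev q B x - ev q B y"
  using ev_add[of q B "x - y" y] by (simp add: algebra_simps)

lemma ev_zero [simp]: "ev q B 0 = 0"
  by (simp add: ev_def)

lemma ev_single: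
  "ev q B (Poly_Mapping.single (u, v) c) = c * B (suq2_class q (word u)) (suq2_class q (word v))"
  unfolding ev_def by (subst lin_ext_single) auto

lemma ev_one: "ev q B 1 = B (suq2_class q 1) (suq2_class q 1)"
proof -
  have "(1::free_alg2) = Poly_Mapping.single ([], []) 1"
    using single_one[where 'a="gen list \<times> gen list" and 'b=complex] by (simp add: zero_prod_def)
  then have "ev q B 1 = ev q B (Poly_Mapping.single ([], []) 1)" by (rule arg_cong)
  also have "\<dots> = B (suq2_class q 1) (suq2_class q 1)" unfolding ev_single by (simp add: word_Nil)
  finally show ?thesis .
qed

lemma ev_cong:
  "(\<And>u v. B (suq2_class q (word u)) (suq2_class q (word v)) = B' (suq2_class q (word u)) (suq2_class q (word v)))
    \<Longrightarrow> ev q B d = ev q B' d"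
  unfolding ev_def by simp

text \<open>Different pairs of words may have the same pair of classes, so keys of
  \<open>coproduct\<close> can merge and coefficients add up. Summation through
  \<open>lin_ext\<close> is insensitive to this.\<close>

lemma ev_coproduct:
  "(\<Sum>(a\<^sub>1, a\<^sub>2)\<in>Poly_Mapping.keys (coproduct q X). Poly_Mapping.lookup (coproduct q X) (a\<^sub>1, a\<^sub>2) * B a\<^sub>1 a\<^sub>2)
    = ev q B (free_coproduct q (SOME x. x \<in> X))"
proof -
  let ?d = "free_coproduct q (SOME x. x \<in> X)"
  let ?f = "\<lambda>(a\<^sub>1, a\<^sub>2) c. c * B a\<^sub>1 a\<^sub>2"
  have "lin_ext ?f (coproduct q X) = (\<Sum>p\<in>Poly_Mapping.keys ?d. lin_ext ?f (case p of (u, v) \<Rightarrow>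
      Poly_Mapping.single (suq2_class q (word u), suq2_class q (word v)) (Poly_Mapping.lookup ?d (u, v))))"
    unfolding coproduct_def Let_def by (rule lin_ext_sum) (auto simp: distrib_right)
  also have "\<dots> = ev q B ?d"
    unfolding ev_def lin_ext_def[of "\<lambda>(u, v) c. c * B (suq2_class q (word u)) (suq2_class q (word v))"]
    by (intro sum.cong refl) (auto simp: lin_ext_single case_prod_unfold)
  finally show ?thesis by (simp add: lin_ext_def case_prod_unfold)
qed

lemma linear_class:
  assumes "linear_functional (SUq2 q) \<psi>"
  shows "\<psi> (suq2_class q (x + y)) = \<psi> (suq2_class q x) + \<psi> (suq2_class q y)"
    and "\<psi> (suq2_class q (x - y)) = \<psi> (suq2_class q x) - \<psi> (suq2_class q y)"
    and "\<psi> (suq2_class q (Poly_Mapping.single w c)) = c * \<psi> (suq2_class q (word w))"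
    and "\<psi> (suq2_class q (Poly_Mapping.single [] c * x)) = c * \<psi> (suq2_class q x)"
proof -
  have add: "\<psi> (suq2_class q (x + y)) = \<psi> (suq2_class q x) + \<psi> (suq2_class q y)" for x y
  proof -
    have "\<psi> (suq2_class q x \<oplus>\<^bsub>SUq2 q\<^esub> suq2_class q y) = \<psi> (suq2_class q x) + \<psi> (suq2_class q y)"
      using assms unfolding linear_functional_def by blast
    then show ?thesis by simp
  qed
  show "\<psi> (suq2_class q (x + y)) = \<psi> (suq2_class q x) + \<psi> (suq2_class q y)" by (rule add)
  show "\<psi> (suq2_class q (x - y)) = \<psi> (suq2_class q x) - \<psi> (suq2_class q y)"
    using add[of "x - y" y] by simp
  have sm: "\<psi> (suq2_class q (Poly_Mapping.single [] c * x)) = c * \<psi> (suq2_class q x)" for c x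
  proof -
    have "\<psi> (smult (SUq2 q) c (suq2_class q x)) = c * \<psi> (suq2_class q x)"
      using assms unfolding linear_functional_def by blast
    then show ?thesis by simp
  qed
  show "\<psi> (suq2_class q (Poly_Mapping.single w c)) = c * \<psi> (suq2_class q (word w))"
    using sm[of c "word w"] by (simp add: mult_single)
  show "\<psi> (suq2_class q (Poly_Mapping.single [] c * x)) = c * \<psi> (suq2_class q x)" by (rule sm)
qed

lemma linear_functionalI:
  assumes "\<And>x y. \<psi> (suq2_class q (x + y)) = \<psi> (suq2_class q x) + \<psi> (suq2_class q y)"
    and "\<And>c x. \<psi> (suq2_class q (Poly_Mapping.single [] c * x)) = c * \<psi> (suq2_class q x)"
  shows "linear_functional (SUq2 q) \<psi>"
  unfolding linear_functional_def using assms by (auto simp: carrier_SUq2)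

lemma linear_relations:
  assumes "linear_functional (SUq2 q) \<psi>"
  shows
    "\<psi> (suq2_class q (word [Alpha_star, Alpha])) = \<psi> (suq2_class q 1) - \<psi> (suq2_class q (word [Beta, Beta_star]))"
    "\<psi> (suq2_class q (word [Alpha, Alpha_star])) = \<psi> (suq2_class q 1) - of_real q * of_real q * \<psi> (suq2_class q (word [Beta, Beta_star]))"
    "\<psi> (suq2_class q (word [Alpha, Beta])) = of_real q * \<psi> (suq2_class q (word [Beta, Alpha]))"
    "\<psi> (suq2_class q (word [Alpha, Beta_star])) = of_real q * \<psi> (suq2_class q (word [Beta_star, Alpha]))"
    "\<psi> (suq2_class q (word [Beta_star, Beta])) = \<psi> (suq2_class q (word [Beta, Beta_star]))"
    "\<psi> (suq2_class q (word [Beta_star, Alpha_star])) = of_real q * \<psi> (suq2_class q (word [Alpha_star, Beta_star]))"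
    "\<psi> (suq2_class q (word [Beta, Alpha_star])) = of_real q * \<psi> (suq2_class q (word [Alpha_star, Beta]))"
  unfolding class_relations linear_class(2)[OF assms]
    linear_class(3)[OF assms, of "[Beta, Beta_star]" "of_real (q\<^sup>2)"]
    linear_class(3)[OF assms, of _ "of_real q"]
  by (simp_all add: power2_eq_square)

lemma linear_functional_mult_left:
  fixes \<psi> :: "suq2 \<Rightarrow> complex" and a :: free_alg
  assumes "linear_functional (SUq2 q) \<psi>"
  shows "linear_functional (SUq2 q) (\<lambda>X. \<psi> (suq2_class q a \<otimes>\<^bsub>SUq2 q\<^esub> X))"
proof (rule linear_functionalI[where \<psi>="\<lambda>X. \<psi> (suq2_class q a \<otimes>\<^bsub>SUq2 q\<^esub> X)"])
  fix c x
  have "a * Poly_Mapping.single [] c = Poly_Mapping.single [] c * a"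
    using single_zero_central[of c a] by simp
  then have "a * Poly_Mapping.single [] c * x = Poly_Mapping.single [] c * a * x" by (rule arg_cong)
  then have e: "a * (Poly_Mapping.single [] c * x) = Poly_Mapping.single [] c * (a * x)"
    by (simp only: mult.assoc)
  show "\<psi> (suq2_class q a \<otimes>\<^bsub>SUq2 q\<^esub> suq2_class q (Poly_Mapping.single [] c * x)) = c * \<psi> (suq2_class q a \<otimes>\<^bsub>SUq2 q\<^esub> suq2_class q x)"
    unfolding class_mult e by (rule linear_class(4)[OF assms])
qed (simp add: distrib_left linear_class(1)[OF assms])

lemma linear_functional_mult_right:
  fixes \<psi> :: "suq2 \<Rightarrow> complex" and a :: free_alg
  assumes "linear_functional (SUq2 q) \<psi>"
  shows "linear_functional (SUq2 q) (\<lambda>X. \<psi> (X \<otimes>\<^bsub>SUq2 q\<^esub> suq2_class q a))"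
  by (rule linear_functionalI[where \<psi>="\<lambda>X. \<psi> (X \<otimes>\<^bsub>SUq2 q\<^esub> suq2_class q a)"])
     (simp_all add: distrib_right linear_class(1)[OF assms] linear_class(4)[OF assms] mult.assoc)

lemma linear_functional_scale:
  "linear_functional A \<psi> \<Longrightarrow> linear_functional A (\<lambda>X. c * \<psi> X)"
  by (simp add: linear_functional_def algebra_simps)

lemma linear_functional_scale_right:
  "linear_functional A \<psi> \<Longrightarrow> linear_functional A (\<lambda>X. \<psi> X * c)"
  by (simp add: linear_functional_def algebra_simps)

lemma bilinear_mult_left:
  assumes "bilinear_functional (SUq2 q) B"
  shows "bilinear_functional (SUq2 q)
    (\<lambda>X Y. c * B (suq2_class q a \<otimes>\<^bsub>SUq2 q\<^esub> X) (suq2_class q b \<otimes>\<^bsub>SUq2 q\<^esub> Y))"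
  using assms unfolding bilinear_functional_def
  by (auto simp: carrier_SUq2 intro!: linear_functional_scale
    linear_functional_mult_left[where \<psi>="\<lambda>X. B X _"] linear_functional_mult_left)

lemma bilinear_mult_right:
  assumes "bilinear_functional (SUq2 q) B"
  shows "bilinear_functional (SUq2 q)
    (\<lambda>X Y. c * B (X \<otimes>\<^bsub>SUq2 q\<^esub> suq2_class q a) (Y \<otimes>\<^bsub>SUq2 q\<^esub> suq2_class q b))"
  using assms unfolding bilinear_functional_def
  by (auto simp: carrier_SUq2 intro!: linear_functional_scale
    linear_functional_mult_right[where \<psi>="\<lambda>X. B X _"] linear_functional_mult_right)

lemma ev_mult_single:
  "ev q B (Poly_Mapping.single (u, v) c * e) =
    ev q (\<lambda>X Y. c * B (suq2_class q (word u) \<otimes>\<^bsub>SUq2 q\<^esub> X) (suq2_class q (word v) \<otimes>\<^bsub>SUq2 q\<^esub> Y)) e"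
  "ev q B (e * Poly_Mapping.single (u, v) c) =
    ev q (\<lambda>X Y. c * B (X \<otimes>\<^bsub>SUq2 q\<^esub> suq2_class q (word u)) (Y \<otimes>\<^bsub>SUq2 q\<^esub> suq2_class q (word v))) e"
proof -
  show "ev q B (Poly_Mapping.single (u, v) c * e) =
    ev q (\<lambda>X Y. c * B (suq2_class q (word u) \<otimes>\<^bsub>SUq2 q\<^esub> X) (suq2_class q (word v) \<otimes>\<^bsub>SUq2 q\<^esub> Y)) e"
    by (rule additive_ext[of "\<lambda>e. ev q B (Poly_Mapping.single (u, v) c * e)"])
       (auto simp: ev_add distrib_left mult_single ev_single)
  show "ev q B (e * Poly_Mapping.single (u, v) c) =
    ev q (\<lambda>X Y. c * B (X \<otimes>\<^bsub>SUq2 q\<^esub> suq2_class q (word u)) (Y \<otimes>\<^bsub>SUq2 q\<^esub> suq2_class q (word v))) e"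
    by (rule additive_ext[of "\<lambda>e. ev q B (e * Poly_Mapping.single (u, v) c)"])
       (auto simp: ev_add distrib_right mult_single ev_single)
qed

text \<open>Formal tensors on which all bilinear functionals vanish represent zero in the tensor
  square of the quotient. They form an ideal because multiplication by a fixed tensor turns one
  bilinear functional into another.\<close>

lemma ev_mult_zero:
  assumes e: "\<And>B. bilinear_functional (SUq2 q) B \<Longrightarrow> ev q B e = 0" and B: "bilinear_functional (SUq2 q) B"
  shows "ev q B (d * e) = 0" "ev q B (e * d) = 0"
proof -
  show "ev q B (d * e) = 0"
    by (induction d rule: poly_mapping_induct)
       (auto simp: ev_add distrib_right ev_mult_single intro!: e bilinear_mult_left B)
  show "ev q B (e * d) = 0"
    by (induction d rule: poly_mapping_induct)
       (auto simp: ev_add distrib_left ev_mult_single intro!: e bilinear_mult_right B)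
qed

lemma ev_coproduct_ideal:
  assumes "x \<in> suq2_ideal q" and B: "bilinear_functional (SUq2 q) B"
  shows "ev q B (free_coproduct q x) = 0"
proof -
  \<comment> \<open>The quantifier over all functionals belongs inside the set: multiplication
    changes the functional, so a fixed B would not yield an ideal.\<close>
  let ?I = "{x. \<forall>B. bilinear_functional (SUq2 q) B \<longrightarrow> ev q B (free_coproduct q x) = 0}"
  have "relators q \<subseteq> ?I"
  proof (clarify)
    fix x B assume x: "x \<in> relators q" and B: "bilinear_functional (SUq2 q) B"
    have lin: "linear_functional (SUq2 q) (B (suq2_class q y))" "linear_functional (SUq2 q) (\<lambda>X. B X (suq2_class q y))" for y
      using B by (auto simp: bilinear_functional_def)
    note rel = linear_relations[OF lin(1)] linear_relations[OF lin(2)]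
    show "ev q B (free_coproduct q x) = 0"
      using x unfolding suq2_relators_def
      by (auto simp: free_star_add free_star_diff free_star_single
        free_coproduct_add free_coproduct_diff free_coproduct_single free_coproduct_one
        ev_add ev_diff ev_single ev_one distrib_left distrib_right left_diff_distrib right_diff_distrib
        mult_single plus_prod_def zero_prod_def rel power2_eq_square)
  qed
  moreover have "a * x \<in> ?I \<and> x * a \<in> ?I" if "x \<in> ?I" for a x
    using that ev_mult_zero[of q "free_coproduct q x" _ "free_coproduct q a"]
    by (simp add: free_coproduct_mult)
  ultimately have "suq2_ideal q \<subseteq> ?I"
    by (intro suq2_ideal_minimal) (simp_all add: free_coproduct_add ev_add)
  then show ?thesis using assms by blast
qed

lemma ev_coproduct_class:
  assumes B: "bilinear_functional (SUq2 q) B"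
  shows "ev q B (free_coproduct q (SOME y. y \<in> suq2_class q x)) = ev q B (free_coproduct q x)"
proof -
  have "x \<in> suq2_class q x" by (simp add: mem_class ideal_zero)
  then have "(SOME y. y \<in> suq2_class q x) \<in> suq2_class q x" by (rule someI)
  then have "ev q B (free_coproduct q ((SOME y. y \<in> suq2_class q x) - x)) = 0"
    using B by (intro ev_coproduct_ideal) (simp_all add: mem_class)
  then show ?thesis by (simp add: free_coproduct_diff ev_diff)
qed

lemma linear_functional_ev:
  assumes "\<And>u v. linear_functional A (\<lambda>a. B a (suq2_class q (word u)) (suq2_class q (word v)))"
  shows "linear_functional A (\<lambda>a. ev q (B a) d)"
  using assms unfolding linear_functional_def ev_def lin_ext_def
  by (auto simp: case_prod_unfold sum.distrib[symmetric] sum_distrib_left algebra_simps intro!: sum.cong)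

text \<open>Chosen representatives are exchanged one variable at a time: first in b with the classes
  from a fixed, then in a, where the whole inner sum is again a bilinear functional.\<close>

lemma convolution_class:
  assumes \<phi>: "bilinear_functional (SUq2 q) \<phi>" and \<psi>: "linear_functional (SUq2 q) \<psi>"
  shows "convolution q \<phi> \<psi> (suq2_class q x) (suq2_class q y) =
    ev q (\<lambda>a\<^sub>1 a\<^sub>2. ev q (\<lambda>b\<^sub>1 b\<^sub>2. \<phi> a\<^sub>1 b\<^sub>1 * \<psi> (a\<^sub>2 \<otimes>\<^bsub>SUq2 q\<^esub> b\<^sub>2)) (free_coproduct q y)) (free_coproduct q x)"
proof -
  let ?B = "\<lambda>a\<^sub>1 a\<^sub>2 b\<^sub>1 b\<^sub>2. \<phi> a\<^sub>1 b\<^sub>1 * \<psi> (a\<^sub>2 \<otimes>\<^bsub>SUq2 q\<^esub> b\<^sub>2)"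
  let ?y = "SOME z. z \<in> suq2_class q y"
  have B: "bilinear_functional (SUq2 q) (?B (suq2_class q u) (suq2_class q v))" for u v
    using \<phi> \<psi> unfolding bilinear_functional_def
    by (auto simp: carrier_SUq2 intro!: linear_functional_scale linear_functional_scale_right linear_functional_mult_left)
  have G: "bilinear_functional (SUq2 q) (\<lambda>a\<^sub>1 a\<^sub>2. ev q (?B a\<^sub>1 a\<^sub>2) (free_coproduct q y))"
    using \<phi> \<psi> unfolding bilinear_functional_def
    by (auto simp: carrier_SUq2 intro!: linear_functional_ev linear_functional_scale linear_functional_scale_right linear_functional_mult_right)
  have "convolution q \<phi> \<psi> (suq2_class q x) (suq2_class q y) =
    (\<Sum>(a\<^sub>1, a\<^sub>2)\<in>Poly_Mapping.keys (coproduct q (suq2_class q x)).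
       Poly_Mapping.lookup (coproduct q (suq2_class q x)) (a\<^sub>1, a\<^sub>2) *
       (\<Sum>(b\<^sub>1, b\<^sub>2)\<in>Poly_Mapping.keys (coproduct q (suq2_class q y)).
         Poly_Mapping.lookup (coproduct q (suq2_class q y)) (b\<^sub>1, b\<^sub>2) * ?B a\<^sub>1 a\<^sub>2 b\<^sub>1 b\<^sub>2))"
    unfolding convolution_def by (simp add: sum_distrib_left case_prod_unfold mult.assoc)
  also have "\<dots> = ev q (\<lambda>a\<^sub>1 a\<^sub>2. ev q (?B a\<^sub>1 a\<^sub>2) (free_coproduct q ?y)) (free_coproduct q (SOME z. z \<in> suq2_class q x))"
    unfolding ev_coproduct by (rule refl)
  also have "\<dots> = ev q (\<lambda>a\<^sub>1 a\<^sub>2. ev q (?B a\<^sub>1 a\<^sub>2) (free_coproduct q y)) (free_coproduct q (SOME z. z \<in> suq2_class q x))"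
    by (rule ev_cong) (rule ev_coproduct_class[OF B])
  also have "\<dots> = ev q (\<lambda>a\<^sub>1 a\<^sub>2. ev q (?B a\<^sub>1 a\<^sub>2) (free_coproduct q y)) (free_coproduct q x)"
    by (rule ev_coproduct_class[OF G])
  finally show ?thesis .
qed

text \<open>Pairing the invariance identity at \<open>(\<beta>, \<beta>\<^sup>*)\<close> and \<open>(\<beta>\<^sup>*, \<beta>)\<close> with the vacuum state \<open>\<psi>\<close>
  gives \<open>\<phi>(\<alpha>\<^sup>*, \<alpha>) = q\<^sup>2 \<phi>(\<beta>, \<beta>\<^sup>*)\<close> and \<open>\<phi>(\<alpha>, \<alpha>\<^sup>*) = \<phi>(\<beta>\<^sup>*, \<beta>)\<close>, which antisymmetry makes
  incompatible unless both sides vanish.\<close>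

lemma invariant_antisymmetric_zero:
  assumes q: "0 < q" "q < 1" and inv: "invariant_functional q \<phi>"
    and anti: "\<And>a b. a \<in> carrier (SUq2 q) \<Longrightarrow> b \<in> carrier (SUq2 q) \<Longrightarrow> \<phi> a b = - \<phi> b a"
    and \<psi>: "linear_functional (SUq2 q) \<psi>" "\<psi> (suq2_class q 1) = 1" "\<psi> (suq2_class q (word [Beta, Beta_star])) = 1"
      "\<psi> (suq2_class q (word [Beta_star, Alpha])) = 0" "\<psi> (suq2_class q (word [Alpha_star, Beta])) = 0"
  shows "\<phi> (suq2_class q (word [Beta])) (suq2_class q (word [Beta_star])) = 0"
proof -
  have \<phi>: "bilinear_functional (SUq2 q) \<phi>" using inv by (simp add: invariant_functional_def)
  have conv: "convolution q \<phi> \<psi> (suq2_class q x) (suq2_class q y) = \<phi> (suq2_class q x) (suq2_class q y)" for x y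
    using inv \<psi> unfolding invariant_functional_def by (simp add: class_one)
  note expand = convolution_class[OF \<phi> \<psi>(1)] free_coproduct_single ev_add ev_single mult_single
    linear_relations[OF \<psi>(1)] \<psi>(2-5)
  let ?c = "\<lambda>g. suq2_class q (word [g])"
  \<comment> \<open>The mixed terms vanish, as the relations turn them into multiples of \<psi> at
    \<open>[Beta_star, Alpha]\<close> and \<open>[Alpha_star, Beta]\<close>. The factor 1 - q^2 is
    \<psi> at \<open>[Alpha, Alpha_star]\<close>.\<close>
  have "\<phi> (?c Beta) (?c Beta_star) * (1 - of_real q * of_real q) + \<phi> (?c Alpha_star) (?c Alpha) = \<phi> (?c Beta) (?c Beta_star)"
    using conv[of "word [Beta]" "word [Beta_star]"] by (simp add: expand)
  \<comment> \<open>Here \<psi> at \<open>[Alpha_star, Alpha]\<close> is 1 - 1 = 0, so the term with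
    \<phi> at (\<open>Beta_star\<close>, \<open>Beta\<close>) drops out of the convolution.\<close>
  moreover have "\<phi> (?c Alpha) (?c Alpha_star) = \<phi> (?c Beta_star) (?c Beta)"
    using conv[of "word [Beta_star]" "word [Beta]"] by (simp add: expand)
  moreover have "\<phi> (?c Alpha) (?c Alpha_star) = - \<phi> (?c Alpha_star) (?c Alpha)"
    "\<phi> (?c Beta_star) (?c Beta) = - \<phi> (?c Beta) (?c Beta_star)"
    by (rule anti; simp)+
  ultimately have "\<phi> (?c Beta) (?c Beta_star) * (1 - of_real q * of_real q) = 0" by simp
  moreover have "q * q < 1" using q mult_strict_mono[of q 1 q 1] by simp
  then have "of_real q * of_real q \<noteq> (1::complex)"
    by (metis less_irrefl of_real_1 of_real_eq_iff of_real_mult)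
  ultimately show ?thesis by simp
qed

hide_type (open) Finite_Cartesian_Product.vec

section \<open>Representations as operators on \<open>l\<^sup>2(\<nat>)\<close>\<close>

definition restr :: "nat set \<Rightarrow> vec \<Rightarrow> vec" where
  "restr I v = (\<lambda>i. if i \<in> I then v i else 0)"

lemma restr_l2: assumes "v \<in> l2 J" shows "restr I v \<in> l2 I"
proof -
  have "(\<lambda>i. (cmod (restr I v i))\<^sup>2) summable_on UNIV"
    by (rule summable_on_comparison_test[OF l2_summable[OF assms]]) (auto simp: restr_def)
  then show ?thesis by (auto simp: l2_def restr_def)
qed

lemma restr_id [simp]: "v \<in> l2 I \<Longrightarrow> restr I v = v"
  by (auto simp: l2_def restr_def)

lemma coord_cproj': "coord (app (cproj I) x) = restr I (coord x)"
  by (rule ext) (simp add: restr_def)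

lemma norm_Ell2: "v \<in> l2 I \<Longrightarrow> norm (Ell2 v) = l2_norm v"
  by (simp add: norm_ell2_def coord_Ell2')

lemma norm_restr_le: "l2_norm (restr I (coord x)) \<le> norm x"
  using norm_app[of "cproj I" x] norm_cproj[of I]
  by (simp add: norm_ell2_def coord_cproj'[symmetric])
     (metis mult_left_le_one_le norm_ge_zero norm_ell2_def order_trans)

text \<open>Extension by zero outside I. It puts the operators of all modules into the single
  algebra \<open>bop\<close>, where the identity of l^2(I) becomes \<open>cproj I\<close>.\<close>

definition bext :: "nat set \<Rightarrow> oper \<Rightarrow> bop" where
  "bext I T = (SOME S. \<forall>x. coord (app S x) = T (restr I (coord x)))"

lemma coord_bext:
  assumes "bounded_op I J T" shows "coord (app (bext I T) x) = T (restr I (coord x))"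
proof -
  obtain K where T: "\<And>x. x \<in> l2 I \<Longrightarrow> T x \<in> l2 J" 
    "\<And>c x y. x \<in> l2 I \<Longrightarrow> y \<in> l2 I \<Longrightarrow> T (\<lambda>i. c * x i + y i) = (\<lambda>i. c * T x i + T y i)"
    "\<And>x. x \<in> l2 I \<Longrightarrow> l2_norm (T x) \<le> K * l2_norm x"
    using assms unfolding bounded_op_def by blast
  define f where "f x = Ell2 (T (restr I (coord x)))" for x
  have r: "restr I (coord x) \<in> l2 I" for x by (rule restr_l2[OF coord])
  have cf: "coord (f x) = T (restr I (coord x))" for x
    unfolding f_def by (rule coord_Ell2'[OF T(1)[OF r]])
  have T0: "T (\<lambda>i. 0) = (\<lambda>i. 0)"
    using T(2)[OF l2_zero l2_zero, of "-1"] by (auto simp: fun_eq_iff)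
  have "\<exists>S. app S = f"
  proof (rule bop_of_linear)
    show "f (x + y) = f x + f y" for x y
    proof (rule ell2_eqI)
      have "restr I (coord (x + y)) = (\<lambda>i. 1 * restr I (coord x) i + restr I (coord y) i)"
        by (auto simp: restr_def)
      then show "coord (f (x + y)) i = coord (f x + f y) i" for i
        by (simp add: cf T(2)[OF r r, of 1, simplified])
    qed
    show "f (cscale c x) = cscale c (f x)" for c x
    proof (rule ell2_eqI)
      have "restr I (coord (cscale c x)) = (\<lambda>i. c * restr I (coord x) i + 0)"
        by (auto simp: restr_def)
      then show "coord (f (cscale c x)) i = coord (cscale c (f x)) i" for i
        using T(2)[OF r l2_zero, of c x] by (simp add: cf T0)
    qed
    show "norm (f x) \<le> \<bar>K\<bar> * norm x" for x
    proof -
      have "norm (f x) \<le> K * l2_norm (restr I (coord x))" unfolding norm_ell2_def cf by (rule T(3)[OF r])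
      also have "\<dots> \<le> \<bar>K\<bar> * l2_norm (restr I (coord x))" 
        by (intro mult_right_mono) (auto simp: l2_norm_def infsum_nonneg)
      also have "\<dots> \<le> \<bar>K\<bar> * norm x" by (intro mult_left_mono norm_restr_le) auto
      finally show ?thesis .
    qed
  qed
  then obtain S where "app S = f" ..
  then have "\<exists>S. \<forall>x. coord (app S x) = T (restr I (coord x))" using cf by metis
  then show ?thesis unfolding bext_def by (rule someI_ex[THEN spec])
qed

lemma bext_unique:
  assumes "\<And>x. coord (app S x) = T (restr I (coord x))" shows "bext I T = S"
proof -
  have "\<exists>S. \<forall>x. coord (app S x) = T (restr I (coord x))" using assms by blast
  from someI_ex[OF this] show ?thesis
    using assms by (intro bop_eqI ell2_eqI) (simp add: bext_def)
qed

definition to_oper :: "bop \<Rightarrow> oper" where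
  "to_oper T v = coord (app T (Ell2 v))"

lemma bounded_to_oper: "bounded_op UNIV UNIV (to_oper T)"
  unfolding bounded_op_def
proof (intro conjI ballI allI exI)
  fix x y :: vec and c assume x: "x \<in> l2 UNIV" and y: "y \<in> l2 UNIV"
  have "Ell2 (\<lambda>i. c * x i + y i) = cscale c (Ell2 x) + Ell2 y"
    using x y l2_add[OF l2_cmul[OF x] y] by (intro ell2_eqI) simp
  then show "to_oper T (\<lambda>i. c * x i + y i) = (\<lambda>i. c * to_oper T x i + to_oper T y i)"
    by (auto simp: to_oper_def)
next
  fix x :: vec assume "x \<in> l2 UNIV"
  then show "l2_norm (to_oper T x) \<le> norm T * l2_norm x"
    using norm_app[of T "Ell2 x"] by (simp add: to_oper_def norm_ell2_def)
qed (auto simp: to_oper_def intro: coord)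

lemma restr_UNIV [simp]: "restr UNIV v = v"
  by (simp add: restr_def)

lemma bext_to_oper [simp]: "bext UNIV (to_oper T) = T"
  by (rule bext_unique) (simp add: to_oper_def coord_inverse)

text \<open>Restriction to I is contractive, so extension by zero leaves the supremum
  unchanged.\<close>

lemma op_norm_bext:
  assumes T: "bounded_op I I T" shows "op_norm I T = norm (bext I T)"
proof (rule antisym)
  have 1: "l2_norm (T x) \<le> norm (bext I T)" if "x \<in> l2 I" "l2_norm x \<le> 1" for x
  proof -
    have "l2_norm (T x) = norm (app (bext I T) (Ell2 x))"
      using that by (simp add: norm_ell2_def coord_bext[OF T] coord_Ell2')
    also have "\<dots> \<le> norm (bext I T) * norm (Ell2 x)" by (rule norm_app)
    also have "\<dots> \<le> norm (bext I T) * 1" using that by (intro mult_left_mono) (auto simp: norm_Ell2)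
    finally show ?thesis by simp
  qed
  have ne: "{x \<in> l2 I. l2_norm x \<le> 1} \<noteq> {}"
    using l2_zero[of I] by (auto simp: l2_norm_def)
  show "op_norm I T \<le> norm (bext I T)"
    unfolding op_norm_def by (rule cSUP_least[OF ne]) (use 1 in auto)
  have bdd: "bdd_above ((\<lambda>x. l2_norm (T x)) ` {x \<in> l2 I. l2_norm x \<le> 1})"
    by (rule bdd_aboveI2[where M="norm (bext I T)"]) (use 1 in auto)
  have up: "l2_norm (T x) \<le> op_norm I T" if "x \<in> l2 I" "l2_norm x \<le> 1" for x
    unfolding op_norm_def using that by (intro cSUP_upper[OF _ bdd]) auto
  have "norm (app (bext I T) x) \<le> op_norm I T * norm x" for x
  proof (cases "norm x = 0")
    case False
    let ?y = "(1 / norm x) *\<^sub>R x"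
    have "l2_norm (restr I (coord ?y)) \<le> 1" using norm_restr_le[of I ?y] False by simp
    from up[OF restr_l2[OF coord] this] have "norm (app (bext I T) ?y) \<le> op_norm I T"
      by (simp only: norm_ell2_def[of "app (bext I T) ?y"] coord_bext[OF T])
    then show ?thesis using False by (simp add: field_simps)
  qed auto
  moreover have "0 \<le> op_norm I T"
    using up[OF l2_zero] order_trans[rotated] by (fastforce simp: l2_norm_def infsum_nonneg)
  ultimately show "norm (bext I T) \<le> op_norm I T" by (intro norm_bop_bound) auto
qed

text \<open>Complex scalars as operators, since \<open>bop\<close> carries only real
  scaling.\<close>

definition csop :: "complex \<Rightarrow> bop" where "csop c = wop (\<lambda>_. c) id"

lemma app_csop [simp]: "app (csop c) x = cscale c x"
  unfolding csop_def by (rule ell2_eqI, subst coord_wop[where C="cmod c"]) auto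

lemma norm_csop: "norm (csop c) \<le> cmod c"
  by (rule norm_bop_bound) (auto simp: norm_cscale)

lemma csop_simps: "csop (a + b) = csop a + csop b" "csop (a * b) = csop a * csop b" "csop 1 = 1" "csop 0 = 0"
  by (intro bop_eqI ell2_eqI; simp add: algebra_simps)+

lemma csop_comm: "csop c * T = T * csop c"
  by (rule bop_eqI) simp

text \<open>Representations need not be unital. The adjoint condition is stated for the real inner
  product; complex linearity recovers the complex one.\<close>

definition bop_rep :: "'a star_alg \<Rightarrow> ('a \<Rightarrow> bop) \<Rightarrow> bool" where
  "bop_rep A R \<longleftrightarrow>
    (\<forall>a\<in>carrier A. \<forall>b\<in>carrier A. R (a \<oplus>\<^bsub>A\<^esub> b) = R a + R b) \<and>
    (\<forall>c. \<forall>a\<in>carrier A. R (smult A c a) = csop c * R a) \<and>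
    (\<forall>a\<in>carrier A. \<forall>b\<in>carrier A. R (a \<otimes>\<^bsub>A\<^esub> b) = R a * R b) \<and>
    (\<forall>a\<in>carrier A. \<forall>x y. inner (app (R (star A a)) x) y = inner x (app (R a) y))"

lemma bext_add:
  assumes "bounded_op I I S" "bounded_op I I T" "bounded_op I I U"
    and "\<And>x. x \<in> l2 I \<Longrightarrow> U x = (\<lambda>i. S x i + T x i)"
  shows "bext I U = bext I S + bext I T"
  by (rule bext_unique)
     (use restr_l2[OF coord] in \<open>auto simp: coord_bext[OF assms(1)] coord_bext[OF assms(2)] assms(4) fun_eq_iff\<close>)

lemma bext_mult:
  assumes S: "bounded_op J K S" and T: "bounded_op I J T" and "bounded_op I K U"
    and "\<And>x. x \<in> l2 I \<Longrightarrow> U x = S (T x)"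
  shows "bext I U = bext J S * bext I T"
  by (rule bext_unique)
     (use restr_l2[OF coord] T in \<open>auto simp: coord_bext[OF S] coord_bext[OF T] assms bounded_op_def\<close>)

lemma l2_inner_restr: "y \<in> l2 I \<Longrightarrow> l2_inner x y = l2_inner (restr I x) y"
  unfolding l2_inner_def by (rule infsum_cong) (auto simp: restr_def l2_def)

lemma l2_inner_restr': "x \<in> l2 I \<Longrightarrow> l2_inner x y = l2_inner x (restr I y)"
  unfolding l2_inner_def by (rule infsum_cong) (auto simp: restr_def l2_def)

lemma star_rep_bext:
  assumes "star_rep A I \<rho>" and star: "\<And>a. a \<in> carrier A \<Longrightarrow> star A a \<in> carrier A"
    "\<And>c a. a \<in> carrier A \<Longrightarrow> smult A c a \<in> carrier A"
    "\<And>a b. a \<in> carrier A \<Longrightarrow> b \<in> carrier A \<Longrightarrow> a \<oplus>\<^bsub>A\<^esub> b \<in> carrier A"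
    "\<And>a b. a \<in> carrier A \<Longrightarrow> b \<in> carrier A \<Longrightarrow> a \<otimes>\<^bsub>A\<^esub> b \<in> carrier A"
  shows "bop_rep A (\<lambda>a. bext I (\<rho> a))"
  unfolding bop_rep_def
proof (intro conjI ballI allI)
  have b: "bounded_op I I (\<rho> a)" if "a \<in> carrier A" for a using assms(1) that by (auto simp: star_rep_def)
  fix a b x y c assume a: "a \<in> carrier A"
  show "bext I (\<rho> (smult A c a)) = csop c * bext I (\<rho> a)"
    by (rule bext_unique)
       (use assms(1) a restr_l2[OF coord] in \<open>auto simp: star_rep_def coord_bext[OF b[OF a]]\<close>)
  show "inner (app (bext I (\<rho> (star A a))) x) y = inner x (app (bext I (\<rho> a)) y)"
  proof -
    have "l2_inner (\<rho> (star A a) (restr I (coord x))) (restr I (coord y)) = l2_inner (restr I (coord x)) (\<rho> a (restr I (coord y)))"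
      using assms(1) a restr_l2[OF coord] by (auto simp: star_rep_def)
    moreover have "\<rho> (star A a) (restr I (coord x)) \<in> l2 I" "\<rho> a (restr I (coord y)) \<in> l2 I"
      using b[OF a] b[OF star(1)[OF a]] restr_l2[OF coord] by (auto simp: bounded_op_def)
    ultimately show ?thesis
      unfolding inner_ell2_def coord_bext[OF b[OF a]] coord_bext[OF b[OF star(1)[OF a]]]
      by (metis l2_inner_restr l2_inner_restr')
  qed
next
  have b: "bounded_op I I (\<rho> a)" if "a \<in> carrier A" for a using assms(1) that by (auto simp: star_rep_def)
  fix a b assume a: "a \<in> carrier A" and b': "b \<in> carrier A"
  show "bext I (\<rho> (a \<oplus>\<^bsub>A\<^esub> b)) = bext I (\<rho> a) + bext I (\<rho> b)"
    by (rule bext_add[OF b[OF a] b[OF b'] b[OF star(3)[OF a b']]])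
       (use assms(1) a b' in \<open>auto simp: star_rep_def\<close>)
  show "bext I (\<rho> (a \<otimes>\<^bsub>A\<^esub> b)) = bext I (\<rho> a) * bext I (\<rho> b)"
    by (rule bext_mult[OF b[OF a] b[OF b'] b[OF star(4)[OF a b']]])
       (use assms(1) a b' in \<open>auto simp: star_rep_def\<close>)
qed

lemma cinner_from_inner:
  assumes "\<And>x y. inner (app S x) y = inner x (app T y)"
  shows "l2_inner (coord (app S x)) (coord y) = l2_inner (coord x) (coord (app T y))"
proof (rule complex_eqI)
  show "Re (l2_inner (coord (app S x)) (coord y)) = Re (l2_inner (coord x) (coord (app T y)))"
    using assms[of x y] by (simp add: inner_ell2_def)
  have *: "l2_inner (coord (cscale c z)) v = c * l2_inner (coord z) v" for c z v
    unfolding l2_inner_def by (simp add: mult.assoc infsum_cmult_right')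
  \<comment> \<open>The real part at -i x is the imaginary part at x.\<close>
  show "Im (l2_inner (coord (app S x)) (coord y)) = Im (l2_inner (coord x) (coord (app T y)))"
    using assms[of "cscale (-\<i>) x" y] by (simp add: inner_ell2_def *)
qed

lemma bop_rep_star_rep:
  assumes "bop_rep A R" shows "star_rep A UNIV (\<lambda>a. to_oper (R a))"
  unfolding star_rep_def
proof (intro conjI ballI allI)
  fix a x y assume a: "a \<in> carrier A" and x: "x \<in> l2 UNIV" and y: "y \<in> l2 UNIV"
  have "l2_inner (coord (app (R (star A a)) (Ell2 x))) (coord (Ell2 y)) = l2_inner (coord (Ell2 x)) (coord (app (R a) (Ell2 y)))"
    by (rule cinner_from_inner) (use assms a in \<open>auto simp: bop_rep_def\<close>)
  then show "l2_inner (to_oper (R (star A a)) x) y = l2_inner x (to_oper (R a) y)"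
    using x y by (simp add: to_oper_def)
qed (use assms in \<open>auto simp: bounded_to_oper bop_rep_def to_oper_def coord_inverse\<close>)

section \<open>The enveloping algebra\<close>

lemma SUq2_closed [simp]:
  assumes "a \<in> carrier (SUq2 q)" "b \<in> carrier (SUq2 q)"
  shows "a \<oplus>\<^bsub>SUq2 q\<^esub> b \<in> carrier (SUq2 q)" "a \<otimes>\<^bsub>SUq2 q\<^esub> b \<in> carrier (SUq2 q)"
    "a \<ominus>\<^bsub>SUq2 q\<^esub> b \<in> carrier (SUq2 q)"
  using assms by (auto simp: carrier_SUq2)

lemma SUq2_closed_unary [simp]:
  assumes "a \<in> carrier (SUq2 q)"
  shows "star (SUq2 q) a \<in> carrier (SUq2 q)" "smult (SUq2 q) c a \<in> carrier (SUq2 q)"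
  using assms by (auto simp: carrier_SUq2)

lemma bop_rep_class:
  assumes "bop_rep (SUq2 q) R"
  shows "R (suq2_class q (x + y)) = R (suq2_class q x) + R (suq2_class q y)"
    and "R (suq2_class q (x * y)) = R (suq2_class q x) * R (suq2_class q y)"
    and "R (suq2_class q (Poly_Mapping.single [] c * x)) = csop c * R (suq2_class q x)"
    and "inner (app (R (suq2_class q (free_star x))) u) v = inner u (app (R (suq2_class q x)) v)"
    and "R (suq2_class q 0) = 0"
    and "R (suq2_class q (x - y)) = R (suq2_class q x) - R (suq2_class q y)"
proof -
  have add: "R (suq2_class q (x + y)) = R (suq2_class q x) + R (suq2_class q y)" for x y
    using assms unfolding bop_rep_def by (metis class_add class_carrier)
  then show "R (suq2_class q (x + y)) = R (suq2_class q x) + R (suq2_class q y)" .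
  show "R (suq2_class q (x * y)) = R (suq2_class q x) * R (suq2_class q y)"
    using assms unfolding bop_rep_def by (metis class_mult class_carrier)
  show "R (suq2_class q (Poly_Mapping.single [] c * x)) = csop c * R (suq2_class q x)"
    using assms unfolding bop_rep_def by (metis class_smult class_carrier)
  show "inner (app (R (suq2_class q (free_star x))) u) v = inner u (app (R (suq2_class q x)) v)"
    using assms unfolding bop_rep_def by (metis class_star class_carrier)
  show "R (suq2_class q 0) = 0" using add[of 0 0] by simp
  show "R (suq2_class q (x - y)) = R (suq2_class q x) - R (suq2_class q y)"
    using add[of "x - y" y] by simp
qed

section \<open>Uniform boundedness and the universal norm\<close>

lemma class_unit_relations:
  "suq2_class q (word [Alpha_star, Alpha] + word [Beta_star, Beta]) = suq2_class q 1"
  "suq2_class q (word [Alpha, Alpha_star] + Poly_Mapping.single [Beta, Beta_star] (of_real (q\<^sup>2))) = suq2_class q 1"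
  unfolding class_eq_iff by (rule subsetD[OF relators_ideal], simp add: suq2_relators_def)+

text \<open>The image of 1 is a selfadjoint idempotent, hence a contraction even when it is not the
  identity. The two unit relations then bound sums of squared norms, and normality of \<beta>
  transfers the bound to its adjoint.\<close>

lemma bop_rep_generator_bound:
  assumes R: "bop_rep (SUq2 q) R"
  shows "norm (R (suq2_class q 1)) \<le> 1" "norm (R (suq2_class q (word [g]))) \<le> 1"
proof -
  define r where "r x = app (R (suq2_class q x))" for x
  have mult: "r (x * y) u = r x (r y u)" for x y u by (simp add: r_def bop_rep_class[OF R])
  have add: "r (x + y) u = r x u + r y u" for x y u by (simp add: r_def bop_rep_class[OF R])
  have adj: "inner (r (free_star x) u) v = inner u (r x v)" for x u v
    unfolding r_def by (rule bop_rep_class(4)[OF R])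
  have cong: "r x = r y" if "suq2_class q x = suq2_class q y" for x y using that by (simp add: r_def)
  have sq: "(norm (r x u))\<^sup>2 = inner (r (free_star x * x) u) u" for x u
    unfolding power2_norm_eq_inner mult adj ..
  have one: "norm (r 1 u) \<le> norm u" for u
  proof -
    have "(norm (r 1 u))\<^sup>2 = inner (r 1 u) u" using sq[of 1 u] by simp
    also have "\<dots> \<le> norm (r 1 u) * norm u" by (rule norm_cauchy_schwarz)
    finally show ?thesis by (cases "norm (r 1 u) = 0") (auto simp: power2_eq_square)
  qed
  then show "norm (R (suq2_class q 1)) \<le> 1" unfolding r_def by (intro norm_bop_bound) auto
  have le: "inner (r 1 u) u \<le> (norm u)\<^sup>2" for u
    using norm_cauchy_schwarz[of "r 1 u" u] mult_right_mono[OF one[of u] norm_ge_zero[of u]]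
    by (simp add: power2_eq_square)
  have star_word: "free_star (word [g]) * word [g] = word [gen_star g, g]" for g
    by (simp add: free_star_single mult_single)
  have "r (word [Alpha_star, Alpha] + word [Beta_star, Beta]) = r 1"
    by (rule cong) (rule class_unit_relations)
  then have 1: "(norm (r (word [Alpha]) u))\<^sup>2 + (norm (r (word [Beta]) u))\<^sup>2 \<le> (norm u)\<^sup>2" for u
    using le[of u] unfolding sq star_word by (simp add: add[symmetric] inner_add_left[symmetric])
  have "r (word [Alpha, Alpha_star] + Poly_Mapping.single [] (of_real (q\<^sup>2)) * word [Beta, Beta_star]) = r 1"
    by (rule cong) (use class_unit_relations(2)[of q] in \<open>simp add: mult_single\<close>)
  moreover have "r (Poly_Mapping.single [] (of_real (q\<^sup>2)) * x) u = q\<^sup>2 *\<^sub>R r x u" for x u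
    unfolding r_def bop_rep_class(3)[OF R] by (intro ell2_eqI) simp
  ultimately have 2: "(norm (r (word [Alpha_star]) u))\<^sup>2 + q\<^sup>2 * (norm (r (word [Beta_star]) u))\<^sup>2 \<le> (norm u)\<^sup>2" for u
    using le[of u] unfolding sq star_word gen_star.simps
    by (metis add inner_add_left inner_scaleR_left)
  have 3: "(norm (r (word [Beta_star]) u))\<^sup>2 = (norm (r (word [Beta]) u))\<^sup>2" for u
    unfolding sq star_word gen_star.simps using cong[OF class_relations(5)] by simp
  have "(norm (r (word [g]) u))\<^sup>2 \<le> (norm u)\<^sup>2" for u
    using 1[of u] 2[of u] 3[of u] zero_le_power2[of "norm (r (word [Beta]) u)"]
      zero_le_power2[of "norm (r (word [Alpha]) u)"]
      mult_nonneg_nonneg[OF zero_le_power2[of q] zero_le_power2[of "norm (r (word [Beta_star]) u)"]]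
    by (cases g; simp only:; linarith)
  then have "norm (r (word [g]) u) \<le> norm u" for u by (rule power2_le_imp_le) simp
  then show "norm (R (suq2_class q (word [g]))) \<le> 1" unfolding r_def by (intro norm_bop_bound) auto
qed

text \<open>Without a bound uniform in the representation the supremum in
  \<open>universal_norm\<close> would carry no information. Monomials are bounded by the modulus of
  their coefficient.\<close>

lemma bop_rep_bounded: "\<exists>K. \<forall>R. bop_rep (SUq2 q) R \<longrightarrow> norm (R (suq2_class q x)) \<le> K"
proof (induction x rule: poly_mapping_induct)
  case zero
  show ?case by (rule exI[of _ 0]) (auto simp: bop_rep_class)
next
  case (single w c)
  have "norm (R (suq2_class q (Poly_Mapping.single w c))) \<le> cmod c" if R: "bop_rep (SUq2 q) R" for R
  proof (induction w)
    case Nil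
    have "R (suq2_class q (Poly_Mapping.single [] c)) = csop c * R (suq2_class q 1)"
      using bop_rep_class(3)[OF R, of c 1] by simp
    also have "norm \<dots> \<le> norm (csop c) * norm (R (suq2_class q 1))" by (rule norm_mult_ineq)
    also have "\<dots> \<le> cmod c * 1"
      by (intro mult_mono norm_csop bop_rep_generator_bound[OF R]) auto
    finally show ?case by simp
  next
    case (Cons g w)
    have "R (suq2_class q (Poly_Mapping.single (g # w) c)) = R (suq2_class q (word [g])) * R (suq2_class q (Poly_Mapping.single w c))"
      using bop_rep_class(2)[OF R, of "word [g]" "Poly_Mapping.single w c"] by (simp add: mult_single)
    also have "norm \<dots> \<le> norm (R (suq2_class q (word [g]))) * norm (R (suq2_class q (Poly_Mapping.single w c)))"
      by (rule norm_mult_ineq)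
    also have "\<dots> \<le> 1 * cmod c" by (intro mult_mono Cons bop_rep_generator_bound[OF R]) auto
    finally show ?case by simp
  qed
  then show ?case by blast
next
  case (add x y)
  then obtain K L where "\<forall>R. bop_rep (SUq2 q) R \<longrightarrow> norm (R (suq2_class q x)) \<le> K"
    "\<forall>R. bop_rep (SUq2 q) R \<longrightarrow> norm (R (suq2_class q y)) \<le> L" by blast
  then have "\<forall>R. bop_rep (SUq2 q) R \<longrightarrow> norm (R (suq2_class q (x + y))) \<le> K + L"
    by (auto simp: bop_rep_class intro: norm_triangle_mono)
  then show ?case by blast
qed

abbreviation unorm :: "real \<Rightarrow> suq2 \<Rightarrow> real" where
  "unorm q \<equiv> universal_norm (SUq2 q)"

lemma star_rep_bop_rep: "star_rep (SUq2 q) I \<rho> \<Longrightarrow> bop_rep (SUq2 q) (\<lambda>a. bext I (\<rho> a))"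
  by (rule star_rep_bext) auto

lemma star_rep_op_norm: "star_rep A I \<rho> \<Longrightarrow> a \<in> carrier A \<Longrightarrow> op_norm I (\<rho> a) = norm (bext I (\<rho> a))"
  by (rule op_norm_bext) (simp add: star_rep_def)

text \<open>Together with \<open>unorm_upper\<close> this replaces the supremum in all later
  estimates. The zero representation keeps its index set nonempty.\<close>

lemma unorm_least:
  assumes a: "a \<in> carrier (SUq2 q)" and K: "\<And>R. bop_rep (SUq2 q) R \<Longrightarrow> norm (R a) \<le> K"
  shows "unorm q a \<le> K"
  unfolding universal_norm_def
proof (rule cSUP_least)
  have "bop_rep (SUq2 q) (\<lambda>_. 0)" by (simp add: bop_rep_def)
  then show "{(I, \<rho>). star_rep (SUq2 q) I \<rho>} \<noteq> {}" using bop_rep_star_rep by blast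
qed (use K[OF star_rep_bop_rep] star_rep_op_norm[OF _ a] in auto)

lemma unorm_upper:
  assumes a: "a \<in> carrier (SUq2 q)" and R: "bop_rep (SUq2 q) R"
  shows "norm (R a) \<le> unorm q a"
proof -
  obtain x where x: "a = suq2_class q x" using a by (auto simp: carrier_SUq2)
  obtain K where K: "\<And>R. bop_rep (SUq2 q) R \<Longrightarrow> norm (R a) \<le> K"
    using bop_rep_bounded[of q x] unfolding x by blast
  have bdd: "bdd_above ((\<lambda>(I, \<rho>). op_norm I (\<rho> a)) ` {(I, \<rho>). star_rep (SUq2 q) I \<rho>})"
    by (rule bdd_aboveI2[where M=K]) (use K[OF star_rep_bop_rep] star_rep_op_norm[OF _ a] in auto)
  have "norm (R a) = op_norm UNIV (to_oper (R a))" using op_norm_bext[OF bounded_to_oper] by simp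
  also have "\<dots> \<le> unorm q a"
    unfolding universal_norm_def
    using cSUP_upper[OF _ bdd, of "(UNIV, \<lambda>a. to_oper (R a))"] bop_rep_star_rep[OF R] by simp
  finally show ?thesis .
qed

lemma unorm_nonneg: "a \<in> carrier (SUq2 q) \<Longrightarrow> 0 \<le> unorm q a"
  using unorm_upper[of a q "\<lambda>_. 0"] by (simp add: bop_rep_def)

lemma unorm_add:
  assumes "a \<in> carrier (SUq2 q)" "b \<in> carrier (SUq2 q)"
  shows "unorm q (a \<oplus>\<^bsub>SUq2 q\<^esub> b) \<le> unorm q a + unorm q b"
proof (rule unorm_least)
  fix R assume R: "bop_rep (SUq2 q) R"
  then have "R (a \<oplus>\<^bsub>SUq2 q\<^esub> b) = R a + R b" using assms by (auto simp: bop_rep_def)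
  also have "norm \<dots> \<le> norm (R a) + norm (R b)" by (rule norm_triangle_ineq)
  also have "\<dots> \<le> unorm q a + unorm q b" using R assms by (intro add_mono unorm_upper)
  finally show "norm (R (a \<oplus>\<^bsub>SUq2 q\<^esub> b)) \<le> unorm q a + unorm q b" .
qed (use assms in auto)

lemma unorm_mult:
  assumes "a \<in> carrier (SUq2 q)" "b \<in> carrier (SUq2 q)"
  shows "unorm q (a \<otimes>\<^bsub>SUq2 q\<^esub> b) \<le> unorm q a * unorm q b"
proof (rule unorm_least)
  fix R assume R: "bop_rep (SUq2 q) R"
  then have "R (a \<otimes>\<^bsub>SUq2 q\<^esub> b) = R a * R b" using assms by (auto simp: bop_rep_def)
  also have "norm \<dots> \<le> norm (R a) * norm (R b)" by (rule norm_mult_ineq)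
  also have "\<dots> \<le> unorm q a * unorm q b" using R assms by (intro mult_mono unorm_upper unorm_nonneg) auto
  finally show "norm (R (a \<otimes>\<^bsub>SUq2 q\<^esub> b)) \<le> unorm q a * unorm q b" .
qed (use assms in auto)

lemma unorm_smult:
  assumes "a \<in> carrier (SUq2 q)"
  shows "unorm q (smult (SUq2 q) c a) \<le> cmod c * unorm q a"
proof (rule unorm_least)
  fix R assume R: "bop_rep (SUq2 q) R"
  then have "R (smult (SUq2 q) c a) = csop c * R a" using assms by (auto simp: bop_rep_def)
  also have "norm \<dots> \<le> norm (csop c) * norm (R a)" by (rule norm_mult_ineq)
  also have "\<dots> \<le> cmod c * unorm q a" using R assms by (intro mult_mono unorm_upper norm_csop) auto
  finally show "norm (R (smult (SUq2 q) c a)) \<le> cmod c * unorm q a" .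
qed (use assms in auto)

text \<open>The squared norm of S x is the inner product of x with T S x; one factor
  cancels.\<close>

lemma norm_adjoint_le:
  assumes "\<And>x y. inner (app S x) y = inner x (app T y)" shows "norm S \<le> norm T"
proof (rule norm_bop_bound)
  fix x
  have "(norm (app S x))\<^sup>2 = inner x (app T (app S x))" by (simp add: power2_norm_eq_inner assms)
  also have "\<dots> \<le> norm x * norm (app T (app S x))" by (rule norm_cauchy_schwarz)
  also have "\<dots> \<le> norm x * (norm T * norm (app S x))" by (intro mult_left_mono norm_app) auto
  finally have "norm (app S x) * norm (app S x) \<le> norm T * norm x * norm (app S x)"
    by (simp add: power2_eq_square mult_ac)
  then show "norm (app S x) \<le> norm T * norm x"
    by (cases "norm (app S x) = 0") auto
qed auto

lemma unorm_star:
  assumes "a \<in> carrier (SUq2 q)"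
  shows "unorm q (star (SUq2 q) a) \<le> unorm q a"
proof (rule unorm_least)
  fix R assume R: "bop_rep (SUq2 q) R"
  then have "norm (R (star (SUq2 q) a)) \<le> norm (R a)"
    using assms by (intro norm_adjoint_le) (auto simp: bop_rep_def)
  also have "\<dots> \<le> unorm q a" using R assms by (intro unorm_upper)
  finally show "norm (R (star (SUq2 q) a)) \<le> unorm q a" .
qed (use assms in auto)

lemma unorm_zero: "unorm q (suq2_class q 0) = 0"
  using unorm_least[of "suq2_class q 0" q 0] unorm_nonneg[of "suq2_class q 0" q]
  by (auto simp: bop_rep_class)

subsection \<open>Cauchy sequences\<close>

definition udist :: "real \<Rightarrow> suq2 \<Rightarrow> suq2 \<Rightarrow> real" where
  "udist q a b = unorm q (a \<ominus>\<^bsub>SUq2 q\<^esub> b)"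

lemma udist_self [simp]: "a \<in> carrier (SUq2 q) \<Longrightarrow> udist q a a = 0"
  by (auto simp: udist_def carrier_SUq2 unorm_zero)

lemma udist_nonneg: "a \<in> carrier (SUq2 q) \<Longrightarrow> b \<in> carrier (SUq2 q) \<Longrightarrow> 0 \<le> udist q a b"
  by (simp add: udist_def unorm_nonneg)

lemma udist_commute:
  assumes "a \<in> carrier (SUq2 q)" "b \<in> carrier (SUq2 q)" shows "udist q a b = udist q b a"
proof -
  have le: "udist q a b \<le> udist q b a" if "a \<in> carrier (SUq2 q)" "b \<in> carrier (SUq2 q)" for a b
  proof -
    obtain x y where "a = suq2_class q x" "b = suq2_class q y" using \<open>a \<in> _\<close> \<open>b \<in> _\<close> by (auto simp: carrier_SUq2)
    moreover have "Poly_Mapping.single [] (-1) * (y - x) = (x - y)"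
      using word_Nil by (simp add: single_uminus)
    ultimately have "a \<ominus>\<^bsub>SUq2 q\<^esub> b = smult (SUq2 q) (-1) (b \<ominus>\<^bsub>SUq2 q\<^esub> a)" by simp
    then show ?thesis unfolding udist_def using unorm_smult[of "b \<ominus>\<^bsub>SUq2 q\<^esub> a" q "-1"] that by simp
  qed
  show ?thesis using le assms by (intro antisym)
qed

lemma udist_triangle:
  assumes "a \<in> carrier (SUq2 q)" "b \<in> carrier (SUq2 q)" "c \<in> carrier (SUq2 q)"
  shows "udist q a c \<le> udist q a b + udist q b c"
proof -
  have "a \<ominus>\<^bsub>SUq2 q\<^esub> c = (a \<ominus>\<^bsub>SUq2 q\<^esub> b) \<oplus>\<^bsub>SUq2 q\<^esub> (b \<ominus>\<^bsub>SUq2 q\<^esub> c)"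
    using assms by (auto simp: carrier_SUq2)
  then show ?thesis unfolding udist_def using assms by (simp add: unorm_add)
qed

lemma udist_add:
  assumes "a \<in> carrier (SUq2 q)" "b \<in> carrier (SUq2 q)" "c \<in> carrier (SUq2 q)" "d \<in> carrier (SUq2 q)"
  shows "udist q (a \<oplus>\<^bsub>SUq2 q\<^esub> c) (b \<oplus>\<^bsub>SUq2 q\<^esub> d) \<le> udist q a b + udist q c d"
proof -
  have "(a \<oplus>\<^bsub>SUq2 q\<^esub> c) \<ominus>\<^bsub>SUq2 q\<^esub> (b \<oplus>\<^bsub>SUq2 q\<^esub> d) = (a \<ominus>\<^bsub>SUq2 q\<^esub> b) \<oplus>\<^bsub>SUq2 q\<^esub> (c \<ominus>\<^bsub>SUq2 q\<^esub> d)"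
    using assms by (auto simp: carrier_SUq2 algebra_simps)
  then show ?thesis unfolding udist_def using assms by (simp add: unorm_add)
qed

lemma udist_mult:
  assumes "a \<in> carrier (SUq2 q)" "b \<in> carrier (SUq2 q)" "c \<in> carrier (SUq2 q)" "d \<in> carrier (SUq2 q)"
  shows "udist q (a \<otimes>\<^bsub>SUq2 q\<^esub> c) (b \<otimes>\<^bsub>SUq2 q\<^esub> d) \<le> udist q a b * unorm q c + unorm q b * udist q c d"
proof -
  have "(a \<otimes>\<^bsub>SUq2 q\<^esub> c) \<ominus>\<^bsub>SUq2 q\<^esub> (b \<otimes>\<^bsub>SUq2 q\<^esub> d) = ((a \<ominus>\<^bsub>SUq2 q\<^esub> b) \<otimes>\<^bsub>SUq2 q\<^esub> c) \<oplus>\<^bsub>SUq2 q\<^esub> (b \<otimes>\<^bsub>SUq2 q\<^esub> (c \<ominus>\<^bsub>SUq2 q\<^esub> d))"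
    using assms by (auto simp: carrier_SUq2 algebra_simps)
  then show ?thesis unfolding udist_def
    using unorm_add[of "(a \<ominus>\<^bsub>SUq2 q\<^esub> b) \<otimes>\<^bsub>SUq2 q\<^esub> c" q "b \<otimes>\<^bsub>SUq2 q\<^esub> (c \<ominus>\<^bsub>SUq2 q\<^esub> d)"]
      unorm_mult[of "a \<ominus>\<^bsub>SUq2 q\<^esub> b" q c] unorm_mult[of b q "c \<ominus>\<^bsub>SUq2 q\<^esub> d"] assms by simp
qed

lemma udist_smult:
  assumes "a \<in> carrier (SUq2 q)" "b \<in> carrier (SUq2 q)"
  shows "udist q (smult (SUq2 q) c a) (smult (SUq2 q) c b) \<le> cmod c * udist q a b"
proof -
  have "smult (SUq2 q) c a \<ominus>\<^bsub>SUq2 q\<^esub> smult (SUq2 q) c b = smult (SUq2 q) c (a \<ominus>\<^bsub>SUq2 q\<^esub> b)"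
    using assms by (auto simp: carrier_SUq2 right_diff_distrib)
  then show ?thesis unfolding udist_def using assms by (simp add: unorm_smult)
qed

lemma udist_star:
  assumes "a \<in> carrier (SUq2 q)" "b \<in> carrier (SUq2 q)"
  shows "udist q (star (SUq2 q) a) (star (SUq2 q) b) \<le> udist q a b"
proof -
  have "star (SUq2 q) a \<ominus>\<^bsub>SUq2 q\<^esub> star (SUq2 q) b = star (SUq2 q) (a \<ominus>\<^bsub>SUq2 q\<^esub> b)"
    using assms by (auto simp: carrier_SUq2 free_star_diff)
  then show ?thesis unfolding udist_def using assms by (simp add: unorm_star)
qed

abbreviation cau :: "real \<Rightarrow> (nat \<Rightarrow> suq2) set" where "cau q \<equiv> cauchy_seqs (SUq2 q)"
abbreviation env :: "real \<Rightarrow> (nat \<Rightarrow> suq2) set star_alg" where "env q \<equiv> enveloping (SUq2 q)"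
abbreviation ncl :: "real \<Rightarrow> (nat \<Rightarrow> suq2) \<Rightarrow> (nat \<Rightarrow> suq2) set" where
  "ncl q s \<equiv> null_rel (SUq2 q) `` {s}"

lemma cau_iff: "s \<in> cau q \<longleftrightarrow> (\<forall>n. s n \<in> carrier (SUq2 q)) \<and>
    (\<forall>e>0. \<exists>N. \<forall>m\<ge>N. \<forall>n\<ge>N. udist q (s m) (s n) < e)"
  by (simp add: cauchy_seqs_def udist_def)

lemma cau_carrier: "s \<in> cau q \<Longrightarrow> s n \<in> carrier (SUq2 q)"
  by (simp add: cau_iff)

lemma null_iff: "(s, t) \<in> null_rel (SUq2 q) \<longleftrightarrow> s \<in> cau q \<and> t \<in> cau q \<and> (\<lambda>n. udist q (s n) (t n)) \<longlonglongrightarrow> 0"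
  by (simp add: null_rel_def udist_def)

text \<open>One Lipschitz estimate in two sequences covers all operations of the completion. Unary
  ones take the same sequence twice, whence the doubled distances in \<open>udist_smult'\<close> and
  \<open>udist_star'\<close>.\<close>

lemma null_combine:
  assumes "(\<lambda>n. udist q (s n) (s' n)) \<longlonglongrightarrow> 0" "(\<lambda>n. udist q (t n) (t' n)) \<longlonglongrightarrow> 0"
    and "\<And>n. u n \<in> carrier (SUq2 q)" "\<And>n. u' n \<in> carrier (SUq2 q)"
    and le: "\<And>n. udist q (u n) (u' n) \<le> K * (udist q (s n) (s' n) + udist q (t n) (t' n))"
  shows "(\<lambda>n. udist q (u n) (u' n)) \<longlonglongrightarrow> 0"
proof (rule tendsto_sandwich[OF _ always_eventually[OF allI[OF le]] tendsto_const])
  have "(\<lambda>n. K * (udist q (s n) (s' n) + udist q (t n) (t' n))) \<longlonglongrightarrow> K * (0 + 0)"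
    by (intro tendsto_intros assms)
  then show "(\<lambda>n. K * (udist q (s n) (s' n) + udist q (t n) (t' n))) \<longlonglongrightarrow> 0" by simp
  show "\<forall>\<^sub>F n in sequentially. 0 \<le> udist q (u n) (u' n)"
    using assms by (intro always_eventually allI udist_nonneg)
qed

lemma cau_combine:
  assumes s: "s \<in> cau q" and t: "t \<in> cau q" and u: "\<And>n. u n \<in> carrier (SUq2 q)"
    and le: "\<And>m n. udist q (u m) (u n) \<le> K * (udist q (s m) (s n) + udist q (t m) (t n))"
  shows "u \<in> cau q"
  unfolding cau_iff
proof (intro conjI allI impI)
  fix e :: real assume e: "e > 0"
  define d where "d = e / (2 * (\<bar>K\<bar> + 1))"
  have d: "d > 0" using e by (simp add: d_def add_nonneg_pos)
  obtain N where N: "\<forall>m\<ge>N. \<forall>n\<ge>N. udist q (s m) (s n) < d" using s d by (auto simp: cau_iff)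
  obtain M where M: "\<forall>m\<ge>M. \<forall>n\<ge>M. udist q (t m) (t n) < d" using t d by (auto simp: cau_iff)
  have "udist q (u m) (u n) < e" if "m \<ge> max N M" "n \<ge> max N M" for m n
  proof -
    let ?x = "udist q (s m) (s n) + udist q (t m) (t n)"
    have "udist q (s m) (s n) < d" "udist q (t m) (t n) < d" using N M that by auto
    moreover have "0 \<le> udist q (s m) (s n)" "0 \<le> udist q (t m) (t n)"
      using s t by (auto intro!: udist_nonneg cau_carrier)
    ultimately have x: "?x < 2 * d" "0 \<le> ?x" by auto
    have "udist q (u m) (u n) \<le> K * ?x" by (rule le)
    also have "\<dots> \<le> (\<bar>K\<bar> + 1) * ?x" using x(2) by (intro mult_right_mono) auto
    also have "\<dots> < (\<bar>K\<bar> + 1) * (2 * d)" using x(1) by (intro mult_strict_left_mono) auto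
    also have "\<dots> = e" using e by (simp add: d_def field_simps add_nonneg_eq_0_iff)
    finally show ?thesis .
  qed
  then show "\<exists>N. \<forall>m\<ge>N. \<forall>n\<ge>N. udist q (u m) (u n) < e" by blast
qed (rule u)

lemma cau_const [simp]: "a \<in> carrier (SUq2 q) \<Longrightarrow> (\<lambda>n. a) \<in> cau q"
  by (simp add: cau_iff)

text \<open>Multiplication is Lipschitz only on bounded sets; this supplies the constants for
  \<open>udist_mult_bound\<close>.\<close>

lemma cau_bounded:
  assumes s: "s \<in> cau q" shows "\<exists>K. \<forall>n. unorm q (s n) \<le> K"
proof -
  have le: "unorm q a \<le> unorm q b + udist q a b" if "a \<in> carrier (SUq2 q)" "b \<in> carrier (SUq2 q)" for a b
  proof -
    have "a = (a \<ominus>\<^bsub>SUq2 q\<^esub> b) \<oplus>\<^bsub>SUq2 q\<^esub> b" using that by (auto simp: carrier_SUq2)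
    then show ?thesis using unorm_add[of "a \<ominus>\<^bsub>SUq2 q\<^esub> b" q b] that by (simp add: udist_def)
  qed
  have "Cauchy (\<lambda>n. unorm q (s n))"
  proof (rule metric_CauchyI)
    fix e :: real assume "e > 0"
    then obtain N where N: "\<forall>m\<ge>N. \<forall>n\<ge>N. udist q (s m) (s n) < e" using s by (auto simp: cau_iff)
    have "dist (unorm q (s m)) (unorm q (s n)) < e" if "m \<ge> N" "n \<ge> N" for m n
      using le[of "s m" "s n"] le[of "s n" "s m"] N[rule_format, OF that] N[rule_format, OF that(2,1)]
        cau_carrier[OF s] by (force simp: dist_real_def abs_if)
    then show "\<exists>N. \<forall>m\<ge>N. \<forall>n\<ge>N. dist (unorm q (s m)) (unorm q (s n)) < e" by blast
  qed
  then have "Bseq (\<lambda>n. unorm q (s n))" by (rule Cauchy_Bseq)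
  then obtain K where "\<forall>n. norm (unorm q (s n)) \<le> K" by (auto simp: Bseq_def)
  then have "\<forall>n. unorm q (s n) \<le> K" by (auto simp: abs_le_iff)
  then show ?thesis ..
qed

lemma null_equiv: "equiv (cau q) (null_rel (SUq2 q))"
proof (rule equivI)
  show "null_rel (SUq2 q) \<subseteq> cau q \<times> cau q" by (auto simp: null_iff)
  show "refl_on (cau q) (null_rel (SUq2 q))" by (auto simp: refl_on_def null_iff cau_carrier)
  show "sym (null_rel (SUq2 q))"
  proof (rule symI)
    fix s t assume st: "(s, t) \<in> null_rel (SUq2 q)"
    then have "(\<lambda>n. udist q (t n) (s n)) = (\<lambda>n. udist q (s n) (t n))"
      by (intro ext udist_commute) (auto simp: null_iff cau_carrier)
    with st show "(t, s) \<in> null_rel (SUq2 q)" by (auto simp: null_iff)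
  qed
  show "trans (null_rel (SUq2 q))"
  proof (rule transI)
    fix s t u assume st: "(s, t) \<in> null_rel (SUq2 q)" and tu: "(t, u) \<in> null_rel (SUq2 q)"
    have "(\<lambda>n. udist q (s n) (u n)) \<longlonglongrightarrow> 0"
      by (rule null_combine[of q s t t u _ _ 1]) (use st tu in \<open>auto simp: null_iff cau_carrier udist_triangle\<close>)
    with st tu show "(s, u) \<in> null_rel (SUq2 q)" by (auto simp: null_iff)
  qed
qed

lemma ncl_eq: "(s, t) \<in> null_rel (SUq2 q) \<Longrightarrow> ncl q s = ncl q t"
  by (rule equiv_class_eq[OF null_equiv])

lemma ncl_self: "s \<in> cau q \<Longrightarrow> s \<in> ncl q s"
  by (rule equiv_class_self[OF null_equiv])

lemma ncl_UN1:
  assumes "s \<in> cau q" "\<And>s'. (s, s') \<in> null_rel (SUq2 q) \<Longrightarrow> f s' = c" shows "(\<Union>s'\<in>ncl q s. f s') = c"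
  using assms ncl_self by blast

lemma ncl_UN2:
  assumes "s \<in> cau q" "t \<in> cau q"
    "\<And>s' t'. (s, s') \<in> null_rel (SUq2 q) \<Longrightarrow> (t, t') \<in> null_rel (SUq2 q) \<Longrightarrow> f s' t' = c"
  shows "(\<Union>s'\<in>ncl q s. \<Union>t'\<in>ncl q t. f s' t') = c"
  using assms by (intro ncl_UN1) auto

lemma env_carrier: "carrier (env q) = ncl q ` cau q"
  by (auto simp: enveloping_def quotient_def)

lemma cau_add: "s \<in> cau q \<Longrightarrow> t \<in> cau q \<Longrightarrow> (\<lambda>n. s n \<oplus>\<^bsub>SUq2 q\<^esub> t n) \<in> cau q"
  by (rule cau_combine[of s q t _ 1]) (auto simp: cau_carrier udist_add)

lemma env_add: assumes s: "s \<in> cau q" and t: "t \<in> cau q"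
  shows "ncl q s \<oplus>\<^bsub>env q\<^esub> ncl q t = ncl q (\<lambda>n. s n \<oplus>\<^bsub>SUq2 q\<^esub> t n)"
proof -
  have "(\<Union>s'\<in>ncl q s. \<Union>t'\<in>ncl q t. ncl q (\<lambda>n. s' n \<oplus>\<^bsub>SUq2 q\<^esub> t' n)) = ncl q (\<lambda>n. s n \<oplus>\<^bsub>SUq2 q\<^esub> t n)"
  proof (rule ncl_UN2[OF s t], rule ncl_eq[symmetric])
    fix s' t' assume a: "(s, s') \<in> null_rel (SUq2 q)" "(t, t') \<in> null_rel (SUq2 q)"
    have "(\<lambda>n. udist q (s n \<oplus>\<^bsub>SUq2 q\<^esub> t n) (s' n \<oplus>\<^bsub>SUq2 q\<^esub> t' n)) \<longlonglongrightarrow> 0"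
      by (rule null_combine[of q s s' t t' _ _ 1]) (use a in \<open>auto simp: null_iff cau_carrier udist_add\<close>)
    with a show "(\<lambda>n. s n \<oplus>\<^bsub>SUq2 q\<^esub> t n, \<lambda>n. s' n \<oplus>\<^bsub>SUq2 q\<^esub> t' n) \<in> null_rel (SUq2 q)"
      by (auto simp: null_iff cau_add)
  qed
  then show ?thesis by (simp add: enveloping_def)
qed

lemma udist_mult_bound:
  assumes "a \<in> carrier (SUq2 q)" "b \<in> carrier (SUq2 q)" "c \<in> carrier (SUq2 q)" "d \<in> carrier (SUq2 q)"
    and "unorm q c \<le> K" "unorm q b \<le> L"
  shows "udist q (a \<otimes>\<^bsub>SUq2 q\<^esub> c) (b \<otimes>\<^bsub>SUq2 q\<^esub> d) \<le> (\<bar>K\<bar> + \<bar>L\<bar>) * (udist q a b + udist q c d)"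
proof -
  have "udist q a b * unorm q c \<le> udist q a b * (\<bar>K\<bar> + \<bar>L\<bar>)" "unorm q b * udist q c d \<le> (\<bar>K\<bar> + \<bar>L\<bar>) * udist q c d"
    using assms by (intro mult_left_mono mult_right_mono udist_nonneg; force)+
  then show ?thesis using udist_mult[OF assms(1-4)] by (simp add: algebra_simps)
qed

lemma cau_mult: assumes "s \<in> cau q" "t \<in> cau q" shows "(\<lambda>n. s n \<otimes>\<^bsub>SUq2 q\<^esub> t n) \<in> cau q"
proof -
  obtain K L where KL: "\<And>n. unorm q (t n) \<le> K" "\<And>n. unorm q (s n) \<le> L" using assms cau_bounded by meson
  show ?thesis
    by (rule cau_combine[of s q t _ "\<bar>K\<bar> + \<bar>L\<bar>"]) (use KL assms in \<open>auto simp: cau_carrier udist_mult_bound\<close>)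
qed

lemma env_mult: assumes s: "s \<in> cau q" and t: "t \<in> cau q"
  shows "ncl q s \<otimes>\<^bsub>env q\<^esub> ncl q t = ncl q (\<lambda>n. s n \<otimes>\<^bsub>SUq2 q\<^esub> t n)"
proof -
  have "(\<Union>s'\<in>ncl q s. \<Union>t'\<in>ncl q t. ncl q (\<lambda>n. s' n \<otimes>\<^bsub>SUq2 q\<^esub> t' n)) = ncl q (\<lambda>n. s n \<otimes>\<^bsub>SUq2 q\<^esub> t n)"
  proof (rule ncl_UN2[OF s t], rule ncl_eq[symmetric])
    fix s' t' assume a: "(s, s') \<in> null_rel (SUq2 q)" "(t, t') \<in> null_rel (SUq2 q)"
    then have s': "s' \<in> cau q" "t' \<in> cau q" by (auto simp: null_iff)
    obtain K L where KL: "\<And>n. unorm q (t n) \<le> K" "\<And>n. unorm q (s' n) \<le> L" using s' t cau_bounded by meson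
    have "(\<lambda>n. udist q (s n \<otimes>\<^bsub>SUq2 q\<^esub> t n) (s' n \<otimes>\<^bsub>SUq2 q\<^esub> t' n)) \<longlonglongrightarrow> 0"
      by (rule null_combine[of q s s' t t' _ _ "\<bar>K\<bar> + \<bar>L\<bar>"]) (use KL a in \<open>auto simp: null_iff cau_carrier udist_mult_bound\<close>)
    with a show "(\<lambda>n. s n \<otimes>\<^bsub>SUq2 q\<^esub> t n, \<lambda>n. s' n \<otimes>\<^bsub>SUq2 q\<^esub> t' n) \<in> null_rel (SUq2 q)"
      by (auto simp: null_iff cau_mult)
  qed
  then show ?thesis by (simp add: enveloping_def)
qed

lemma udist_smult':
  assumes "a \<in> carrier (SUq2 q)" "b \<in> carrier (SUq2 q)"
  shows "udist q (smult (SUq2 q) c a) (smult (SUq2 q) c b) \<le> cmod c * (udist q a b + udist q a b)"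
proof -
  have "0 \<le> cmod c * udist q a b" using assms by (simp add: udist_nonneg)
  then show ?thesis using udist_smult[OF assms, of c] by (simp add: distrib_left)
qed

lemma udist_star': "a \<in> carrier (SUq2 q) \<Longrightarrow> b \<in> carrier (SUq2 q) \<Longrightarrow>
    udist q (star (SUq2 q) a) (star (SUq2 q) b) \<le> 1 * (udist q a b + udist q a b)"
  using udist_star[of a q b] udist_nonneg[of a q b] by simp

lemma cau_smult: "s \<in> cau q \<Longrightarrow> (\<lambda>n. smult (SUq2 q) c (s n)) \<in> cau q"
  by (rule cau_combine[of s q s _ "cmod c"]) (use udist_smult' in \<open>auto simp: cau_carrier\<close>)

lemma cau_star: "s \<in> cau q \<Longrightarrow> (\<lambda>n. star (SUq2 q) (s n)) \<in> cau q"
  by (rule cau_combine[of s q s _ 1]) (use udist_star' in \<open>auto simp: cau_carrier\<close>)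

lemma env_smult: assumes s: "s \<in> cau q"
  shows "smult (env q) c (ncl q s) = ncl q (\<lambda>n. smult (SUq2 q) c (s n))"
proof -
  have "(\<Union>s'\<in>ncl q s. ncl q (\<lambda>n. smult (SUq2 q) c (s' n))) = ncl q (\<lambda>n. smult (SUq2 q) c (s n))"
  proof (rule ncl_UN1[OF s], rule ncl_eq[symmetric])
    fix s' assume a: "(s, s') \<in> null_rel (SUq2 q)"
    have "(\<lambda>n. udist q (smult (SUq2 q) c (s n)) (smult (SUq2 q) c (s' n))) \<longlonglongrightarrow> 0"
      by (rule null_combine[of q s s' s s' _ _ "cmod c"]) (use a udist_smult' in \<open>auto simp: null_iff cau_carrier\<close>)
    with a show "(\<lambda>n. smult (SUq2 q) c (s n), \<lambda>n. smult (SUq2 q) c (s' n)) \<in> null_rel (SUq2 q)"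
      by (auto simp: null_iff cau_smult)
  qed
  then show ?thesis by (simp add: enveloping_def)
qed

lemma env_star: assumes s: "s \<in> cau q"
  shows "star (env q) (ncl q s) = ncl q (\<lambda>n. star (SUq2 q) (s n))"
proof -
  have "(\<Union>s'\<in>ncl q s. ncl q (\<lambda>n. star (SUq2 q) (s' n))) = ncl q (\<lambda>n. star (SUq2 q) (s n))"
  proof (rule ncl_UN1[OF s], rule ncl_eq[symmetric])
    fix s' assume a: "(s, s') \<in> null_rel (SUq2 q)"
    have "(\<lambda>n. udist q (star (SUq2 q) (s n)) (star (SUq2 q) (s' n))) \<longlonglongrightarrow> 0"
      by (rule null_combine[of q s s' s s' _ _ 1]) (use a udist_star' in \<open>auto simp: null_iff cau_carrier\<close>)
    with a show "(\<lambda>n. star (SUq2 q) (s n), \<lambda>n. star (SUq2 q) (s' n)) \<in> null_rel (SUq2 q)"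
      by (auto simp: null_iff cau_star)
  qed
  then show ?thesis by (simp add: enveloping_def)
qed

lemma env_closed:
  assumes "X \<in> carrier (env q)" "Y \<in> carrier (env q)"
  shows "X \<oplus>\<^bsub>env q\<^esub> Y \<in> carrier (env q)" "X \<otimes>\<^bsub>env q\<^esub> Y \<in> carrier (env q)"
  using assms by (auto simp: env_carrier env_add env_mult intro!: imageI cau_add cau_mult)

lemma env_closed_unary:
  assumes "X \<in> carrier (env q)"
  shows "smult (env q) c X \<in> carrier (env q)" "star (env q) X \<in> carrier (env q)"
  using assms by (auto simp: env_carrier env_smult env_star intro!: imageI cau_smult cau_star)

lemma to_env:
  assumes "a \<in> carrier (SUq2 q)" "b \<in> carrier (SUq2 q)"
  shows "to_enveloping (SUq2 q) a \<in> carrier (env q)"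
    "to_enveloping (SUq2 q) (a \<oplus>\<^bsub>SUq2 q\<^esub> b) = to_enveloping (SUq2 q) a \<oplus>\<^bsub>env q\<^esub> to_enveloping (SUq2 q) b"
    "to_enveloping (SUq2 q) (a \<otimes>\<^bsub>SUq2 q\<^esub> b) = to_enveloping (SUq2 q) a \<otimes>\<^bsub>env q\<^esub> to_enveloping (SUq2 q) b"
    "to_enveloping (SUq2 q) (smult (SUq2 q) c a) = smult (env q) c (to_enveloping (SUq2 q) a)"
    "to_enveloping (SUq2 q) (star (SUq2 q) a) = star (env q) (to_enveloping (SUq2 q) a)"
  using assms by (simp_all add: to_enveloping_def env_carrier env_add env_mult env_smult env_star)

lemma bop_rep_to_env:
  assumes "bop_rep (env q) R" shows "bop_rep (SUq2 q) (\<lambda>a. R (to_enveloping (SUq2 q) a))"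
  using assms unfolding bop_rep_def by (auto simp: to_env)

lemma star_rep_env: "star_rep (env q) I \<rho> \<Longrightarrow> bop_rep (env q) (\<lambda>X. bext I (\<rho> X))"
  by (rule star_rep_bext) (simp_all add: env_closed env_closed_unary)

text \<open>R is contractive for the universal norm, so it extends by limits along representatives.
  That every new value is a norm limit of old ones later carries compactness of commutators over to
  the completion.\<close>

lemma bop_rep_extend:
  assumes R: "bop_rep (SUq2 q) R"
  obtains R' where "bop_rep (env q) R'"
    "\<And>a. a \<in> carrier (SUq2 q) \<Longrightarrow> R' (to_enveloping (SUq2 q) a) = R a"
    "\<And>X. X \<in> carrier (env q) \<Longrightarrow> \<exists>s. (\<forall>n. s n \<in> carrier (SUq2 q)) \<and> (\<lambda>n. R (s n)) \<longlonglongrightarrow> R' X"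
proof -
  have diff: "norm (R a - R b) \<le> udist q a b" if "a \<in> carrier (SUq2 q)" "b \<in> carrier (SUq2 q)" for a b
  proof -
    have "R (a \<ominus>\<^bsub>SUq2 q\<^esub> b) = R a - R b"
      using that bop_rep_class(6)[OF R] by (auto simp: carrier_SUq2)
    then show ?thesis using unorm_upper[of "a \<ominus>\<^bsub>SUq2 q\<^esub> b" q R] that R by (simp add: udist_def)
  qed
  have conv: "\<exists>L. (\<lambda>n. R (s n)) \<longlonglongrightarrow> L" if s: "s \<in> cau q" for s
  proof -
    have "Cauchy (\<lambda>n. R (s n))"
    proof (rule metric_CauchyI)
      fix e :: real assume "e > 0"
      then obtain N where "\<forall>m\<ge>N. \<forall>n\<ge>N. udist q (s m) (s n) < e" using s by (auto simp: cau_iff)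
      moreover have "dist (R (s m)) (R (s n)) \<le> udist q (s m) (s n)" for m n
        unfolding dist_norm by (intro diff cau_carrier[OF s])
      ultimately have "\<forall>m\<ge>N. \<forall>n\<ge>N. dist (R (s m)) (R (s n)) < e" by (meson le_less_trans)
      then show "\<exists>N. \<forall>m\<ge>N. \<forall>n\<ge>N. dist (R (s m)) (R (s n)) < e" by blast
    qed
    then show ?thesis using Cauchy_convergent convergent_def by blast
  qed
  define R' where "R' X = lim (\<lambda>n. R ((SOME s. s \<in> X) n))" for X
  have lim: "(\<lambda>n. R (s n)) \<longlonglongrightarrow> R' (ncl q s)" if s: "s \<in> cau q" for s
  proof -
    define t where "t = (SOME t. t \<in> ncl q s)"
    have "t \<in> ncl q s" unfolding t_def by (rule someI[of "\<lambda>t. t \<in> ncl q s", OF ncl_self[OF s]])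
    then have t: "t \<in> cau q" "(\<lambda>n. udist q (s n) (t n)) \<longlonglongrightarrow> 0" by (auto simp: null_iff)
    obtain L where L: "(\<lambda>n. R (t n)) \<longlonglongrightarrow> L" using conv[OF t(1)] ..
    then have "R' (ncl q s) = L" unfolding R'_def t_def[symmetric] by (rule limI)
    moreover have "(\<lambda>n. R (s n) - R (t n)) \<longlonglongrightarrow> 0"
      by (rule Lim_null_comparison[OF always_eventually t(2)]) (use diff cau_carrier s t in auto)
    from tendsto_add[OF this L] have "(\<lambda>n. R (s n)) \<longlonglongrightarrow> L" by simp
    ultimately show ?thesis by simp
  qed
  have ip: "(\<lambda>n. inner (app (f n) x) y) \<longlonglongrightarrow> inner (app F x) y" "(\<lambda>n. inner y (app (f n) x)) \<longlonglongrightarrow> inner y (app F x)"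
    if "f \<longlonglongrightarrow> F" for f F x y
    by (intro tendsto_intros bounded_linear.tendsto[OF bounded_linear_app_left that])+
  have r: "R (a \<oplus>\<^bsub>SUq2 q\<^esub> b) = R a + R b" "R (smult (SUq2 q) c a) = csop c * R a" "R (a \<otimes>\<^bsub>SUq2 q\<^esub> b) = R a * R b"
    "inner (app (R (star (SUq2 q) a)) x) y = inner x (app (R a) y)"
    if "a \<in> carrier (SUq2 q)" "b \<in> carrier (SUq2 q)" for a b c x y
    using R that by (auto simp: bop_rep_def)
  have "bop_rep (env q) R'"
    unfolding bop_rep_def env_carrier
  proof (intro conjI ballI allI; elim imageE; simp only:)
    fix s t c x y assume s: "s \<in> cau q" 
    note sc = cau_carrier[OF s]
    have "(\<lambda>n. csop c * R (s n)) \<longlonglongrightarrow> R' (smult (env q) c (ncl q s))"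
      using lim[OF cau_smult[OF s], of c] unfolding env_smult[OF s] by (simp add: r(2)[OF sc sc])
    then show "R' (smult (env q) c (ncl q s)) = csop c * R' (ncl q s)"
      by (rule LIMSEQ_unique) (intro tendsto_intros lim s)
    have "(\<lambda>n. inner x (app (R (s n)) y)) \<longlonglongrightarrow> inner (app (R' (star (env q) (ncl q s))) x) y"
      using ip(1)[OF lim[OF cau_star[OF s]], of x y] unfolding env_star[OF s] by (simp add: r(4)[OF sc sc])
    then show "inner (app (R' (star (env q) (ncl q s))) x) y = inner x (app (R' (ncl q s)) y)"
      by (rule LIMSEQ_unique) (rule ip(2)[OF lim[OF s]])
    assume t: "t \<in> cau q"
    note tc = cau_carrier[OF t]
    have "(\<lambda>n. R (s n) + R (t n)) \<longlonglongrightarrow> R' (ncl q s \<oplus>\<^bsub>env q\<^esub> ncl q t)"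
      using lim[OF cau_add[OF s t]] unfolding env_add[OF s t] by (simp add: r(1)[OF sc tc])
    then show "R' (ncl q s \<oplus>\<^bsub>env q\<^esub> ncl q t) = R' (ncl q s) + R' (ncl q t)"
      by (rule LIMSEQ_unique) (intro tendsto_intros lim s t)
    have "(\<lambda>n. R (s n) * R (t n)) \<longlonglongrightarrow> R' (ncl q s \<otimes>\<^bsub>env q\<^esub> ncl q t)"
      using lim[OF cau_mult[OF s t]] unfolding env_mult[OF s t] by (simp add: r(3)[OF sc tc])
    then show "R' (ncl q s \<otimes>\<^bsub>env q\<^esub> ncl q t) = R' (ncl q s) * R' (ncl q t)"
      by (rule LIMSEQ_unique) (intro tendsto_intros lim s t)
  qed
  moreover have "R' (to_enveloping (SUq2 q) a) = R a" if "a \<in> carrier (SUq2 q)" for a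
    using lim[OF cau_const[OF that]] unfolding to_enveloping_def by (simp add: LIMSEQ_const_iff)
  moreover have "\<exists>s. (\<forall>n. s n \<in> carrier (SUq2 q)) \<and> (\<lambda>n. R (s n)) \<longlonglongrightarrow> R' X" if "X \<in> carrier (env q)" for X
    using that lim cau_carrier unfolding env_carrier by blast
  ultimately show ?thesis by (rule that)
qed

section \<open>The index pairing\<close>

context traced_ideal
begin

text \<open>X1 and X2 embed two complementary copies, with left inverses Y1 and Y2. Block sums of
  parametrices are parametrices, and rotating Y past X splits the trace.\<close>

lemma index_sum:
  assumes iso: "Y1 * X1 = 1" "Y2 * X2 = 1" "Y1 * X2 = 0" "Y2 * X1 = 0" "X1 * Y1 + X2 * Y2 = 1"
    and T: "fredholm T1" "fredholm T2"
  shows "index (X1 * T1 * Y1 + X2 * T2 * Y2) = index T1 + index T2"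
proof -
  obtain S1 S2 where S: "parametrix T1 S1" "parametrix T2 S2" using T by (auto simp: fredholm_def)
  have iso': "Y1 * (X1 * z) = z" "Y2 * (X2 * z) = z" "Y1 * (X2 * z) = 0" "Y2 * (X1 * z) = 0" for z
    using iso(1-4) by (simp_all add: mult.assoc[symmetric])
  have prod: "(X1 * A1 * Y1 + X2 * A2 * Y2) * (X1 * B1 * Y1 + X2 * B2 * Y2) - 1
      = X1 * (A1 * B1 - 1) * Y1 + X2 * (A2 * B2 - 1) * Y2" for A1 A2 B1 B2
  proof -
    have "(X1 * A1 * Y1 + X2 * A2 * Y2) * (X1 * B1 * Y1 + X2 * B2 * Y2) = X1 * A1 * B1 * Y1 + X2 * A2 * B2 * Y2"
      by (simp add: distrib_left distrib_right mult.assoc iso')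
    then show ?thesis using iso(5) by (simp add: algebra_simps)
  qed
  have tr: "tr (X1 * R1 * Y1 + X2 * R2 * Y2) = tr R1 + tr R2" if "R1 \<in> J" "R2 \<in> J" for R1 R2
    using that tr_comm[of "X1 * R1" Y1] tr_comm[of "X2 * R2" Y2]
    by (simp add: tr_add left_mem right_mem iso')
  have "parametrix (X1 * T1 * Y1 + X2 * T2 * Y2) (X1 * S1 * Y1 + X2 * S2 * Y2)"
    using S unfolding parametrix_def prod by (simp add: add_mem left_mem right_mem)
  from index_eq[OF this] show ?thesis
    unfolding prod using S by (simp add: index_eq tr parametrix_def)
qed

text \<open>U is an isomorphism from the range of E to that of G, and both operators are the
  identity off these ranges. Conjugation sees the defects of T only through E; what is lost under 1
  - E has the same trace for both defects.\<close>

lemma index_conj: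
  assumes U: "U' * U = E" "U * U' = G" "E * U' = U'" "U * E = U"
    and T: "E * T = T - (1 - E)" "T * E = T - (1 - E)" "fredholm T"
  shows "index (U * T * U' + (1 - G)) = index T"
proof -
  obtain S where S: "parametrix T S" using T by (auto simp: fredholm_def)
  have "U' * (U * U') = U'" by (simp only: mult.assoc[symmetric] U(1) U(3))
  moreover have "U * U' * U = U" by (simp only: mult.assoc U(1) U(4))
  ultimately have UG: "U' * G = U'" "G * U = U" unfolding U(2) .
  have GG: "G * G = G" using UG(1) U(2) by (metis mult.assoc)
  have EE: "E * E = E" using U(1,4) by (metis mult.assoc)
  define D where "D = 1 - E"
  have DT: "D * T = D" "T * D = D" "D * D = D" "E * D = 0"
    unfolding D_def by (simp_all add: left_diff_distrib right_diff_distrib T(1,2) EE)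
  have prod: "(U * A * U' + (1 - G)) * (U * B * U' + (1 - G)) = U * (A * E * B) * U' + (1 - G)" for A B
  proof -
    have "U * A * U' * (1 - G) = 0" using UG(1) by (simp add: right_diff_distrib mult.assoc)
    moreover have "(1 - G) * (U * B * U') = 0" using UG(2) by (simp add: left_diff_distrib mult.assoc[symmetric])
    moreover have "(1 - G) * (1 - G) = 1 - G" using GG by (simp add: algebra_simps)
    moreover have "U * A * U' * (U * B * U') = U * (A * E * B) * U'" using U(1) by (simp add: mult.assoc[symmetric]) (simp add: mult.assoc U(1))
    ultimately show ?thesis by (simp add: distrib_left distrib_right)
  qed
  have TS: "(U * T * U' + (1 - G)) * (U * S * U' + (1 - G)) - 1 = U * (T * S - 1) * U'"
  proof -
    have "U * (T * E * S) * U' = U * (E * T * S) * U'" using T(1,2) by simp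
    also have "\<dots> = U * (T * S) * U'" using U(4) by (simp add: mult.assoc[symmetric])
    finally show ?thesis unfolding prod using U(2) by (simp add: algebra_simps)
  qed
  have ST: "(U * S * U' + (1 - G)) * (U * T * U' + (1 - G)) - 1 = U * (S * T - 1) * U'"
  proof -
    have "U * (S * E * T) * U' = U * (S * (T * E)) * U'" using T(1,2) by (simp add: mult.assoc)
    also have "\<dots> = U * (S * T) * U'" using U(3) by (simp add: mult.assoc)
    finally show ?thesis unfolding prod using U(2) by (simp add: algebra_simps)
  qed
  have tr: "tr (U * R * U') = tr (E * R)" if "R \<in> J" for R
    using tr_comm[OF left_mem[OF that], of U U'] U(1) by (simp add: mult.assoc[symmetric])
  have R: "T * S - 1 \<in> J" "S * T - 1 \<in> J" using S by (auto simp: parametrix_def)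
  have P: "parametrix (U * T * U' + (1 - G)) (U * S * U' + (1 - G))"
    unfolding parametrix_def TS ST using R by (simp add: left_mem right_mem)
  have "index (U * T * U' + (1 - G)) = tr (E * (T * S - 1)) - tr (E * (S * T - 1))"
    using index_eq[OF P] unfolding TS ST by (simp add: tr R)
  \<comment> \<open>A parametrix S need not respect E, so these parts need not vanish. Since T D = D
    T = D, both have the same compression to D.\<close>
  moreover have "tr (D * (T * S - 1)) = tr (D * (S * T - 1))"
  proof -
    have Z: "D * (T * S - 1) = D * (S - 1)" "(S * T - 1) * D = (S - 1) * D"
      using DT by (simp_all add: algebra_simps mult.assoc[symmetric])
    have "tr (D * (T * S - 1)) = tr (D * (D * (T * S - 1)))" using DT(3) by (simp add: mult.assoc[symmetric])
    also have "\<dots> = tr (D * (T * S - 1) * D)" using tr_comm[OF left_mem[OF R(1)], of D D] by simp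
    also have "\<dots> = tr (D * ((S * T - 1) * D))" unfolding Z by (simp add: mult.assoc)
    also have "\<dots> = tr ((S * T - 1) * D * D)" using tr_comm[OF right_mem[OF R(2)], of D D] by simp
    also have "\<dots> = tr ((S * T - 1) * D)" using DT(3) by (simp add: mult.assoc)
    also have "\<dots> = tr (D * (S * T - 1))" by (rule tr_comm[OF R(2)])
    finally show ?thesis .
  qed
  moreover have "tr (E * X) = tr X - tr (D * X)" if "X \<in> J" for X
  proof -
    have "E * X = X - D * X" by (simp add: D_def algebra_simps)
    then show ?thesis using tr_diff[OF that left_mem[OF that]] by simp
  qed
  ultimately show ?thesis using R by (simp add: index_eq[OF S])
qed

end

subsection \<open>Two-by-two matrices of operators\<close>

text \<open>Isometries onto the even and the odd coordinates, with adjoints \<open>W1\<close> and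
  \<open>W2\<close>: generators of a Cuntz algebra, which identify \<open>bop\<close> with its own 2
  x 2 matrices. The parity agrees with \<open>sum_encode\<close>.\<close>

definition V1 :: bop where "V1 = wop (\<lambda>n. of_bool (even n)) (\<lambda>n. n div 2)"
definition V2 :: bop where "V2 = wop (\<lambda>n. of_bool (odd n)) (\<lambda>n. n div 2)"
definition W1 :: bop where "W1 = wop (\<lambda>_. 1) (\<lambda>n. 2 * n)"
definition W2 :: bop where "W2 = wop (\<lambda>_. 1) (\<lambda>n. 2 * n + 1)"

lemma coord_VW [simp]:
  "coord (app V1 x) n = (if even n then coord x (n div 2) else 0)"
  "coord (app V2 x) n = (if odd n then coord x (n div 2) else 0)"
  "coord (app W1 x) n = coord x (2 * n)"
  "coord (app W2 x) n = coord x (2 * n + 1)"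
  unfolding V1_def V2_def W1_def W2_def
  by (subst coord_wop[where C=1]; auto simp: inj_on_def elim!: evenE oddE)+

lemma VW_relations:
  "W1 * V1 = 1" "W2 * V2 = 1" "W1 * V2 = 0" "W2 * V1 = 0" "V1 * W1 + V2 * W2 = 1"
proof -
  show "V1 * W1 + V2 * W2 = 1"
    by (intro bop_eqI ell2_eqI) (auto simp: odd_two_times_div_two_succ)
qed (intro bop_eqI ell2_eqI; simp)+

lemma VW_assoc: "W1 * (V1 * x) = x" "W2 * (V2 * x) = x" "W1 * (V2 * x) = 0" "W2 * (V1 * x) = 0"
  using VW_relations by (simp_all add: mult.assoc[symmetric])

definition mat2 :: "bop \<Rightarrow> bop \<Rightarrow> bop \<Rightarrow> bop \<Rightarrow> bop" where
  "mat2 A B C D = V1 * A * W1 + V1 * B * W2 + V2 * C * W1 + V2 * D * W2"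

lemma mat2_mult: "mat2 A B C D * mat2 A' B' C' D' =
    mat2 (A * A' + B * C') (A * B' + B * D') (C * A' + D * C') (C * B' + D * D')"
  unfolding mat2_def by (simp add: distrib_left distrib_right mult.assoc VW_assoc add_ac)

lemma mat2_add: "mat2 A B C D + mat2 A' B' C' D' = mat2 (A + A') (B + B') (C + C') (D + D')"
  unfolding mat2_def by (simp add: distrib_left distrib_right add_ac)

lemma mat2_diff: "mat2 A B C D - mat2 A' B' C' D' = mat2 (A - A') (B - B') (C - C') (D - D')"
  unfolding mat2_def by (simp add: left_diff_distrib right_diff_distrib algebra_simps)

lemma mat2_one: "mat2 1 0 0 1 = 1"
  using VW_relations by (simp add: mat2_def)

lemma mat2_zero: "mat2 0 0 0 0 = 0"
  by (simp add: mat2_def)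

lemma mat2_hs: "hs A \<Longrightarrow> hs B \<Longrightarrow> hs C \<Longrightarrow> hs D \<Longrightarrow> hs (mat2 A B C D)"
  unfolding mat2_def by (intro hs_add hs_mult_left hs_mult_right)

lemma mat2_closure:
  assumes "A \<in> closure trace_class" "B \<in> closure trace_class" "C \<in> closure trace_class" "D \<in> closure trace_class"
  shows "mat2 A B C D \<in> closure trace_class"
  unfolding mat2_def using assms by (simp add: TC.closure_add TC.closure_left TC.closure_right)

lemma mat2_trace:
  assumes "A \<in> trace_class" "B \<in> trace_class" "C \<in> trace_class" "D \<in> trace_class"
  shows "trace (mat2 A B C D) = trace A + trace D"
proof -
  have t: "trace (V * X * W) = trace (W * V * X)" if "X \<in> trace_class" for V W X
    using TC.tr_comm[OF TC.left_mem[OF that], of V W] by (simp add: mult.assoc)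
  show ?thesis
    unfolding mat2_def using assms VW_relations
      t[OF assms(1), of V1 W1] t[OF assms(2), of V1 W2] t[OF assms(3), of V2 W1] t[OF assms(4), of V2 W2]
    by (simp add: trace_add trace_class.add TC.left_mem TC.right_mem TC.tr_zero)
qed

lemma mat2_tendsto:
  assumes "(A \<longlongrightarrow> A') F" "(B \<longlongrightarrow> B') F" "(C \<longlongrightarrow> C') F" "(D \<longlongrightarrow> D') F"
  shows "((\<lambda>x. mat2 (A x) (B x) (C x) (D x)) \<longlongrightarrow> mat2 A' B' C' D') F"
  unfolding mat2_def by (intro tendsto_intros assms)

subsection \<open>Compression of a unitary to the range of a projection\<close>

text \<open>Completed by the identity off the range of P, so that Fredholm theory in the full
  algebra applies.\<close>

definition compression :: "'a::ring_1 \<Rightarrow> 'a \<Rightarrow> 'a" where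
  "compression P w = P * w * P + (1 - P)"

text \<open>The corner product P w P w' P differs from P w w' P exactly by P times the two
  commutators. This is what makes \<open>compression P w'\<close> a parametrix.\<close>

lemma compression_mult:
  assumes P: "P * P = P" "P * (w * w') * P = P"
  shows "compression P w * compression P w' - 1 = P * (w * P - P * w) * (w' * P - P * w')"
proof -
  have PP: "P * (P * z) = P * z" for z using P(1) by (simp add: mult.assoc[symmetric])
  have ww: "P * (w * (w' * P)) = P" using P(2) by (simp add: mult.assoc)
  show ?thesis unfolding compression_def
    by (simp add: algebra_simps mult.assoc PP P(1) ww)
qed

text \<open>Since d P = (1 - P) d for the commutator d, rotating the second trace moves P in front
  of d and both traces combine. The resulting 2 P - 1 acts as F on a module.\<close>

lemma index_compression_hs:
  assumes P: "P * P = P" "P * (w * w') * P = P" "P * (w' * w) * P = P"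
    and hs: "hs (w * P - P * w)" "hs (w' * P - P * w')"
  shows "TC.index (compression P w) = trace ((2 *\<^sub>R P - 1) * (w * P - P * w) * (w' * P - P * w'))"
proof -
  define d d' where "d = w * P - P * w" and "d' = w' * P - P * w'"
  have dd: "d * d' \<in> trace_class" using hs by (auto simp: d_def d'_def intro: trace_class.prod)
  have hs': "hs d" "hs d'" "hs (P * d')" using hs by (auto simp: d_def d'_def intro: hs_mult_left)
  have 1: "compression P w * compression P w' - 1 = P * d * d'"
    and 2: "compression P w' * compression P w - 1 = P * d' * d"
    using P unfolding d_def d'_def by (simp_all add: compression_mult)
  have m: "P * d * d' \<in> trace_class" "P * d' * d \<in> trace_class"
    using hs by (auto simp: d_def d'_def intro!: trace_class.prod hs_mult_left)
  have "TC.index (compression P w) = trace (P * d * d') - trace (P * d' * d)"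
    using TC.index_eq[of "compression P w" "compression P w'"] m
    unfolding TC.parametrix_def 1 2 by simp
  also have "trace (P * d' * d) = trace (d * (P * d'))" by (rule trace_prod_comm) (use hs' in auto)
  also have "d * (P * d') = d * d' - P * d * d'"
  proof -
    have "d * P = d - P * d" unfolding d_def using P(1)
      by (simp add: algebra_simps mult.assoc) (simp add: mult.assoc[symmetric])
    then show ?thesis by (simp add: mult.assoc[symmetric] left_diff_distrib)
  qed
  also have "trace \<dots> = trace (d * d') - trace (P * d * d')" by (rule TC.tr_diff[OF dd m(1)])
  also have "trace (P * d * d') - (trace (d * d') - trace (P * d * d'))
      = trace (P * d * d' + P * d * d' - d * d')"
    using m dd by (simp add: TC.tr_diff TC.tr_add trace_class.add)
  also have "P * d * d' + P * d * d' - d * d' = (2 *\<^sub>R P - 1) * d * d'"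
    by (simp add: algebra_simps scaleR_2)
  finally show ?thesis by (simp add: d_def d'_def)
qed

lemma fredholm_compression:
  assumes P: "P * P = P" "P * (w * w') * P = P" "P * (w' * w) * P = P"
    and d: "w * P - P * w \<in> closure trace_class" "w' * P - P * w' \<in> closure trace_class"
  shows "TC.fredholm (compression P w)"
  using TC.fredholm_closure[of "compression P w" "compression P w'"] d P
  by (simp add: compression_mult TC.closure_left)

subsection \<open>The Fredholm operator of a module\<close>

text \<open>The operator is the compression of \<open>1 \<oplus> u\<close> to the range of \<open>(Q + F)/2\<close>, where \<open>u\<close> is the
  fundamental unitary with rows \<open>(\<alpha>, - q \<beta>\<^sup>*)\<close> and \<open>(\<beta>, \<alpha>\<^sup>*)\<close>, acting on the range of the image \<open>e\<close>
  of the unit, and \<open>1\<close> acts on the complement of \<open>e\<close> in the module.\<close>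

definition fundamental :: "real \<Rightarrow> bop \<Rightarrow> (suq2 \<Rightarrow> bop) \<Rightarrow> bop" where
  "fundamental q Q R = mat2
     (Q - R (suq2_class q 1) + R (suq2_class q (word [Alpha]))) (- q *\<^sub>R R (suq2_class q (word [Beta_star])))
     (R (suq2_class q (word [Beta]))) (Q - R (suq2_class q 1) + R (suq2_class q (word [Alpha_star])))"

definition fundamental_star :: "real \<Rightarrow> bop \<Rightarrow> (suq2 \<Rightarrow> bop) \<Rightarrow> bop" where
  "fundamental_star q Q R = mat2
     (Q - R (suq2_class q 1) + R (suq2_class q (word [Alpha_star]))) (R (suq2_class q (word [Beta_star])))
     (- q *\<^sub>R R (suq2_class q (word [Beta]))) (Q - R (suq2_class q 1) + R (suq2_class q (word [Alpha])))"

definition diag2 :: "bop \<Rightarrow> bop" where "diag2 A = mat2 A 0 0 A"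

lemma diag2_mult: "diag2 A * mat2 X Y Z W = mat2 (A * X) (A * Y) (A * Z) (A * W)"
  "mat2 X Y Z W * diag2 A = mat2 (X * A) (Y * A) (Z * A) (W * A)"
  by (simp_all add: diag2_def mat2_mult)

lemma diag2_simps: "diag2 A * diag2 B = diag2 (A * B)" "diag2 A + diag2 B = diag2 (A + B)"
  "diag2 A - diag2 B = diag2 (A - B)" "diag2 1 = 1"
  by (simp_all add: diag2_def mat2_mult mat2_add mat2_diff mat2_one)

lemma mat2_scaleR: "r *\<^sub>R mat2 A B C D = mat2 (r *\<^sub>R A) (r *\<^sub>R B) (r *\<^sub>R C) (r *\<^sub>R D)"
  by (simp add: mat2_def scaleR_add_right)

text \<open>As F squares to Q, (Q + F)/2 is the spectral projection of F at eigenvalue 1 within the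
  module, here doubled for 2 x 2 matrices.\<close>

definition module_proj :: "bop \<Rightarrow> bop \<Rightarrow> bop" where
  "module_proj Q F = diag2 ((1/2) *\<^sub>R (Q + F))"

definition module_operator :: "real \<Rightarrow> bop \<Rightarrow> bop \<Rightarrow> (suq2 \<Rightarrow> bop) \<Rightarrow> bop" where
  "module_operator q Q F R = compression (module_proj Q F) (fundamental q Q R)"

lemma csop_of_real: "csop (of_real r) * T = r *\<^sub>R T"
  by (intro bop_eqI ell2_eqI) simp

text \<open>A module transported to \<open>bop\<close>: everything lives in the corner of Q, where F
  squares to the identity. The image of the algebra unit may be smaller than Q.\<close>

locale fredholm_data =
  fixes q :: real and Q F :: bop and R :: "suq2 \<Rightarrow> bop"
  assumes QQ: "Q * Q = Q" and FF: "F * F = Q" and QF: "Q * F = F" and FQ: "F * Q = F"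
    and R: "bop_rep (SUq2 q) R"
    and QR: "a \<in> carrier (SUq2 q) \<Longrightarrow> Q * R a = R a" and RQ: "a \<in> carrier (SUq2 q) \<Longrightarrow> R a * Q = R a"
begin

abbreviation "cl w \<equiv> R (suq2_class q (word w))"
abbreviation "e \<equiv> R (suq2_class q 1)"
abbreviation "P \<equiv> module_proj Q F"
abbreviation "w \<equiv> fundamental q Q R"
abbreviation "w' \<equiv> fundamental_star q Q R"

text \<open>Opposite in sign to \<open>commutator F x\<close>; in the products of two that are
  traced the signs cancel.\<close>

definition com :: "bop \<Rightarrow> bop" where "com x = x * F - F * x"

lemma PP: "P * P = P"
proof -
  have "(Q + F) * (Q + F) = 2 *\<^sub>R (Q + F)"
    by (simp add: distrib_left distrib_right QQ FF QF FQ scaleR_2 add_ac)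
  then have "(1/2) *\<^sub>R (Q + F) * ((1/2) *\<^sub>R (Q + F)) = (1/2) *\<^sub>R (Q + F)"
    unfolding mult_scaleR_left mult_scaleR_right by simp
  then show ?thesis by (simp add: module_proj_def diag2_simps)
qed

lemma PQP: "P * diag2 Q * P = P"
proof -
  have "P * diag2 Q = P" by (simp add: module_proj_def diag2_simps distrib_right QQ FQ)
  then show ?thesis using PP by simp
qed

lemma relations:
  "cl [Alpha_star] * cl [Alpha] = e - cl [Beta] * cl [Beta_star]"
  "cl [Alpha] * cl [Alpha_star] = e - (q * q) *\<^sub>R (cl [Beta] * cl [Beta_star])"
  "cl [Alpha] * cl [Beta] = q *\<^sub>R (cl [Beta] * cl [Alpha])"
  "cl [Alpha] * cl [Beta_star] = q *\<^sub>R (cl [Beta_star] * cl [Alpha])"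
  "cl [Beta_star] * cl [Beta] = cl [Beta] * cl [Beta_star]"
  "cl [Beta_star] * cl [Alpha_star] = q *\<^sub>R (cl [Alpha_star] * cl [Beta_star])"
  "cl [Beta] * cl [Alpha_star] = q *\<^sub>R (cl [Alpha_star] * cl [Beta])"
proof -
  have m: "cl [g] * cl [h] = cl [g, h]" for g h
    using bop_rep_class(2)[OF R, of "word [g]" "word [h]"] by (simp add: mult_single)
  have s: "R (suq2_class q (Poly_Mapping.single w (of_real r))) = r *\<^sub>R cl w" for w r
    using bop_rep_class(3)[OF R, of "of_real r" "word w"] by (simp add: mult_single csop_of_real)
  show "cl [Alpha_star] * cl [Alpha] = e - cl [Beta] * cl [Beta_star]"
    "cl [Alpha] * cl [Alpha_star] = e - (q * q) *\<^sub>R (cl [Beta] * cl [Beta_star])"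
    "cl [Alpha] * cl [Beta] = q *\<^sub>R (cl [Beta] * cl [Alpha])"
    "cl [Alpha] * cl [Beta_star] = q *\<^sub>R (cl [Beta_star] * cl [Alpha])"
    "cl [Beta_star] * cl [Beta] = cl [Beta] * cl [Beta_star]"
    "cl [Beta_star] * cl [Alpha_star] = q *\<^sub>R (cl [Alpha_star] * cl [Beta_star])"
    "cl [Beta] * cl [Alpha_star] = q *\<^sub>R (cl [Alpha_star] * cl [Beta])"
    unfolding m class_relations bop_rep_class(6)[OF R] s by (simp_all only: power2_eq_square)
qed

lemma unit: "e * e = e" "e * cl x = cl x" "cl x * e = cl x"
  using bop_rep_class(2)[OF R, of 1 1] bop_rep_class(2)[OF R, of 1 "word x"] bop_rep_class(2)[OF R, of "word x" 1]
  by simp_all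

text \<open>Unitarity holds in the corner of Q: on e it is the content of the defining relations,
  and on Q - e the matrix is the identity.\<close>

lemma fundamental_unitary: "w * w' = diag2 Q" "w' * w = diag2 Q"
  unfolding fundamental_def fundamental_star_def diag2_def mat2_mult
  by (simp_all add: distrib_left distrib_right left_diff_distrib right_diff_distrib QQ QR RQ unit relations
    flip: scaleR_left_distrib)

lemma commute_proj: assumes "Q * x = x * Q" 
  shows "x * ((1/2) *\<^sub>R (Q + F)) - (1/2) *\<^sub>R (Q + F) * x = (1/2) *\<^sub>R com x"
  using assms by (simp add: com_def algebra_simps)

lemma com_simps: "com (x + y) = com x + com y" "com (x - y) = com x - com y" "com (r *\<^sub>R x) = r *\<^sub>R com x"
  "com Q = 0"
  by (simp_all add: com_def algebra_simps QF FQ)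

text \<open>Q commutes with all entries, so half the commutator with F remains. The entry Q - e
  contributes - \<open>com e\<close>, as e need not commute with F.\<close>

lemma fundamental_commutator:
  "w * P - P * w = (1/2) *\<^sub>R mat2
     (com (cl [Alpha]) - com e) (- q *\<^sub>R com (cl [Beta_star])) (com (cl [Beta])) (com (cl [Alpha_star]) - com e)"
  "w' * P - P * w' = (1/2) *\<^sub>R mat2
     (com (cl [Alpha_star]) - com e) (com (cl [Beta_star])) (- q *\<^sub>R com (cl [Beta])) (com (cl [Alpha]) - com e)"
proof -
  have c: "Q * cl x = cl x * Q" "Q * e = e * Q" for x by (simp_all add: QR RQ)
  have A: "Q * (Q - e + cl x) = (Q - e + cl x) * Q" "Q * (- q *\<^sub>R cl x) = (- q *\<^sub>R cl x) * Q" for x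
    using c by (simp_all add: distrib_left distrib_right left_diff_distrib right_diff_distrib)
  have C: "com (Q - e + cl x) = com (cl x) - com e" "com (- q *\<^sub>R cl x) = - q *\<^sub>R com (cl x)" for x
    by (simp_all add: com_simps del: scaleR_minus_left)
  show "w * P - P * w = (1/2) *\<^sub>R mat2
     (com (cl [Alpha]) - com e) (- q *\<^sub>R com (cl [Beta_star])) (com (cl [Beta])) (com (cl [Alpha_star]) - com e)"
    "w' * P - P * w' = (1/2) *\<^sub>R mat2
     (com (cl [Alpha_star]) - com e) (com (cl [Beta_star])) (- q *\<^sub>R com (cl [Beta])) (com (cl [Alpha]) - com e)"
    unfolding module_proj_def fundamental_def fundamental_star_def diag2_mult mat2_diff
      commute_proj[OF A(1)] commute_proj[OF A(2)] commute_proj[OF c(1)] C mat2_scaleR by (rule refl)+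
qed

lemma fredholm:
  assumes c: "\<And>a. a \<in> carrier (SUq2 q) \<Longrightarrow> com (R a) \<in> closure trace_class"
  shows "TC.fredholm (module_operator q Q F R)"
proof -
  have s: "x \<in> closure trace_class \<Longrightarrow> r *\<^sub>R x \<in> closure trace_class" for x r
    using TC.closure_left[of x "r *\<^sub>R 1"] by simp
  have "w * P - P * w \<in> closure trace_class" "w' * P - P * w' \<in> closure trace_class"
    unfolding fundamental_commutator
    by (intro s mat2_closure TC.closure_diff c class_carrier)+
  then show ?thesis
    unfolding module_operator_def
    using PP PQP by (intro fredholm_compression[where w'=w']) (simp_all add: fundamental_unitary)
qed

text \<open>Both sides equal F x F - x, since F squares to the identity of the module.\<close>

lemma F_com: assumes "Q * x = x" "x * Q = x" shows "F * com x = - (com x * F)"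
proof -
  have "F * (F * x) = x" using FF assms(1) by (simp add: mult.assoc[symmetric])
  moreover have "x * F * F = x" using FF assms(2) by (simp add: mult.assoc)
  ultimately show ?thesis by (simp add: com_def right_diff_distrib left_diff_distrib mult.assoc)
qed

lemma Q_com: assumes "Q * x = x" "x * Q = x" shows "Q * com x = com x"
proof -
  have "Q * (x * F) = x * F" using assms by (simp add: mult.assoc[symmetric])
  moreover have "Q * (F * x) = F * x" using QF by (simp add: mult.assoc[symmetric])
  ultimately show ?thesis by (simp add: com_def right_diff_distrib)
qed

text \<open>On the diagonal of the 2 x 2 product the \<alpha> terms x, y occur in both orders with
  weight 1, the \<beta> terms with weights q^2 and 1. Antisymmetry under the trace cancels the
  former and leaves 1 - q^2; the 1/4 comes from the two halves in
  \<open>fundamental_commutator\<close>.\<close>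

lemma index_hs:
  assumes c: "\<And>a. a \<in> carrier (SUq2 q) \<Longrightarrow> hs (com (R a))"
  shows "TC.index (module_operator q Q F R) =
    of_real ((1 - q * q) / 4) * trace (F * com (cl [Beta]) * com (cl [Beta_star]))"
proof -
  define x y b b' where "x = com (cl [Alpha]) - com e" and "y = com (cl [Alpha_star]) - com e"
    and "b = com (cl [Beta])" and "b' = com (cl [Beta_star])"
  have hs_scale: "hs X \<Longrightarrow> hs (r *\<^sub>R X)" for X r using hs_mult_left[of X "r *\<^sub>R 1"] by simp
  have hs_diff: "hs X \<Longrightarrow> hs Y \<Longrightarrow> hs (X - Y)" for X Y
    using hs_add[of X "(-1) *\<^sub>R Y"] hs_scale[of Y "-1"] by simp
  have h: "hs x" "hs y" "hs b" "hs b'" unfolding x_def y_def b_def b'_def by (intro hs_diff c class_carrier)+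
  have Fx: "F * z = - (z * F)" "Q * z = z" if "z \<in> {x, y, b, b'}" for z
    using that
    by (auto simp: x_def y_def b_def b'_def left_diff_distrib right_diff_distrib F_com[OF QR RQ] Q_com[OF QR RQ])
  have t: "F * u * v \<in> trace_class" if "hs u" "hs v" for u v
    using that by (intro trace_class.prod hs_mult_left)
  \<comment> \<open>Rotation under the trace brings v to the front, where F anticommutes with
    it.\<close>
  have anti: "trace (F * u * v) = - trace (F * v * u)" if "u \<in> {x, y, b, b'}" "v \<in> {x, y, b, b'}" for u v
  proof -
    have hu: "hs u" "hs v" using that h by auto
    have "trace (F * u * v) = trace (v * (F * u))" using hu by (intro trace_prod_comm hs_mult_left)
    also have "v * (F * u) = - (F * v * u)" using Fx(1)[OF that(2)] by (simp add: mult.assoc[symmetric])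
    finally show ?thesis using TC.tr_uminus[OF t[OF hu(2,1)]] by simp
  qed
  have "2 *\<^sub>R P = diag2 (Q + F)" by (simp add: module_proj_def diag2_def mat2_scaleR)
  then have P: "2 *\<^sub>R P - 1 = diag2 (Q + F - 1)" using diag2_simps(3)[of "Q + F" 1] by (simp add: diag2_simps(4))
  \<comment> \<open>Q - 1 annihilates the corner, so of 2 P - 1 only F survives.\<close>
  have Fz: "(Q + F - 1) * (z * v) = F * z * v" if "z \<in> {x, y, b, b'}" for z v
  proof -
    have "Q * (z * v) = z * v" using Fx(2)[OF that] by (simp add: mult.assoc[symmetric])
    then show ?thesis by (simp add: distrib_right left_diff_distrib mult.assoc)
  qed
  have "(2 *\<^sub>R P - 1) * (w * P - P * w) * (w' * P - P * w')
     = (1/4) *\<^sub>R (diag2 (Q + F - 1) * (mat2 x (- q *\<^sub>R b') b y * mat2 y b' (- q *\<^sub>R b) x))"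
    unfolding P fundamental_commutator x_def y_def b_def b'_def
    by (simp add: mult.assoc)
  also have "\<dots> = (1/4) *\<^sub>R mat2 (F * x * y + (q * q) *\<^sub>R (F * b' * b)) (F * x * b' - q *\<^sub>R (F * b' * x))
       (F * b * y - q *\<^sub>R (F * y * b)) (F * b * b' + F * y * x)"
    unfolding mat2_mult diag2_mult by (simp add: distrib_left right_diff_distrib Fz)
  finally have D: "(2 *\<^sub>R P - 1) * (w * P - P * w) * (w' * P - P * w') = \<dots>" .
  have st: "X \<in> trace_class \<Longrightarrow> r *\<^sub>R X \<in> trace_class" for X r using TC.left_mem[of X "r *\<^sub>R 1"] by simp
  have str: "trace (r *\<^sub>R X) = of_real r * trace X" for X r
    unfolding trace_def matcoef_def by (simp add: infsum_cmult_right')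
  have m: "F * x * y + (q * q) *\<^sub>R (F * b' * b) \<in> trace_class" "F * x * b' - q *\<^sub>R (F * b' * x) \<in> trace_class"
       "F * b * y - q *\<^sub>R (F * y * b) \<in> trace_class" "F * b * b' + F * y * x \<in> trace_class"
    using h by (auto intro!: trace_class.add TC.diff_mem st t)
  have "TC.index (module_operator q Q F R) = trace ((2 *\<^sub>R P - 1) * (w * P - P * w) * (w' * P - P * w'))"
    unfolding module_operator_def
  proof (rule index_compression_hs)
    show "hs (w * P - P * w)" "hs (w' * P - P * w')"
      unfolding fundamental_commutator by (intro hs_scale mat2_hs hs_diff c class_carrier)+
  qed (use PP PQP in \<open>simp_all add: fundamental_unitary\<close>)
  also have "\<dots> = of_real (1/4) * (trace (F * x * y + (q * q) *\<^sub>R (F * b' * b)) + trace (F * b * b' + F * y * x))"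
    unfolding D str mat2_trace[OF m] ..
  also have "\<dots> = of_real (1/4) * (trace (F * x * y) + of_real (q * q) * trace (F * b' * b) + (trace (F * b * b') + trace (F * y * x)))"
    using h by (simp add: TC.tr_add t st str)
  also have "\<dots> = of_real ((1 - q * q) / 4) * trace (F * b * b')"
    using anti[of x y] anti[of b' b] by (simp add: algebra_simps)
  finally show ?thesis by (simp add: b_def b'_def)
qed

end

subsection \<open>Fredholm modules\<close>

abbreviation module_rep :: "real \<Rightarrow> nat set \<Rightarrow> ((nat \<Rightarrow> suq2) set \<Rightarrow> oper) \<Rightarrow> suq2 \<Rightarrow> bop" where
  "module_rep q I \<rho> \<equiv> \<lambda>a. bext I (\<rho> (to_enveloping (SUq2 q) a))"

definition module_index :: "real \<Rightarrow> (nat \<Rightarrow> suq2) set ktriple \<Rightarrow> complex" where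
  "module_index q = (\<lambda>(I, \<rho>, F). TC.index (module_operator q (cproj I) (bext I F) (module_rep q I \<rho>)))"

lemma bounded_op_range: "bounded_op I J T \<Longrightarrow> x \<in> l2 I \<Longrightarrow> T x \<in> l2 J"
  by (simp add: bounded_op_def)

lemma fredholm_data_module:
  assumes "(I, \<rho>, F) \<in> odd_fredholm_modules (env q)"
  shows "fredholm_data q (cproj I) (bext I F) (module_rep q I \<rho>)"
proof
  have F: "bounded_op I I F" and FF: "\<And>x. x \<in> l2 I \<Longrightarrow> F (F x) = x" and \<rho>: "star_rep (env q) I \<rho>"
    using assms by (auto simp: odd_fredholm_modules_def)
  have r: "restr I (coord x) \<in> l2 I" for x by (rule restr_l2[OF coord])
  show "cproj I * cproj I = cproj I" by (rule cproj_idem)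
  show "bext I F * bext I F = cproj I"
    by (intro bop_eqI) (simp add: coord_inject[symmetric] coord_bext[OF F] coord_cproj' bounded_op_range[OF F r] FF[OF r])
  show "cproj I * bext I F = bext I F"
    by (intro bop_eqI) (simp add: coord_inject[symmetric] coord_bext[OF F] coord_cproj' bounded_op_range[OF F r])
  show "bext I F * cproj I = bext I F"
    by (intro bop_eqI) (simp add: coord_inject[symmetric] coord_bext[OF F] coord_cproj' r)
  show "bop_rep (SUq2 q) (module_rep q I \<rho>)"
    by (rule bop_rep_to_env) (rule star_rep_env[OF \<rho>])
  fix a assume "a \<in> carrier (SUq2 q)"
  then have b: "bounded_op I I (\<rho> (to_enveloping (SUq2 q) a))"
    using \<rho> to_env(1) by (auto simp: star_rep_def)
  show "cproj I * module_rep q I \<rho> a = module_rep q I \<rho> a"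
    by (intro bop_eqI) (simp add: coord_inject[symmetric] coord_bext[OF b] coord_cproj' bounded_op_range[OF b r])
  show "module_rep q I \<rho> a * cproj I = module_rep q I \<rho> a"
    by (intro bop_eqI) (simp add: coord_inject[symmetric] coord_bext[OF b] coord_cproj' r)
qed

lemma bext_commutator:
  assumes "bounded_op I I S" "bounded_op I I T"
  shows "bext I (commutator S T) = bext I S * bext I T - bext I T * bext I S"
proof (rule bext_unique)
  fix x
  have "restr I (coord x) \<in> l2 I" by (rule restr_l2[OF coord])
  then show "coord (app (bext I S * bext I T - bext I T * bext I S) x) = commutator S T (restr I (coord x))"
    by (auto simp: fun_eq_iff commutator_def coord_bext[OF assms(1)] coord_bext[OF assms(2)]
      bounded_op_range[OF assms(1)] bounded_op_range[OF assms(2)])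
qed

lemma compact_bext:
  assumes "compact_op I T" shows "bext I T \<in> closure trace_class"
proof (rule compact_imp_closure)
  have T: "bounded_op I I T" using assms by (simp add: compact_op_def)
  fix s :: "nat \<Rightarrow> ell2" assume s: "\<And>n. norm (s n) \<le> 1"
  define v where "v n = restr I (coord (s n))" for n
  have "v n \<in> l2 I \<and> l2_norm (v n) \<le> 1" for n
    unfolding v_def using restr_l2[OF coord] norm_restr_le[of I "s n"] s[of n] by (auto intro: order_trans)
  then obtain r y where r: "strict_mono (r :: nat \<Rightarrow> nat)" "y \<in> l2 I" "(\<lambda>n. l2_norm (T (v (r n)) - y)) \<longlonglongrightarrow> 0"
    using assms unfolding compact_op_def by blast
  have "dist (app (bext I T) (s (r n))) (Ell2 y) = l2_norm (T (v (r n)) - y)" for n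
  proof -
    have "coord (app (bext I T) (s (r n)) - Ell2 y) = T (v (r n)) - y"
      using r(2) by (auto simp: coord_bext[OF T] v_def coord_Ell2' fun_diff_def)
    then show ?thesis by (simp add: dist_norm norm_ell2_def)
  qed
  then have "(\<lambda>n. app (bext I T) (s (r n))) \<longlonglongrightarrow> Ell2 y"
    using r(3) by (subst tendsto_dist_iff) simp
  with r(1) show "\<exists>r y. strict_mono (r :: nat \<Rightarrow> nat) \<and> (\<lambda>n. app (bext I T) (s (r n))) \<longlonglongrightarrow> y" by blast
qed

lemma fredholm_module:
  assumes "(I, \<rho>, F) \<in> odd_fredholm_modules (env q)"
  shows "TC.fredholm (module_operator q (cproj I) (bext I F) (module_rep q I \<rho>))"
proof -
  interpret fredholm_data q "cproj I" "bext I F" "module_rep q I \<rho>" by (rule fredholm_data_module[OF assms])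
  show ?thesis
  proof (rule fredholm)
    fix a assume a: "a \<in> carrier (SUq2 q)"
    let ?T = "\<rho> (to_enveloping (SUq2 q) a)"
    have "bounded_op I I F" "bounded_op I I ?T" and c: "compact_op I (commutator F ?T)"
      using assms to_env(1)[OF a a] by (auto simp: odd_fredholm_modules_def star_rep_def)
    then have "com (bext I ?T) = (-1) * bext I (commutator F ?T)"
      by (simp add: bext_commutator com_def)
    then show "com (bext I ?T) \<in> closure trace_class"
      using TC.closure_left[OF compact_bext[OF c], of "-1"] by simp
  qed
qed

subsection \<open>Unitary equivalence\<close>

text \<open>U intertwines all data, so the second operator is a conjugate of the first, completed by
  the identity off Q'. After amplification by \<open>diag2\<close> this is the situation of
  \<open>index_conj\<close>.\<close>

lemma module_operator_conj:
  assumes "fredholm_data q Q F R" "fredholm_data q Q' F' R'"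
    and U: "U' * U = Q" "U * U' = Q'" "Q * U' = U'" "U * Q = U" "U * F = F' * U"
    and UR: "\<And>a. a \<in> carrier (SUq2 q) \<Longrightarrow> U * R a = R' a * U"
    and fr: "TC.fredholm (module_operator q Q F R)"
  shows "TC.index (module_operator q Q' F' R') = TC.index (module_operator q Q F R)"
proof -
  interpret M: fredholm_data q Q F R by fact
  interpret N: fredholm_data q Q' F' R' by fact
  have F': "U * F * U' = F'" unfolding U(5) by (simp add: mult.assoc U N.FQ)
  have R': "U * R a * U' = R' a" if "a \<in> carrier (SUq2 q)" for a
    unfolding UR[OF that] by (simp add: mult.assoc U N.RQ[OF that])
  have Q': "U * Q * U' = Q'" using U by simp
  let ?X = "diag2 U" and ?X' = "diag2 U'" and ?E = "diag2 Q" and ?G = "diag2 Q'"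
  let ?P = "module_proj Q F" and ?w = "fundamental q Q R"
  have w: "fundamental q Q' R' = ?X * ?w * ?X'"
    unfolding fundamental_def diag2_mult
    by (simp add: distrib_left distrib_right left_diff_distrib right_diff_distrib R' Q')
  have P: "module_proj Q' F' = ?X * ?P * ?X'"
    unfolding module_proj_def diag2_simps by (simp add: distrib_left distrib_right F' Q')
  have EP: "?E * ?P = ?P" "?P * ?E = ?P"
    unfolding module_proj_def diag2_simps by (simp_all add: distrib_left distrib_right M.QQ M.QF M.FQ)
  have XX: "?X' * ?X = ?E" "?X * ?X' = ?G" "?E * ?X' = ?X'" "?X * ?E = ?X"
    unfolding diag2_simps U by (rule refl)+
  have XX': "?X' * (?X * z) = ?E * z" "?E * (?P * z) = ?P * z" "?P * (?E * z) = ?P * z" for z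
    using XX(1) EP by (simp_all add: mult.assoc[symmetric])
  have T: "module_operator q Q' F' R' = ?X * module_operator q Q F R * ?X' + (1 - ?G)"
  proof -
    have "?X * (?P * ?w * ?P + (1 - ?P)) * ?X' + (1 - ?G) = ?X * ?P * ?w * ?P * ?X' + (1 - ?X * ?P * ?X')"
      by (simp add: algebra_simps XX(2))
    also have "\<dots> = module_operator q Q' F' R'"
      unfolding module_operator_def compression_def w P by (simp add: mult.assoc XX' XX)
    finally show ?thesis by (simp add: module_operator_def compression_def)
  qed
  have E: "?E * module_operator q Q F R = module_operator q Q F R - (1 - ?E)"
    "module_operator q Q F R * ?E = module_operator q Q F R - (1 - ?E)"
    unfolding module_operator_def compression_def
    by (simp_all add: distrib_left distrib_right left_diff_distrib right_diff_distrib mult.assoc EP XX')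
  show ?thesis unfolding T by (rule TC.index_conj[OF XX E fr])
qed

text \<open>The inverse is chosen pointwise. Injectivity on l^2(I) makes the choice unique and hence
  linear, and the isometry identity bounds it.\<close>

lemma isometry_inverse:
  assumes iso: "\<And>x. norm (app U x) = norm (app (cproj I) x)" and JU: "cproj J * U = U"
    and onto: "\<And>y. \<exists>x. app (cproj I) x = x \<and> app U x = app (cproj J) y"
  obtains V where "V * U = cproj I" "U * V = cproj J" "cproj I * V = V"
proof -
  have uniq: "x = x'" if "app (cproj I) x = x" "app (cproj I) x' = x'" "app U x = app U x'" for x x'
    using iso[of "x - x'"] that by simp
  define f where "f y = (SOME x. app (cproj I) x = x \<and> app U x = app (cproj J) y)" for y
  have f: "app (cproj I) (f y) = f y" "app U (f y) = app (cproj J) y" for y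
    using someI_ex[OF onto[of y]] unfolding f_def by auto
  have "\<exists>V. app V = f"
  proof (rule bop_of_linear)
    show "f (x + y) = f x + f y" for x y by (rule uniq) (simp_all add: f)
    show "f (cscale c x) = cscale c (f x)" for c x by (rule uniq) (simp_all add: f)
    show "norm (f x) \<le> 1 * norm x" for x
      using iso[of "f x"] norm_app[of "cproj J" x] mult_right_mono[OF norm_cproj[of J] norm_ge_zero[of x]] f[of x]
      by (simp add: order_trans)
  qed
  then obtain V where V: "app V = f" ..
  have JU': "app (cproj J) (app U x) = app U x" for x using JU by (metis app_simps(6))
  have UI: "app U (app (cproj I) x) = app U x" for x
  proof -
    have "app (cproj I) (x - app (cproj I) x) = 0" using cproj_idem[of I] by (metis app_simps(6,10) cancel_comm_monoid_add_class.diff_cancel)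
    then show ?thesis using iso[of "x - app (cproj I) x"] by simp
  qed
  have II: "app (cproj I) (app (cproj I) x) = app (cproj I) x" for x
    using cproj_idem[of I] by (metis app_simps(6))
  show ?thesis
  proof (rule that)
    show "V * U = cproj I"
    proof (rule bop_eqI)
      fix x
      have "f (app U x) = app (cproj I) x"
      proof (rule uniq)
        show "app U (f (app U x)) = app U (app (cproj I) x)" unfolding f(2) JU' UI ..
      qed (rule f(1) II)+
      then show "app (V * U) x = app (cproj I) x" by (simp add: V)
    qed
    show "U * V = cproj J" "cproj I * V = V" by (intro bop_eqI; simp add: V f)+
  qed
qed

lemma module_index_unitary:
  assumes M: "M \<in> odd_fredholm_modules (env q)" and N: "N \<in> odd_fredholm_modules (env q)"
    and eq: "unitarily_equivalent (env q) M N"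
  shows "module_index q M = module_index q N"
proof -
  obtain I \<rho> F where MI: "M = (I, \<rho>, F)" by (cases M) auto
  obtain J \<sigma> G where NJ: "N = (J, \<sigma>, G)" by (cases N) auto
  obtain U where U: "bounded_op I J U" "U ` l2 I = l2 J"
    "\<And>x y. x \<in> l2 I \<Longrightarrow> y \<in> l2 I \<Longrightarrow> l2_inner (U x) (U y) = l2_inner x y"
    "\<And>x. x \<in> l2 I \<Longrightarrow> U (F x) = G (U x)"
    "\<And>b x. b \<in> carrier (env q) \<Longrightarrow> x \<in> l2 I \<Longrightarrow> U (\<rho> b x) = \<sigma> b (U x)"
    using eq unfolding MI NJ unitarily_equivalent_def by auto
  have r: "restr I (coord x) \<in> l2 I" for x by (rule restr_l2[OF coord])
  let ?U = "bext I U"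
  have cU: "coord (app ?U x) = U (restr I (coord x))" for x by (rule coord_bext[OF U(1)])
  have Ul2: "U x \<in> l2 J" if "x \<in> l2 I" for x by (rule bounded_op_range[OF U(1) that])
  have JU: "cproj J * ?U = ?U"
    by (intro bop_eqI) (simp add: coord_inject[symmetric] cU coord_cproj' Ul2[OF r])
  have UI: "?U * cproj I = ?U"
    by (intro bop_eqI) (simp add: coord_inject[symmetric] cU coord_cproj' r)
  obtain V where V: "V * ?U = cproj I" "?U * V = cproj J" "cproj I * V = V"
  proof (rule isometry_inverse[OF _ JU])
    show "norm (app ?U x) = norm (app (cproj I) x)" for x
      unfolding norm_eq_sqrt_inner inner_ell2_def cU coord_cproj' using U(3)[OF r r] by simp
    show "\<exists>x. app (cproj I) x = x \<and> app ?U x = app (cproj J) y" for y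
    proof -
      have "restr J (coord y) \<in> U ` l2 I" using U(2) restr_l2[OF coord] by simp
      then obtain v where v: "v \<in> l2 I" "U v = restr J (coord y)" by (metis imageE)
      then have "app (cproj I) (Ell2 v) = Ell2 v \<and> app ?U (Ell2 v) = app (cproj J) y"
        by (simp add: coord_inject[symmetric] cU coord_cproj' coord_Ell2')
      then show ?thesis by blast
    qed
  qed
  have bF: "bounded_op I I F" "bounded_op J J G" using M N unfolding MI NJ by (auto simp: odd_fredholm_modules_def)
  have UF: "?U * bext I F = bext J G * ?U"
    by (intro bop_eqI)
       (simp add: coord_inject[symmetric] cU coord_bext[OF bF(1)] coord_bext[OF bF(2)] bounded_op_range[OF bF(1) r] Ul2[OF r] U(4)[OF r])
  have UR: "?U * module_rep q I \<rho> a = module_rep q J \<sigma> a * ?U" if "a \<in> carrier (SUq2 q)" for a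
  proof -
    have e: "to_enveloping (SUq2 q) a \<in> carrier (env q)" by (rule to_env(1)[OF that that])
    then have b: "bounded_op I I (\<rho> (to_enveloping (SUq2 q) a))" "bounded_op J J (\<sigma> (to_enveloping (SUq2 q) a))"
      using M N unfolding MI NJ by (auto simp: odd_fredholm_modules_def star_rep_def)
    show ?thesis
      by (intro bop_eqI)
        (simp add: coord_inject[symmetric] cU coord_bext[OF b(1)] coord_bext[OF b(2)] bounded_op_range[OF b(1) r] Ul2[OF r] U(5)[OF e r])
  qed
  show ?thesis
    using module_operator_conj[OF fredholm_data_module[OF M[unfolded MI]] fredholm_data_module[OF N[unfolded NJ]] V UI UF UR
      fredholm_module[OF M[unfolded MI]]]
    by (simp add: module_index_def MI NJ)
qed

subsection \<open>Operator homotopy\<close>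

lemma bext_diff:
  assumes S: "bounded_op I I S" and T: "bounded_op I I T"
  shows "bext I (S - T) = bext I S - bext I T" "bounded_op I I (S - T)"
proof -
  have c: "coord (app (bext I S - bext I T) x) = (S - T) (restr I (coord x))" for x
    by (auto simp: coord_bext[OF S] coord_bext[OF T])
  then show "bext I (S - T) = bext I S - bext I T" by (rule bext_unique)
  have e: "(S - T) x = coord (app (bext I S - bext I T) (Ell2 x))" if "x \<in> l2 I" for x
    using that unfolding c by (simp add: coord_Ell2')
  show "bounded_op I I (S - T)"
    unfolding bounded_op_def
  proof (intro conjI ballI allI exI)
    fix x y c assume x: "x \<in> l2 I" and y: "y \<in> l2 I"
    have "(\<lambda>i. S x i + (-1) * T x i) \<in> l2 I"
      using bounded_op_range[OF S x] bounded_op_range[OF T x] by (intro l2_add l2_cmul)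
    then show "(S - T) x \<in> l2 I" by (simp add: fun_diff_def)
    show "(S - T) (\<lambda>i. c * x i + y i) = (\<lambda>i. c * (S - T) x i + (S - T) y i)"
      using S T x y by (auto simp: bounded_op_def algebra_simps)
    show "l2_norm ((S - T) x) \<le> norm (bext I S - bext I T) * l2_norm x"
      using norm_app[of "bext I S - bext I T" "Ell2 x"] unfolding e[OF x] by (simp add: norm_ell2_def coord_Ell2'[OF x])
  qed
qed

text \<open>The representation is fixed and only F moves, so the operator depends on t through the
  projection alone, continuously in norm.\<close>

lemma module_index_homotopy:
  assumes "operator_homotopic (env q) M N"
  shows "module_index q M = module_index q N"
proof -
  obtain I \<rho> H where H: "M = (I, \<rho>, H (0::real))" "N = (I, \<rho>, H 1)"
      "\<And>t. t \<in> {0..1} \<Longrightarrow> (I, \<rho>, H t) \<in> odd_fredholm_modules (env q)"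
      "\<And>t. t \<in> {0..1} \<Longrightarrow> ((\<lambda>s. op_norm I (H s - H t)) \<longlongrightarrow> 0) (at t within {0..1})"
    using assms unfolding operator_homotopic_def by auto
  have b: "bounded_op I I (H t)" if "t \<in> {0..1}" for t using H(3)[OF that] by (simp add: odd_fredholm_modules_def)
  have cont: "((\<lambda>s. bext I (H s)) \<longlongrightarrow> bext I (H t)) (at t within {0..1})" if t: "t \<in> {0..1}" for t
  proof -
    have "op_norm I (H s - H t) = dist (bext I (H s)) (bext I (H t))" if "s \<in> {0..1}" for s
      using bext_diff[OF b[OF that] b[OF t]] by (simp add: dist_norm op_norm_bext)
    then have "((\<lambda>s. dist (bext I (H s)) (bext I (H t))) \<longlongrightarrow> 0) (at t within {0..1})"
      using H(4)[OF t] by (subst (asm) tendsto_cong) (auto simp: eventually_at_topological intro!: exI[of _ UNIV])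
    then show ?thesis by (rule tendsto_dist_iff[THEN iffD2])
  qed
  have "TC.index (module_operator q (cproj I) (bext I (H 0)) (module_rep q I \<rho>))
      = TC.index (module_operator q (cproj I) (bext I (H 1)) (module_rep q I \<rho>))"
  proof (rule TC.index_homotopy)
    fix t :: real assume t: "t \<in> {0..1}"
    show "TC.fredholm (module_operator q (cproj I) (bext I (H t)) (module_rep q I \<rho>))"
      by (rule fredholm_module[OF H(3)[OF t]])
    show "((\<lambda>t. module_operator q (cproj I) (bext I (H t)) (module_rep q I \<rho>)) \<longlongrightarrow>
         module_operator q (cproj I) (bext I (H t)) (module_rep q I \<rho>)) (at t within {0..1})"
      unfolding module_operator_def compression_def module_proj_def diag2_def
      by (intro tendsto_intros mat2_tendsto cont t)
  qed
  then show ?thesis by (simp add: H module_index_def)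
qed

subsection \<open>Direct sums\<close>

definition bop_sum :: "bop \<Rightarrow> bop \<Rightarrow> bop" where "bop_sum A B = V1 * A * W1 + V2 * B * W2"

lemma compression_sum:
  fixes X1 :: "'a::ring_1"
  assumes iso: "Y1 * X1 = 1" "Y2 * X2 = 1" "Y1 * X2 = 0" "Y2 * X1 = 0" "X1 * Y1 + X2 * Y2 = 1"
  shows "compression (X1 * P1 * Y1 + X2 * P2 * Y2) (X1 * w1 * Y1 + X2 * w2 * Y2)
    = X1 * compression P1 w1 * Y1 + X2 * compression P2 w2 * Y2"
proof -
  have iso': "Y1 * (X1 * z) = z" "Y2 * (X2 * z) = z" "Y1 * (X2 * z) = 0" "Y2 * (X1 * z) = 0" for z
    using iso(1-4) by (simp_all add: mult.assoc[symmetric])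
  have "X1 * compression P1 w1 * Y1 + X2 * compression P2 w2 * Y2
     = X1 * P1 * w1 * P1 * Y1 + X2 * P2 * w2 * P2 * Y2 + ((X1 * Y1 + X2 * Y2) - (X1 * P1 * Y1 + X2 * P2 * Y2))"
    by (simp add: compression_def algebra_simps)
  also have "\<dots> = compression (X1 * P1 * Y1 + X2 * P2 * Y2) (X1 * w1 * Y1 + X2 * w2 * Y2)"
    unfolding compression_def iso(5) by (simp add: distrib_left distrib_right mult.assoc iso')
  finally show ?thesis by simp
qed

text \<open>Amplification to matrices respects \<open>bop_sum\<close>, so the sum of two modules has
  the block sum as its operator.\<close>

lemma module_operator_sum:
  assumes "TC.fredholm (module_operator q Q F R)" "TC.fredholm (module_operator q Q' F' R')"
  shows "TC.index (module_operator q (bop_sum Q Q') (bop_sum F F') (\<lambda>a. bop_sum (R a) (R' a)))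
    = TC.index (module_operator q Q F R) + TC.index (module_operator q Q' F' R')"
proof -
  have iso: "diag2 W1 * diag2 V1 = 1" "diag2 W2 * diag2 V2 = 1" "diag2 W1 * diag2 V2 = 0" "diag2 W2 * diag2 V1 = 0"
    "diag2 V1 * diag2 W1 + diag2 V2 * diag2 W2 = 1"
    unfolding diag2_simps VW_relations by (simp_all add: diag2_simps) (simp_all add: diag2_def mat2_zero)
  have w: "fundamental q (bop_sum Q Q') (\<lambda>a. bop_sum (R a) (R' a))
    = diag2 V1 * fundamental q Q R * diag2 W1 + diag2 V2 * fundamental q Q' R' * diag2 W2"
    unfolding fundamental_def diag2_mult mat2_add bop_sum_def
    by (rule arg_cong4[where f=mat2]) (simp_all add: algebra_simps)
  have P: "module_proj (bop_sum Q Q') (bop_sum F F')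
    = diag2 V1 * module_proj Q F * diag2 W1 + diag2 V2 * module_proj Q' F' * diag2 W2"
    unfolding module_proj_def diag2_simps bop_sum_def by (simp add: algebra_simps)
  show ?thesis
    using TC.index_sum[OF iso assms] unfolding module_operator_def w P compression_sum[OF iso] .
qed

lemma coord_bop_sum: "coord (app (bop_sum A B) x) n =
    (if even n then coord (app A (app W1 x)) (n div 2) else coord (app B (app W2 x)) (n div 2))"
  by (simp add: bop_sum_def)

lemma sum_encode_simps: "sum_encode (Inl k) = 2 * k" "sum_encode (Inr k) = 2 * k + 1"
  "sum_decode (2 * k) = Inl k" "sum_decode (Suc (2 * k)) = Inr k"
  by (simp_all add: sum_encode_def sum_decode_def)

lemma mem_sum_encode: "n \<in> sum_encode ` A \<longleftrightarrow> sum_decode n \<in> A"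
  using inj_image_mem_iff[OF inj_sum_encode, of "sum_decode n" A] by simp

lemma restr_sum_encode:
  "(\<lambda>k. restr (sum_encode ` (Sum_Type.Plus I J)) v (sum_encode (Inl k))) = restr I (\<lambda>k. v (2 * k))"
  "(\<lambda>k. restr (sum_encode ` (Sum_Type.Plus I J)) v (sum_encode (Inr k))) = restr J (\<lambda>k. v (2 * k + 1))"
  unfolding restr_def mem_sum_encode by (auto simp: fun_eq_iff sum_encode_simps)

lemma cproj_sum: "cproj (sum_encode ` (Sum_Type.Plus I J)) = bop_sum (cproj I) (cproj J)"
proof (intro bop_eqI ell2_eqI)
  fix x n
  show "coord (app (cproj (sum_encode ` (Sum_Type.Plus I J))) x) n = coord (app (bop_sum (cproj I) (cproj J)) x) n"
    unfolding coord_cproj mem_sum_encode by (auto simp: coord_bop_sum sum_decode_def)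
qed

lemma bext_sum:
  assumes S: "bounded_op I I S" and T: "bounded_op J J T"
  shows "bext (sum_encode ` (Sum_Type.Plus I J)) (op_sum S T) = bop_sum (bext I S) (bext J T)"
proof (rule bext_unique)
  have W: "coord (app W1 x) = (\<lambda>k. coord x (2 * k))" "coord (app W2 x) = (\<lambda>k. coord x (2 * k + 1))" for x
    by (auto simp: fun_eq_iff)
  show "coord (app (bop_sum (bext I S) (bext J T)) x) = op_sum S T (restr (sum_encode ` (Sum_Type.Plus I J)) (coord x))" for x
    unfolding op_sum_def restr_sum_encode
    by (auto simp: fun_eq_iff coord_bop_sum coord_bext[OF S] coord_bext[OF T] W sum_decode_def)
qed

lemma module_index_sum:
  assumes M: "M \<in> odd_fredholm_modules (env q)" and N: "N \<in> odd_fredholm_modules (env q)"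
  shows "module_index q (ktriple_sum M N) = module_index q M + module_index q N"
proof -
  obtain I \<rho> F where MI: "M = (I, \<rho>, F)" by (cases M) auto
  obtain J \<sigma> G where NJ: "N = (J, \<sigma>, G)" by (cases N) auto
  have b: "bounded_op I I F" "bounded_op J J G" using M N unfolding MI NJ by (auto simp: odd_fredholm_modules_def)
  have R: "module_rep q (sum_encode ` (Sum_Type.Plus I J)) (\<lambda>b. op_sum (\<rho> b) (\<sigma> b)) a = bop_sum (module_rep q I \<rho> a) (module_rep q J \<sigma> a)"
    if "a \<in> carrier (SUq2 q)" for a
    using M N to_env(1)[OF that that] unfolding MI NJ
    by (intro bext_sum) (auto simp: odd_fredholm_modules_def star_rep_def)
  have "fundamental q Q (module_rep q (sum_encode ` (Sum_Type.Plus I J)) (\<lambda>b. op_sum (\<rho> b) (\<sigma> b)))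
     = fundamental q Q (\<lambda>a. bop_sum (module_rep q I \<rho> a) (module_rep q J \<sigma> a))" for Q
    unfolding fundamental_def by (simp add: R)
  then show ?thesis
    using module_operator_sum[OF fredholm_module[OF M[unfolded MI]] fredholm_module[OF N[unfolded NJ]]]
    by (simp add: MI NJ module_index_def ktriple_sum_def module_operator_def cproj_sum bext_sum[OF b])
qed

section \<open>Constructing Fredholm modules\<close>

definition adjoint_pair :: "bop \<Rightarrow> bop \<Rightarrow> bool" where
  "adjoint_pair S T \<longleftrightarrow> (\<forall>x y. inner (app S x) y = inner x (app T y))"

lemma adjoint_pair_algebra:
  "adjoint_pair S T \<Longrightarrow> adjoint_pair S' T' \<Longrightarrow> adjoint_pair (S + S') (T + T')"
  "adjoint_pair S T \<Longrightarrow> adjoint_pair S' T' \<Longrightarrow> adjoint_pair (S * S') (T' * T)"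
  "adjoint_pair 0 0" "adjoint_pair 1 1"
  by (simp_all add: adjoint_pair_def inner_add_left inner_add_right)

lemma adjoint_pair_csop: "adjoint_pair (csop (cnj c)) (csop c)"
  unfolding adjoint_pair_def inner_ell2 by (auto intro!: infsum_cong simp: algebra_simps)

lemma adjoint_pair_sym: "adjoint_pair S T \<Longrightarrow> adjoint_pair T S"
  unfolding adjoint_pair_def by (metis inner_commute)

text \<open>The index maps are mutually inverse between the supports of the two weights, so the sum
  for the inner product is reindexed.\<close>

lemma adjoint_pair_wop:
  assumes C: "\<And>n. cmod (w n) \<le> 1" "\<And>n. cmod (w' n) \<le> 1"
    and g: "\<And>n. w n \<noteq> 0 \<Longrightarrow> g' (g n) = n \<and> w' (g n) = cnj (w n)"
    and g': "\<And>n. w' n \<noteq> 0 \<Longrightarrow> g (g' n) = n \<and> w (g' n) = cnj (w' n)"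
  shows "adjoint_pair (wop w g) (wop w' g')"
  unfolding adjoint_pair_def
proof (intro allI)
  fix x y
  let ?S = "{n. w n \<noteq> 0}" and ?S' = "{n. w' n \<noteq> 0}"
  have inj: "inj_on g ?S" "inj_on g' ?S'" using g g' by (auto intro: inj_on_inverseI)
  note c = coord_wop[of w, OF C(1) inj(1)] coord_wop[of w', OF C(2) inj(2)]
  have bij: "bij_betw g ?S ?S'"
    by (rule bij_betwI[where g=g']) (use g g' in auto)
  have "inner (app (wop w g) x) y = (\<Sum>\<^sub>\<infinity>n\<in>?S. Re (w n * coord x (g n) * cnj (coord y n)))"
    unfolding inner_ell2 by (rule infsum_cong_neutral) (auto simp: c)
  also have "\<dots> = (\<Sum>\<^sub>\<infinity>n\<in>?S. Re (coord x (g n) * cnj (w' (g n) * coord y (g' (g n)))))"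
    by (rule infsum_cong) (use g in \<open>auto simp: algebra_simps\<close>)
  also have "\<dots> = (\<Sum>\<^sub>\<infinity>m\<in>?S'. Re (coord x m * cnj (w' m * coord y (g' m))))"
    by (rule infsum_reindex_bij_betw[OF bij])
  also have "\<dots> = inner x (app (wop w' g') y)"
    unfolding inner_ell2 by (rule infsum_cong_neutral) (auto simp: c)
  finally show "inner (app (wop w g) x) y = inner x (app (wop w' g') y)" .
qed

lemma closure_imp_compact_op:
  assumes T: "T \<in> closure trace_class" "cproj K * T = T" and b: "bounded_op K K S"
    and S: "\<And>v. v \<in> l2 K \<Longrightarrow> S v = coord (app T (Ell2 v))"
  shows "compact_op K S"
  unfolding compact_op_def
proof (intro conjI allI impI)
  fix s :: "nat \<Rightarrow> vec" assume s: "\<forall>n. s n \<in> l2 K \<and> l2_norm (s n) \<le> 1"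
  then have "norm (Ell2 (s n)) \<le> 1" for n using norm_Ell2[of "s n" K] by simp
  from closure_imp_compact[of T "\<lambda>n. Ell2 (s n)", OF T(1) this] obtain r y
    where r: "strict_mono (r :: nat \<Rightarrow> nat)" "(\<lambda>n. app T (Ell2 (s (r n)))) \<longlonglongrightarrow> y" by blast
  \<comment> \<open>The limit must lie in l^2(K). The range of T does, and the projection is
    continuous.\<close>
  have Ky: "app (cproj K) y = y"
  proof (rule LIMSEQ_unique)
    show "(\<lambda>n. app (cproj K) (app T (Ell2 (s (r n))))) \<longlonglongrightarrow> app (cproj K) y"
      by (rule bounded_linear.tendsto[OF bounded_linear_app r(2)])
    show "(\<lambda>n. app (cproj K) (app T (Ell2 (s (r n))))) \<longlonglongrightarrow> y"
      using r(2) T(2) by (simp flip: app_simps(6))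
  qed
  have "l2_norm (S (s (r n)) - coord y) = dist (app T (Ell2 (s (r n)))) y" for n
  proof -
    have "coord (app T (Ell2 (s (r n))) - y) = S (s (r n)) - coord y" using s S by (auto simp: fun_diff_def)
    then show ?thesis by (simp add: dist_norm norm_ell2_def)
  qed
  moreover have "coord y \<in> l2 K" using restr_l2[OF coord[of y], of K] Ky by (simp flip: coord_cproj')
  moreover have "(\<lambda>n. dist (app T (Ell2 (s (r n)))) y) \<longlonglongrightarrow> 0" by (rule tendsto_dist_iff[THEN iffD1, OF r(2)])
  ultimately show "\<exists>r y. strict_mono r \<and> y \<in> l2 K \<and> (\<lambda>n. l2_norm (S (s (r n)) - y)) \<longlonglongrightarrow> 0"
    using r(1) by (intro exI[of _ r] exI[of _ "coord y"]) simp
qed (rule b)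

lemma bounded_op_from_bop:
  assumes "cproj K * T = T" and S: "\<And>v. v \<in> l2 K \<Longrightarrow> S v = coord (app T (Ell2 v))"
  shows "bounded_op K K S"
  unfolding bounded_op_def
proof (intro conjI ballI allI exI)
  fix x y c assume x: "x \<in> l2 K" and y: "y \<in> l2 K"
  have "coord (app T (Ell2 x)) = restr K (coord (app T (Ell2 x)))"
    using assms(1) by (metis app_simps(6) coord_cproj')
  then show "S x \<in> l2 K" using S[OF x] restr_l2[OF coord] by metis
  have l: "(\<lambda>i. c * x i + y i) \<in> l2 K" by (intro l2_add l2_cmul x y)
  have "Ell2 (\<lambda>i. c * x i + y i) = cscale c (Ell2 x) + Ell2 y"
    by (rule ell2_eqI) (simp add: coord_Ell2'[OF x] coord_Ell2'[OF y] coord_Ell2'[OF l])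
  then show "S (\<lambda>i. c * x i + y i) = (\<lambda>i. c * S x i + S y i)"
    by (auto simp: S[OF l] S[OF x] S[OF y])
  show "l2_norm (S x) \<le> norm T * l2_norm x"
    using norm_app[of T "Ell2 x"] unfolding S[OF x] norm_ell2_def coord_Ell2'[OF x] .
qed

lemma adjoint_pair_l2_inner:
  assumes "adjoint_pair S T" "x \<in> l2 K" "y \<in> l2 K"
  shows "l2_inner (coord (app S (Ell2 x))) y = l2_inner x (coord (app T (Ell2 y)))"
  using cinner_from_inner[of S T "Ell2 x" "Ell2 y"] assms
  by (simp add: adjoint_pair_def coord_Ell2')

text \<open>Converse of the passage to \<open>bop\<close>, used for direct sums and for the standard
  module; the given functions have to match only on l^2(K).\<close>

lemma odd_fredholm_from_bop:
  assumes R: "bop_rep (env q) R" and KR: "\<And>X. X \<in> carrier (env q) \<Longrightarrow> cproj K * R X = R X"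
    and F: "F * F = cproj K" "cproj K * F = F" "adjoint_pair F F"
    and c: "\<And>X. X \<in> carrier (env q) \<Longrightarrow> F * R X - R X * F \<in> closure trace_class"
    and \<rho>: "\<And>X v. X \<in> carrier (env q) \<Longrightarrow> v \<in> l2 K \<Longrightarrow> \<rho> X v = coord (app (R X) (Ell2 v))"
    and F': "\<And>v. v \<in> l2 K \<Longrightarrow> F' v = coord (app F (Ell2 v))"
  shows "(K, \<rho>, F') \<in> odd_fredholm_modules (env q)"
proof -
  have bF: "bounded_op K K F'" by (rule bounded_op_from_bop[OF F(2) F'])
  have bR: "bounded_op K K (\<rho> X)" if "X \<in> carrier (env q)" for X
    by (rule bounded_op_from_bop[OF KR[OF that] \<rho>[OF that]])
  have "star_rep (env q) K \<rho>"
    unfolding star_rep_def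
  proof (intro conjI ballI allI)
    fix X Y x y c assume X: "X \<in> carrier (env q)" and x: "x \<in> l2 K"
    show "\<rho> (smult (env q) c X) x = (\<lambda>i. c * \<rho> X x i)"
      using R X by (auto simp: \<rho>[OF X x] \<rho>[OF env_closed_unary(1)[OF X] x] bop_rep_def)
    assume Y: "Y \<in> carrier (env q)"
    show "\<rho> (X \<oplus>\<^bsub>env q\<^esub> Y) x = (\<lambda>i. \<rho> X x i + \<rho> Y x i)"
      using R X Y by (auto simp: \<rho>[OF X x] \<rho>[OF Y x] \<rho>[OF env_closed(1)[OF X Y] x] bop_rep_def)
    show "\<rho> (X \<otimes>\<^bsub>env q\<^esub> Y) x = \<rho> X (\<rho> Y x)"
      using R X Y by (simp add: \<rho>[OF env_closed(2)[OF X Y] x] \<rho>[OF X bounded_op_range[OF bR[OF Y] x]])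
        (simp add: \<rho>[OF Y x] bop_rep_def coord_inverse)
  next
    show "bounded_op K K (\<rho> X)" if "X \<in> carrier (env q)" for X by (rule bR[OF that])
  next
    fix X x y assume X: "X \<in> carrier (env q)" and x: "x \<in> l2 K" and y: "y \<in> l2 K"
    show "l2_inner (\<rho> (star (env q) X) x) y = l2_inner x (\<rho> X y)"
      unfolding \<rho>[OF X y] \<rho>[OF env_closed_unary(2)[OF X] x]
      by (rule adjoint_pair_l2_inner[OF _ x y]) (use R X in \<open>auto simp: bop_rep_def adjoint_pair_def\<close>)
  qed
  moreover have "F' (F' x) = x" if x: "x \<in> l2 K" for x
  proof -
    have "F' (F' x) = coord (app (F * F) (Ell2 x))"
      unfolding F'[OF bounded_op_range[OF bF x]] by (simp add: F'[OF x] coord_inverse)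
    then show ?thesis using x by (simp add: F coord_cproj' coord_Ell2')
  qed
  moreover have "compact_op K (commutator F' (\<rho> X))" if X: "X \<in> carrier (env q)" for X
  proof -
    have K: "cproj K * (F * R X - R X * F) = F * R X - R X * F"
      using F(2) KR[OF X] by (simp add: right_diff_distrib mult.assoc[symmetric])
    have S: "commutator F' (\<rho> X) v = coord (app (F * R X - R X * F) (Ell2 v))" if v: "v \<in> l2 K" for v
      using F'[OF bounded_op_range[OF bR[OF X] v]] \<rho>[OF X bounded_op_range[OF bF v]]
      by (auto simp: commutator_def \<rho>[OF X v] F'[OF v] coord_inverse fun_diff_def)
    show ?thesis by (rule closure_imp_compact_op[OF c[OF X] K bounded_op_from_bop[OF K S] S])
  qed
  ultimately show ?thesis
    using bF by (auto simp: odd_fredholm_modules_def F' intro: adjoint_pair_l2_inner[OF F(3)])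
qed

subsection \<open>Direct sums of modules\<close>

lemma bop_sum_algebra:
  "bop_sum A B * bop_sum A' B' = bop_sum (A * A') (B * B')"
  "bop_sum A B + bop_sum A' B' = bop_sum (A + A') (B + B')"
  "bop_sum A B - bop_sum A' B' = bop_sum (A - A') (B - B')"
  "csop c * bop_sum A B = bop_sum (csop c * A) (csop c * B)"
proof -
  have "csop c * (V * (X * W)) = V * (csop c * (X * W))" for V X W
    using csop_comm[of c V] by (simp flip: mult.assoc)
  then show "csop c * bop_sum A B = bop_sum (csop c * A) (csop c * B)"
    by (simp add: bop_sum_def distrib_left mult.assoc)
qed (simp_all add: bop_sum_def distrib_left distrib_right left_diff_distrib right_diff_distrib mult.assoc VW_assoc)

lemma adjoint_pair_VW: "adjoint_pair V1 W1" "adjoint_pair V2 W2"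
  unfolding V1_def V2_def W1_def W2_def by (rule adjoint_pair_wop; auto elim!: evenE oddE)+

lemma adjoint_pair_bop_sum:
  "adjoint_pair A A' \<Longrightarrow> adjoint_pair B B' \<Longrightarrow> adjoint_pair (bop_sum A B) (bop_sum A' B')"
  unfolding bop_sum_def mult.assoc
  using adjoint_pair_algebra(2)[OF adjoint_pair_VW(1) adjoint_pair_algebra(2)[OF _ adjoint_pair_sym[OF adjoint_pair_VW(1)]], of A A']
    adjoint_pair_algebra(2)[OF adjoint_pair_VW(2) adjoint_pair_algebra(2)[OF _ adjoint_pair_sym[OF adjoint_pair_VW(2)]], of B B']
  by (intro adjoint_pair_algebra(1)) (simp_all add: mult.assoc)

lemma adjoint_pair_bext:
  assumes "bounded_op I I S" and "\<And>x y. x \<in> l2 I \<Longrightarrow> y \<in> l2 I \<Longrightarrow> l2_inner (S x) y = l2_inner x (S y)"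
  shows "adjoint_pair (bext I S) (bext I S)"
  unfolding adjoint_pair_def inner_ell2_def coord_bext[OF assms(1)]
proof (intro allI arg_cong[of _ _ Re])
  fix x y
  have r: "restr I (coord z) \<in> l2 I" for z by (rule restr_l2[OF coord])
  show "l2_inner (S (restr I (coord x))) (coord y) = l2_inner (coord x) (S (restr I (coord y)))"
    using assms(2)[OF r r, of x y] l2_inner_restr[OF bounded_op_range[OF assms(1) r], of "coord x" y]
      l2_inner_restr'[OF bounded_op_range[OF assms(1) r], of x "coord y"] by simp
qed

lemma op_sum_coord:
  assumes S: "bounded_op I I S" and T: "bounded_op J J T" and v: "v \<in> l2 (sum_encode ` Sum_Type.Plus I J)"
  shows "op_sum S T v = coord (app (bop_sum (bext I S) (bext J T)) (Ell2 v))"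
proof -
  let ?K = "sum_encode ` Sum_Type.Plus I J"
  have W: "coord (app W1 x) = (\<lambda>k. coord x (2 * k))" "coord (app W2 x) = (\<lambda>k. coord x (2 * k + 1))" for x
    by (auto simp: fun_eq_iff)
  have "coord (app (bop_sum (bext I S) (bext J T)) x) = op_sum S T (restr ?K (coord x))" for x
    unfolding op_sum_def restr_sum_encode
    by (auto simp: fun_eq_iff coord_bop_sum coord_bext[OF S] coord_bext[OF T] W sum_decode_def)
  then show ?thesis using v by (simp add: coord_Ell2')
qed

text \<open>The relators of K^1 mention \<open>ktriple_sum M N\<close> as a generator, so they lie
  in the free group only if it is a module again.\<close>

lemma ktriple_sum_module:
  assumes M: "M \<in> odd_fredholm_modules (env q)" and N: "N \<in> odd_fredholm_modules (env q)"
  shows "ktriple_sum M N \<in> odd_fredholm_modules (env q)"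
proof -
  obtain I \<rho> F where MI: "M = (I, \<rho>, F)" by (cases M) auto
  obtain J \<sigma> G where NJ: "N = (J, \<sigma>, G)" by (cases N) auto
  have F: "bounded_op I I F" "\<And>x y. x \<in> l2 I \<Longrightarrow> y \<in> l2 I \<Longrightarrow> l2_inner (F x) y = l2_inner x (F y)"
    and \<rho>: "star_rep (env q) I \<rho>" and cF: "\<And>b. b \<in> carrier (env q) \<Longrightarrow> compact_op I (commutator F (\<rho> b))"
    using M unfolding MI by (auto simp: odd_fredholm_modules_def)
  have G: "bounded_op J J G" "\<And>x y. x \<in> l2 J \<Longrightarrow> y \<in> l2 J \<Longrightarrow> l2_inner (G x) y = l2_inner x (G y)"
    and \<sigma>: "star_rep (env q) J \<sigma>" and cG: "\<And>b. b \<in> carrier (env q) \<Longrightarrow> compact_op J (commutator G (\<sigma> b))"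
    using N unfolding NJ by (auto simp: odd_fredholm_modules_def)
  have b\<rho>: "bounded_op I I (\<rho> b)" and b\<sigma>: "bounded_op J J (\<sigma> b)" if "b \<in> carrier (env q)" for b
    using \<rho> \<sigma> that by (auto simp: star_rep_def)
  interpret A: fredholm_data q "cproj I" "bext I F" "module_rep q I \<rho>"
    by (rule fredholm_data_module[OF M[unfolded MI]])
  interpret B: fredholm_data q "cproj J" "bext J G" "module_rep q J \<sigma>"
    by (rule fredholm_data_module[OF N[unfolded NJ]])
  let ?R = "\<lambda>b. bop_sum (bext I (\<rho> b)) (bext J (\<sigma> b))" and ?F = "bop_sum (bext I F) (bext J G)"
  have r: "restr K (coord x) \<in> l2 K" for K x by (rule restr_l2[OF coord])
  have l: "cproj K * bext K S = bext K S" if "bounded_op K K S" for K S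
    by (intro bop_eqI) (simp add: coord_inject[symmetric] coord_bext[OF that] coord_cproj' bounded_op_range[OF that r])
  show ?thesis
    unfolding MI NJ ktriple_sum_def prod.case
  proof (rule odd_fredholm_from_bop[where R="?R" and F="?F"])
    show "bop_rep (env q) ?R"
      using star_rep_env[OF \<rho>] star_rep_env[OF \<sigma>]
      by (auto simp: bop_rep_def bop_sum_algebra adjoint_pair_bop_sum simp flip: adjoint_pair_def)
    show "?F * ?F = cproj (sum_encode ` Sum_Type.Plus I J)" "cproj (sum_encode ` Sum_Type.Plus I J) * ?F = ?F"
      by (simp_all add: cproj_sum bop_sum_algebra A.FF B.FF A.QF B.QF)
    show "adjoint_pair ?F ?F" by (intro adjoint_pair_bop_sum adjoint_pair_bext F G)
    show "op_sum F G v = coord (app ?F (Ell2 v))" if "v \<in> l2 (sum_encode ` Sum_Type.Plus I J)" for v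
      by (rule op_sum_coord[OF F(1) G(1) that])
    fix b assume b: "b \<in> carrier (env q)"
    show "cproj (sum_encode ` Sum_Type.Plus I J) * ?R b = ?R b"
      by (simp add: cproj_sum bop_sum_algebra l b\<rho>[OF b] b\<sigma>[OF b])
    show "op_sum (\<rho> b) (\<sigma> b) v = coord (app (?R b) (Ell2 v))" if "v \<in> l2 (sum_encode ` Sum_Type.Plus I J)" for v
      by (rule op_sum_coord[OF b\<rho>[OF b] b\<sigma>[OF b] that])
    have "?F * ?R b - ?R b * ?F = bop_sum (bext I (commutator F (\<rho> b))) (bext J (commutator G (\<sigma> b)))"
      by (simp add: bop_sum_algebra bext_commutator[OF F(1) b\<rho>[OF b]] bext_commutator[OF G(1) b\<sigma>[OF b]])
    also have "\<dots> \<in> closure trace_class"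
      unfolding bop_sum_def
      by (intro TC.closure_add TC.closure_left TC.closure_right compact_bext cF[OF b] cG[OF b])
    finally show "?F * ?R b - ?R b * ?F \<in> closure trace_class" .
  qed
qed

section \<open>The standard module on \<open>l\<^sup>2(\<nat> \<times> \<int>)\<close>\<close>

text \<open>Coordinates (k, j) in N x Z, coded by natural numbers since these index all
  vectors.\<close>

definition kk :: "nat \<Rightarrow> nat" where "kk n = fst (prod_decode n)"
definition jj :: "nat \<Rightarrow> int" where "jj n = int_decode (snd (prod_decode n))"
definition en :: "nat \<Rightarrow> int \<Rightarrow> nat" where "en k j = prod_encode (k, int_encode j)"

lemma en_simps [simp]: "kk (en k j) = k" "jj (en k j) = j" "en (kk n) (jj n) = n"
  by (simp_all add: kk_def jj_def en_def)

lemma bop_eq_en: "(\<And>x k j. coord (app S x) (en k j) = coord (app T x) (en k j)) \<Longrightarrow> S = T"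
  by (intro bop_eqI ell2_eqI) (metis en_simps(3))

text \<open>Woronowicz's representation: on the basis, \<alpha> lowers k with factor sqrt(1 -
  q^(2k)) and \<beta> raises j with factor q^k. Shifts look reversed because \<open>wop\<close>
  prescribes image coordinates. At k = 0 the weight of \<open>Alpha_star\<close> vanishes, so
  truncated subtraction does no harm.\<close>

fun std_gen :: "real \<Rightarrow> gen \<Rightarrow> bop" where
  "std_gen q Alpha = wop (\<lambda>n. of_real (sqrt (1 - q ^ (2 * Suc (kk n))))) (\<lambda>n. en (Suc (kk n)) (jj n))"
| "std_gen q Alpha_star = wop (\<lambda>n. of_real (sqrt (1 - q ^ (2 * kk n)))) (\<lambda>n. en (kk n - 1) (jj n))"
| "std_gen q Beta = wop (\<lambda>n. of_real (q ^ kk n)) (\<lambda>n. en (kk n) (jj n - 1))"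
| "std_gen q Beta_star = wop (\<lambda>n. of_real (q ^ kk n)) (\<lambda>n. en (kk n) (jj n + 1))"

text \<open>j = 0 counts as positive, which places the jump between -1 and 0.\<close>

definition std_F :: bop where
  "std_F = wop (\<lambda>n. if jj n \<ge> 0 then 1 else - 1) id"

lemma coord_std_F: "coord (app std_F x) n = (if jj n \<ge> 0 then 1 else - 1) * coord x n"
  unfolding std_F_def by (subst coord_wop[where C=1]) auto

section \<open>The representation of the free algebra and its descent to the quotient\<close>

definition std_free :: "real \<Rightarrow> free_alg \<Rightarrow> bop" where
  "std_free q = lin_ext (\<lambda>w c. csop c * prod_list (map (std_gen q) w))"

definition std_rep :: "real \<Rightarrow> suq2 \<Rightarrow> bop" where
  "std_rep q X = std_free q (SOME x. x \<in> X)"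

lemma std_free_add: "std_free q (x + y) = std_free q x + std_free q y"
  unfolding std_free_def by (rule lin_ext_add) (auto simp: csop_simps distrib_right)

lemma std_free_zero [simp]: "std_free q 0 = 0"
  by (simp add: std_free_def)

lemma std_free_diff: "std_free q (x - y) = std_free q x - std_free q y"
  using std_free_add[of q "x - y" y] by simp

lemma std_free_single: "std_free q (Poly_Mapping.single w c) = csop c * prod_list (map (std_gen q) w)"
  unfolding std_free_def by (rule lin_ext_single) (auto simp: csop_simps)

lemma std_free_one: "std_free q 1 = 1"
  using std_free_single[of q "[]" 1] by (simp add: word_Nil csop_simps)

lemma std_free_mult: "std_free q (x * y) = std_free q x * std_free q y"
proof -
  let ?P = "\<lambda>w. prod_list (map (std_gen q) w)"
  have ss: "csop (a * b) * (?P u * ?P v) = csop a * ?P u * (csop b * ?P v)" for a b u v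
  proof -
    have "csop a * ?P u * (csop b * ?P v) = csop a * (?P u * csop b) * ?P v" by (simp only: mult.assoc)
    also have "?P u * csop b = csop b * ?P u" by (rule csop_comm[symmetric])
    finally show ?thesis by (simp only: csop_simps mult.assoc)
  qed
  have single: "std_free q (x * Poly_Mapping.single w c) = std_free q x * std_free q (Poly_Mapping.single w c)" for w c
    by (rule additive_ext[of "\<lambda>x. std_free q (x * Poly_Mapping.single w c)"])
       (simp_all add: std_free_add distrib_left distrib_right mult_single std_free_single ss)
  show ?thesis
    by (rule additive_ext[of "\<lambda>y. std_free q (x * y)"])
       (simp_all add: std_free_add distrib_left distrib_right single)
qed

context
  fixes q :: real
  assumes q: "0 < q" "q < 1"
begin

lemma q_pow: "0 < q ^ n" "q ^ n \<le> 1"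
  using q by (simp_all add: power_le_one)

lemma weight_bound: "cmod (of_real (sqrt (1 - q ^ n))) \<le> 1" "cmod (of_real (q ^ n)) \<le> 1"
  unfolding norm_of_real using q_pow[of n] by (simp_all add: real_sqrt_le_1_iff)

lemma adjoint_std_gen: "adjoint_pair (std_gen q (gen_star g)) (std_gen q g)"
proof -
  have a: "adjoint_pair (std_gen q Alpha_star) (std_gen q Alpha)"
    unfolding std_gen.simps
  proof (rule adjoint_pair_wop[OF weight_bound(1) weight_bound(1)])
    fix n assume "complex_of_real (sqrt (1 - q ^ (2 * kk n))) \<noteq> 0"
    \<comment> \<open>k = 0 would make the weight zero; beyond it the predecessor is a genuine
      inverse of the successor.\<close>
    then have "kk n \<noteq> 0" by (intro notI) simp
    then show "en (Suc (kk (en (kk n - 1) (jj n)))) (jj (en (kk n - 1) (jj n))) = n \<and>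
      complex_of_real (sqrt (1 - q ^ (2 * Suc (kk (en (kk n - 1) (jj n)))))) = cnj (complex_of_real (sqrt (1 - q ^ (2 * kk n))))"
      by simp
  qed simp
  have b: "adjoint_pair (std_gen q Beta_star) (std_gen q Beta)"
    unfolding std_gen.simps by (rule adjoint_pair_wop[OF weight_bound(2) weight_bound(2)]) simp_all
  show ?thesis using a b adjoint_pair_sym[OF a] adjoint_pair_sym[OF b] by (cases g) simp_all
qed

lemma coord_std_gen:
  "coord (app (std_gen q Alpha) x) (en k j) = of_real (sqrt (1 - q ^ (2 * Suc k))) * coord x (en (Suc k) j)"
  "coord (app (std_gen q Alpha_star) x) (en k j) = of_real (sqrt (1 - q ^ (2 * k))) * coord x (en (k - 1) j)"
  "coord (app (std_gen q Beta) x) (en k j) = of_real (q ^ k) * coord x (en k (j - 1))"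
  "coord (app (std_gen q Beta_star) x) (en k j) = of_real (q ^ k) * coord x (en k (j + 1))"
proof -
  have "inj_on (\<lambda>n. en (kk n - 1) (jj n)) {n. complex_of_real (sqrt (1 - q ^ (2 * kk n))) \<noteq> 0}"
  proof (rule inj_on_inverseI[where g="\<lambda>n. en (Suc (kk n)) (jj n)"])
    fix n assume "n \<in> {n. complex_of_real (sqrt (1 - q ^ (2 * kk n))) \<noteq> 0}"
    then have "kk n \<noteq> 0" by (intro notI) simp
    then show "en (Suc (kk (en (kk n - 1) (jj n)))) (jj (en (kk n - 1) (jj n))) = n" by simp
  qed
  then show "coord (app (std_gen q Alpha_star) x) (en k j) = of_real (sqrt (1 - q ^ (2 * k))) * coord x (en (k - 1) j)"
    unfolding std_gen.simps by (subst coord_wop[OF weight_bound(1)]) simp_all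
  have i: "inj_on (\<lambda>n. en (Suc (kk n)) (jj n)) S" "inj_on (\<lambda>n. en (kk n) (jj n - 1)) S" "inj_on (\<lambda>n. en (kk n) (jj n + 1)) S" for S
    by (rule inj_on_inverseI[where g="\<lambda>n. en (kk n - 1) (jj n)"], simp,
        rule inj_on_inverseI[where g="\<lambda>n. en (kk n) (jj n + 1)"], simp,
        rule inj_on_inverseI[where g="\<lambda>n. en (kk n) (jj n - 1)"], simp)
  show "coord (app (std_gen q Alpha) x) (en k j) = of_real (sqrt (1 - q ^ (2 * Suc k))) * coord x (en (Suc k) j)"
    unfolding std_gen.simps by (subst coord_wop[OF weight_bound(1) i(1)]) simp
  show "coord (app (std_gen q Beta) x) (en k j) = of_real (q ^ k) * coord x (en k (j - 1))"
    unfolding std_gen.simps by (subst coord_wop[OF weight_bound(2) i(2)]) simp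
  show "coord (app (std_gen q Beta_star) x) (en k j) = of_real (q ^ k) * coord x (en k (j + 1))"
    unfolding std_gen.simps by (subst coord_wop[OF weight_bound(2) i(3)]) simp
qed

lemma sqrt_mult_self: "complex_of_real (sqrt (1 - q ^ n)) * (complex_of_real (sqrt (1 - q ^ n)) * z) = (1 - of_real (q ^ n)) * z"
proof -
  have "sqrt (1 - q ^ n) * sqrt (1 - q ^ n) = 1 - q ^ n" using q_pow[of n] by simp
  then have "complex_of_real (sqrt (1 - q ^ n)) * complex_of_real (sqrt (1 - q ^ n)) = 1 - of_real (q ^ n)"
    by (simp flip: of_real_mult)
  then show ?thesis by (simp flip: mult.assoc)
qed

lemma std_free_relators: assumes "x \<in> suq2_relators q" shows "std_free q x = 0"
proof -
  let ?g = "std_gen q"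
  have "?g Alpha_star * ?g Alpha + ?g Beta_star * ?g Beta = 1"
  proof (rule bop_eq_en)
    fix x k j
    show "coord (app (?g Alpha_star * ?g Alpha + ?g Beta_star * ?g Beta) x) (en k j) = coord (app 1 x) (en k j)"
      \<comment> \<open>At k = 0 the first summand has weight zero and its index is truncated, so
        this case is separate.\<close>
      by (cases k) (simp_all add: coord_std_gen sqrt_mult_self del: std_gen.simps power_Suc, 
        simp_all add: algebra_simps power_mult power2_eq_square power_mult_distrib)
  qed
  moreover have "?g Alpha * ?g Alpha_star + csop (of_real (q\<^sup>2)) * (?g Beta * ?g Beta_star) = 1"
    by (rule bop_eq_en) (simp add: coord_std_gen sqrt_mult_self del: std_gen.simps power_Suc mult_Suc_right,
        simp add: algebra_simps power_mult power2_eq_square power_mult_distrib)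
  moreover have "?g Alpha * ?g Beta = csop (of_real q) * (?g Beta * ?g Alpha)"
    by (rule bop_eq_en) (simp add: coord_std_gen del: std_gen.simps)
  moreover have "?g Alpha * ?g Beta_star = csop (of_real q) * (?g Beta_star * ?g Alpha)"
    by (rule bop_eq_en) (simp add: coord_std_gen del: std_gen.simps)
  moreover have "?g Beta_star * ?g Beta = ?g Beta * ?g Beta_star"
    by (rule bop_eq_en) (simp add: coord_std_gen del: std_gen.simps)
  ultimately show ?thesis
    using assms unfolding suq2_relators_def
    by (auto simp: std_free_add std_free_diff std_free_one std_free_single csop_simps(3) simp del: std_gen.simps)
qed

lemma adjoint_std_free: "adjoint_pair (std_free q (free_star x)) (std_free q x)"
proof (induction x rule: poly_mapping_induct)
  case zero
  show ?case by (simp add: adjoint_pair_algebra)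
next
  case (single w c)
  have w: "adjoint_pair (prod_list (map (std_gen q) (rev (map gen_star w)))) (prod_list (map (std_gen q) w))"
    by (induction w) (auto intro!: adjoint_pair_algebra adjoint_std_gen simp del: std_gen.simps)
  have "adjoint_pair (prod_list (map (std_gen q) (rev (map gen_star w))) * csop (cnj c)) (csop c * prod_list (map (std_gen q) w))"
    by (rule adjoint_pair_algebra(2)[OF w adjoint_pair_csop])
  then show ?case unfolding free_star_single std_free_single by (simp only: csop_comm[of "cnj c"])
next
  case (add x y)
  then show ?case by (simp add: free_star_add std_free_add adjoint_pair_algebra)
qed

text \<open>The adjoints of relators act as zero too, because their norm is bounded by that of the
  relators.\<close>

lemma std_free_ideal: "x \<in> suq2_ideal q \<Longrightarrow> std_free q x = 0"
proof -
  have "std_free q (free_star x) = 0" if "std_free q x = 0" for x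
  proof (rule bop_eqI)
    fix v
    have "norm (std_free q (free_star x)) \<le> norm (std_free q x)"
      using adjoint_std_free[of x] unfolding adjoint_pair_def by (intro norm_adjoint_le) blast
    then show "app (std_free q (free_star x)) v = app 0 v" using that by simp
  qed
  then have "relators q \<subseteq> {x. std_free q x = 0}" using std_free_relators by auto
  then have "suq2_ideal q \<subseteq> {x. std_free q x = 0}"
    by (intro suq2_ideal_minimal) (auto simp: std_free_add std_free_mult)
  then show "x \<in> suq2_ideal q \<Longrightarrow> std_free q x = 0" by auto
qed

lemma std_rep_class: "std_rep q (suq2_class q x) = std_free q x"
proof -
  have "x \<in> suq2_class q x" by (simp add: mem_class ideal_zero)
  then have "(SOME y. y \<in> suq2_class q x) \<in> suq2_class q x" by (rule someI)
  then have "std_free q ((SOME y. y \<in> suq2_class q x) - x) = 0" by (intro std_free_ideal) (simp add: mem_class)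
  then show ?thesis by (simp add: std_rep_def std_free_diff)
qed

lemma bop_rep_std: "bop_rep (SUq2 q) (std_rep q)"
  unfolding bop_rep_def
  using adjoint_std_free
  by (auto simp: carrier_SUq2 std_rep_class std_free_add std_free_mult std_free_single adjoint_pair_def)

text \<open>The vector state at (0, 0). This basis vector is killed by \<alpha>, while \<beta> and
  its adjoint move it with weight q^0 = 1; this yields the values demanded by
  \<open>invariant_antisymmetric_zero\<close>.\<close>

definition vacuum :: "suq2 \<Rightarrow> complex" where
  "vacuum X = matcoef (std_rep q X) (en 0 0) (en 0 0)"

lemma en_inj [simp]: "en k j = en k' j' \<longleftrightarrow> k = k' \<and> j = j'"
  by (metis en_simps(1,2))

lemma vacuum:
  "linear_functional (SUq2 q) vacuum" "vacuum (suq2_class q 1) = 1"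
  "vacuum (suq2_class q (word [Beta, Beta_star])) = 1"
  "vacuum (suq2_class q (word [Beta_star, Alpha])) = 0"
  "vacuum (suq2_class q (word [Alpha_star, Beta])) = 0"
  unfolding vacuum_def
  by (auto intro!: linear_functionalI simp: std_rep_class std_free_add std_free_mult std_free_single std_free_one
    matcoef_def csop_simps(3) coord_std_gen simp del: std_gen.simps)

subsection \<open>Commutators with the sign operator\<close>

lemma hs_wop:
  assumes C: "\<And>n. cmod (w n) \<le> C" and g: "inj_on g {n. w n \<noteq> 0}" and s: "(\<lambda>n. (cmod (w n))\<^sup>2) summable_on UNIV"
  shows "hs (wop w g)"
proof -
  have m: "(cmod (matcoef (wop w g) i j))\<^sup>2 = (if j = g i then (cmod (w i))\<^sup>2 else 0)" for i j
    by (simp add: matcoef_def coord_wop[OF C g])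
  have h: "((\<lambda>j. (cmod (matcoef (wop w g) i j))\<^sup>2) has_sum (cmod (w i))\<^sup>2) UNIV" for i
    unfolding m by (rule has_sum_finite_neutralI[where B="{g i}"]) auto
  show ?thesis unfolding hs_rows using infsumI[OF h] has_sum_imp_summable[OF h] s by simp
qed

text \<open>Fixing j leaves a geometric series in q^2 over k.\<close>

lemma summable_level: "(\<lambda>n. if jj n = j then c * q ^ (2 * kk n) else 0) summable_on UNIV"
proof -
  have "summable (\<lambda>k. (q\<^sup>2) ^ k)" using q by (intro summable_geometric) (simp add: power_less_one_iff abs_square_less_1)
  then have "(\<lambda>k. (q\<^sup>2) ^ k) summable_on UNIV"
    by (rule summable_nonneg_imp_summable_on) (use q in auto)
  then have "(\<lambda>k. c * q ^ (2 * k)) summable_on UNIV"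
    by (intro summable_on_cmult_right) (simp add: power_mult)
  moreover have "bij_betw (\<lambda>k. en k j) UNIV {n. jj n = j}"
    by (rule bij_betwI[where g=kk]) auto
  ultimately have "(\<lambda>n. c * q ^ (2 * kk n)) summable_on {n. jj n = j}"
    using summable_on_reindex_bij_betw[of "\<lambda>k. en k j" UNIV "{n. jj n = j}" "\<lambda>n. c * q ^ (2 * kk n)"] by simp
  then show ?thesis
    by (rule summable_on_cong_neutral[THEN iffD1, rotated -1]) auto
qed

text \<open>The sign is constant except across the jump between j = -1 and j = 0. Only one level
  survives, with the height 2 of the jump times the weight q^k.\<close>

lemma coord_com_gen:
  "coord (app (std_F * std_gen q Beta - std_gen q Beta * std_F) x) (en k j)
    = (if j = 0 then 2 * of_real (q ^ k) * coord x (en k (- 1)) else 0)"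
  "coord (app (std_F * std_gen q Beta_star - std_gen q Beta_star * std_F) x) (en k j)
    = (if j = - 1 then - 2 * of_real (q ^ k) * coord x (en k 0) else 0)"
  by (auto simp: coord_std_gen coord_std_F simp del: std_gen.simps)

lemma hs_com_gen: "hs (std_F * std_gen q g - std_gen q g * std_F)"
proof (cases g)
  case Beta
  have C: "cmod (if jj n = 0 then 2 * of_real (q ^ kk n) else 0) \<le> 2" for n
    using weight_bound(2)[of "kk n"] by (simp add: norm_mult)
  have i: "inj_on (\<lambda>n. en (kk n) (- 1)) {n. (if jj n = 0 then 2 * complex_of_real (q ^ kk n) else 0) \<noteq> 0}"
  proof (rule inj_on_inverseI[where g="\<lambda>n. en (kk n) 0"])
    fix n assume "n \<in> {n. (if jj n = 0 then 2 * complex_of_real (q ^ kk n) else 0) \<noteq> 0}"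
    then have "jj n = 0" by (auto split: if_splits)
    then show "en (kk (en (kk n) (- 1))) 0 = n" using en_simps(3)[of n] by simp
  qed
  have "std_F * std_gen q g - std_gen q g * std_F = wop (\<lambda>n. if jj n = 0 then 2 * of_real (q ^ kk n) else 0) (\<lambda>n. en (kk n) (- 1))"
    unfolding Beta by (rule bop_eq_en, subst coord_com_gen, subst coord_wop[OF C i]) simp
  moreover have "(\<lambda>n. (cmod (if jj n = 0 then 2 * of_real (q ^ kk n) else 0))\<^sup>2) = (\<lambda>n. if jj n = 0 then 4 * q ^ (2 * kk n) else 0)"
    using q by (auto simp: norm_mult norm_power power_mult_distrib power_even_eq fun_eq_iff)
  ultimately show ?thesis using hs_wop[OF C i] summable_level[of 0 4] by simp
next
  case Beta_star
  have C: "cmod (if jj n = - 1 then - 2 * of_real (q ^ kk n) else 0) \<le> 2" for n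
    using weight_bound(2)[of "kk n"] by (simp add: norm_mult)
  have i: "inj_on (\<lambda>n. en (kk n) 0) {n. (if jj n = - 1 then - 2 * complex_of_real (q ^ kk n) else 0) \<noteq> 0}"
  proof (rule inj_on_inverseI[where g="\<lambda>n. en (kk n) (- 1)"])
    fix n assume "n \<in> {n. (if jj n = - 1 then - 2 * complex_of_real (q ^ kk n) else 0) \<noteq> 0}"
    then have "jj n = - 1" by (auto split: if_splits)
    then show "en (kk (en (kk n) 0)) (- 1) = n" using en_simps(3)[of n] by simp
  qed
  have "std_F * std_gen q g - std_gen q g * std_F = wop (\<lambda>n. if jj n = - 1 then - 2 * of_real (q ^ kk n) else 0) (\<lambda>n. en (kk n) 0)"
    unfolding Beta_star by (rule bop_eq_en, subst coord_com_gen, subst coord_wop[OF C i]) simp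
  moreover have "(\<lambda>n. (cmod (if jj n = - 1 then - 2 * of_real (q ^ kk n) else 0))\<^sup>2) = (\<lambda>n. if jj n = - 1 then 4 * q ^ (2 * kk n) else 0)"
    using q by (auto simp: norm_mult norm_power power_mult_distrib power_even_eq fun_eq_iff)
  ultimately show ?thesis using hs_wop[OF C i] summable_level[of "- 1" 4] by simp
next
  case Alpha
  have "std_F * std_gen q g - std_gen q g * std_F = 0"
    unfolding Alpha by (rule bop_eq_en) (simp add: coord_std_gen coord_std_F del: std_gen.simps)
  then show ?thesis by (simp add: hs_zero)
next
  case Alpha_star
  have "std_F * std_gen q g - std_gen q g * std_F = 0"
    unfolding Alpha_star by (rule bop_eq_en) (simp add: coord_std_gen coord_std_F del: std_gen.simps)
  then show ?thesis by (simp add: hs_zero)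
qed

text \<open>The commutator is a derivation, so words reduce to generators by the ideal property of
  Hilbert-Schmidt operators.\<close>

lemma hs_com_std: "hs (std_F * std_free q x - std_free q x * std_F)"
proof (induction x rule: poly_mapping_induct)
  case zero
  show ?case by (simp add: hs_zero)
next
  case (single w c)
  have w: "hs (std_F * prod_list (map (std_gen q) w) - prod_list (map (std_gen q) w) * std_F)"
  proof (induction w)
    case (Cons g w)
    let ?P = "prod_list (map (std_gen q) w)" and ?g = "std_gen q g"
    have "std_F * (?g * ?P) - ?g * ?P * std_F = (std_F * ?g - ?g * std_F) * ?P + ?g * (std_F * ?P - ?P * std_F)"
      by (simp add: algebra_simps del: std_gen.simps)
    then show ?case
      using hs_add[OF hs_mult_right[OF hs_com_gen[of g], of ?P] hs_mult_left[OF Cons, of ?g]] by (simp del: std_gen.simps)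
  qed (simp add: hs_zero)
  have "std_F * (csop c * z) - csop c * z * std_F = csop c * (std_F * z - z * std_F)" for z
  proof -
    have "std_F * (csop c * z) = csop c * (std_F * z)" using csop_comm[of c std_F] by (simp flip: mult.assoc)
    then show ?thesis by (simp add: right_diff_distrib mult.assoc)
  qed
  then show ?case using hs_mult_left[OF w] by (simp add: std_free_single del: std_gen.simps)
next
  case (add x y)
  have "std_F * (X + Y) - (X + Y) * std_F = (std_F * X - X * std_F) + (std_F * Y - Y * std_F)" for X Y :: bop
    by (simp add: algebra_simps)
  then show ?case using hs_add[OF add] by (simp add: std_free_add)
qed

lemma hs_closure: assumes "hs T" shows "T \<in> closure trace_class"
proof -
  have "cproj {..<n} * (cproj {..<n} * T) \<in> trace_class" for n
    by (intro trace_class.prod hs_mult_right hs_cproj assms) auto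
  then have "cproj {..<n} * T \<in> trace_class" for n by (simp add: mult.assoc[symmetric] cproj_idem)
  then show ?thesis
    unfolding closure_sequential using hs_cproj_tendsto[OF assms] by (intro exI[of _ "\<lambda>n. cproj {..<n} * T"]) simp
qed

lemma std_F: "std_F * std_F = 1" "adjoint_pair std_F std_F"
proof -
  show "std_F * std_F = 1" by (intro bop_eqI ell2_eqI) (simp add: coord_std_F)
  show "adjoint_pair std_F std_F" unfolding std_F_def by (rule adjoint_pair_wop) auto
qed

lemma cproj_UNIV: "cproj UNIV = 1"
  by (intro bop_eqI ell2_eqI) simp

text \<open>The operator is diagonal, with entries -4 q^(2k) at j = 0 and zero elsewhere. The term
  at k = 0 already has absolute value 4; the full series is 4 / (1 - q^2), corresponding to index
  -1.\<close>

lemma std_trace_nonzero: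
  "trace (std_F * (std_gen q Beta * std_F - std_F * std_gen q Beta) * (std_gen q Beta_star * std_F - std_F * std_gen q Beta_star)) \<noteq> 0"
proof -
  let ?T = "std_F * (std_gen q Beta * std_F - std_F * std_gen q Beta) * (std_gen q Beta_star * std_F - std_F * std_gen q Beta_star)"
  define r where "r n = (if jj n = 0 then 4 * q ^ (2 * kk n) else 0)" for n
  have T: "?T = std_F * ((std_F * std_gen q Beta - std_gen q Beta * std_F) * (std_F * std_gen q Beta_star - std_gen q Beta_star * std_F))"
    by (simp add: algebra_simps del: std_gen.simps)
  have "coord (app ?T x) (en k j) = - of_real (if j = 0 then 4 * q ^ (2 * k) else 0) * coord x (en k j)" for x k j
    unfolding T app_simps(6)[of std_F] coord_std_F app_simps(6)[of "std_F * std_gen q Beta - std_gen q Beta * std_F"] coord_com_gen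
    by (simp add: power_even_eq power2_eq_square)
  then have "matcoef ?T n n = - of_real (r n)" for n
    unfolding matcoef_def r_def by (metis coord_ket en_simps mult.right_neutral)
  moreover have "((\<lambda>n. complex_of_real (r n)) has_sum of_real (infsum r UNIV)) UNIV"
    unfolding r_def by (rule has_sum_of_real[OF has_sum_infsum[OF summable_level]])
  ultimately have "trace ?T = - of_real (infsum r UNIV)"
    unfolding trace_def by (simp add: infsum_uminus infsumI)
  moreover have "infsum r UNIV \<ge> 4"
  proof -
    have "(\<Sum>n\<in>{en 0 0}. r n) \<le> infsum r UNIV"
      using summable_level[of 0 4] q by (intro finite_sum_le_infsum) (auto simp: r_def)
    then show ?thesis by (simp add: r_def)
  qed
  ultimately show ?thesis by auto
qed

lemma std_module:
  obtains M where "M \<in> odd_fredholm_modules (env q)" "module_index q M \<noteq> 0"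
proof -
  obtain R' where R': "bop_rep (env q) R'"
    "\<And>a. a \<in> carrier (SUq2 q) \<Longrightarrow> R' (to_enveloping (SUq2 q) a) = std_rep q a"
    "\<And>X. X \<in> carrier (env q) \<Longrightarrow> \<exists>s. (\<forall>n. s n \<in> carrier (SUq2 q)) \<and> (\<lambda>n. std_rep q (s n)) \<longlonglongrightarrow> R' X"
    using bop_rep_extend[OF bop_rep_std] by blast
  \<comment> \<open>Commutators are Hilbert-Schmidt on the image of the algebra, and limits of these
    stay in the closure of the trace class; so they are compact on the completion.\<close>
  have c: "std_F * R' X - R' X * std_F \<in> closure trace_class" if X: "X \<in> carrier (env q)" for X
  proof -
    obtain s where s: "\<And>n. s n \<in> carrier (SUq2 q)" "(\<lambda>n. std_rep q (s n)) \<longlonglongrightarrow> R' X" using R'(3)[OF X] by blast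
    have cl: "std_F * std_rep q (s n) - std_rep q (s n) * std_F \<in> closure trace_class" for n
      using s(1)[of n] hs_closure[OF hs_com_std] by (auto simp: carrier_SUq2 std_rep_class)
    have "(\<lambda>n. std_F * std_rep q (s n) - std_rep q (s n) * std_F) \<longlonglongrightarrow> std_F * R' X - R' X * std_F"
      by (intro tendsto_intros s(2))
    then show ?thesis by (rule closed_sequentially[OF closed_closure cl])
  qed
  let ?M = "(UNIV, \<lambda>X. to_oper (R' X), to_oper std_F)"
  have M: "?M \<in> odd_fredholm_modules (env q)"
    by (rule odd_fredholm_from_bop[OF R'(1) _ _ _ _ c]) (simp_all add: cproj_UNIV std_F to_oper_def)
  interpret fredholm_data q 1 std_F "\<lambda>a. R' (to_enveloping (SUq2 q) a)"
    using fredholm_data_module[OF M] by (simp add: cproj_UNIV)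
  have rep: "R' (to_enveloping (SUq2 q) (suq2_class q x)) = std_free q x" for x
    by (simp add: R'(2) std_rep_class)
  have "hs (com (R' (to_enveloping (SUq2 q) a)))" if a: "a \<in> carrier (SUq2 q)" for a
  proof -
    obtain x where "a = suq2_class q x" using a by (auto simp: carrier_SUq2)
    then have "com (R' (to_enveloping (SUq2 q) a)) = (-1) * (std_F * std_free q x - std_free q x * std_F)"
      by (simp add: com_def rep)
    then show ?thesis using hs_mult_left[OF hs_com_std, of "-1"] by simp
  qed
  from index_hs[OF this] have "module_index q ?M = of_real ((1 - q * q) / 4) *
      trace (std_F * com (std_free q (word [Beta])) * com (std_free q (word [Beta_star])))"
    by (simp add: module_index_def cproj_UNIV rep)
  moreover have "(1 - q * q) / 4 \<noteq> 0" using q mult_strict_mono[of q 1 q 1] by simp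
  then have "complex_of_real ((1 - q * q) / 4) \<noteq> 0" unfolding of_real_eq_0_iff .
  ultimately have "module_index q ?M \<noteq> 0"
    using std_trace_nonzero by (simp del: of_real_divide of_real_diff of_real_mult add: com_def std_free_single csop_simps(3) del: std_gen.simps)
  with M show ?thesis by (rule that)
qed

end

section \<open>The Chern character and the index\<close>

lemma hilbert_schmidt_bext:
  assumes "hilbert_schmidt_op I T" shows "hs (bext I T)"
proof -
  have T: "bounded_op I I T" using assms by (simp add: hilbert_schmidt_op_def)
  have r: "restr I (l2_unit j) = (if j \<in> I then l2_unit j else (\<lambda>i. 0))" for j
    by (auto simp: restr_def l2_unit_def)
  have "restr I (coord 0) = (\<lambda>i. 0)" "coord 0 = (\<lambda>i. 0)" by (auto simp: restr_def)
  then have "T (\<lambda>i. 0) = (\<lambda>i. 0)"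
    using coord_bext[OF T, of 0] by simp
  then have n: "norm (app (bext I T) (ket j)) = (if j \<in> I then l2_norm (T (l2_unit j)) else 0)" for j
    unfolding norm_ell2_def coord_bext[OF T] coord_ket' r by (simp add: l2_norm_def)
  have "(\<lambda>j. (l2_norm (T (l2_unit j)))\<^sup>2) summable_on I" using assms by (simp add: hilbert_schmidt_op_def)
  then show ?thesis
    unfolding hs_def n by (rule summable_on_cong_neutral[THEN iffD1, rotated -1]) auto
qed

lemma op_trace_bext:
  assumes "\<And>v. v \<in> l2 I \<Longrightarrow> S v = coord (app T (Ell2 v))" and "T * cproj I = T"
  shows "op_trace I S = trace T"
  unfolding op_trace_def trace_def
proof (rule infsum_cong_neutral)
  fix i assume "i \<in> UNIV - I"
  then have "app (cproj I) (ket i) = 0" by (intro ell2_eqI) simp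
  then show "matcoef T i i = 0" unfolding matcoef_def by (subst assms(2)[symmetric]) simp
next
  fix i assume "i \<in> I \<inter> UNIV"
  then have i: "l2_unit i \<in> l2 I" by (intro l2_unit_l2) auto
  have "l2_inner (S (l2_unit i)) (l2_unit i) = (\<Sum>\<^sub>\<infinity>j\<in>{i}. S (l2_unit i) j)"
    unfolding l2_inner_def by (rule infsum_cong_neutral) (auto simp: l2_unit_def)
  then show "l2_inner (S (l2_unit i)) (l2_unit i) = matcoef T i i"
    by (simp add: assms(1)[OF i] matcoef_def ket_def)
qed auto

text \<open>The sign changes between \<open>com\<close> and \<open>commutator\<close> cancel. The
  1/2 in \<open>chern_cocycle\<close> turns the constant (1 - q^2)/4 of \<open>index_hs\<close> into
  (1 - q^2)/2.\<close>

lemma index_chern: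
  assumes q: "0 < q" "q < 1" and M: "M \<in> odd_fredholm_modules (env q)"
    and hsM: "hilbert_schmidt_module (SUq2 q) (pullback (to_enveloping (SUq2 q)) M)"
  shows "module_index q M = of_real ((1 - q * q) / 2) *
    chern_cocycle (pullback (to_enveloping (SUq2 q)) M) (suq2_class q (word [Beta])) (suq2_class q (word [Beta_star]))"
proof -
  obtain I \<rho> F where MI: "M = (I, \<rho>, F)" by (cases M) auto
  interpret fredholm_data q "cproj I" "bext I F" "module_rep q I \<rho>"
    by (rule fredholm_data_module[OF M[unfolded MI]])
  have b: "bounded_op I I F" "bounded_op I I (\<rho> (to_enveloping (SUq2 q) a))"
    and h: "hilbert_schmidt_op I (commutator F (\<rho> (to_enveloping (SUq2 q) a)))" if "a \<in> carrier (SUq2 q)" for a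
    using M hsM to_env(1)[OF that that] that unfolding MI
    by (auto simp: odd_fredholm_modules_def star_rep_def hilbert_schmidt_module_def pullback_def)
  have com: "com (module_rep q I \<rho> a) = - bext I (commutator F (\<rho> (to_enveloping (SUq2 q) a)))"
    if "a \<in> carrier (SUq2 q)" for a
    by (simp add: bext_commutator b[OF that] com_def)
  have hs: "hs (com (module_rep q I \<rho> a))" if "a \<in> carrier (SUq2 q)" for a
    using hs_mult_left[OF hilbert_schmidt_bext[OF h[OF that]], of "-1"] com[OF that] by simp
  let ?b = "suq2_class q (word [Beta])" and ?b' = "suq2_class q (word [Beta_star])"
  let ?C = "\<lambda>a. commutator F (\<rho> (to_enveloping (SUq2 q) a))"
  let ?T = "bext I F * com (module_rep q I \<rho> ?b) * com (module_rep q I \<rho> ?b')"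
  have bC: "bounded_op I I (?C a)" if "a \<in> carrier (SUq2 q)" for a
    using h[OF that] by (simp add: hilbert_schmidt_op_def)
  have T: "?T = bext I F * bext I (?C ?b) * bext I (?C ?b')"
    by (simp add: com)
  have "op_trace I (F \<circ> ?C ?b \<circ> ?C ?b') = trace ?T"
  proof (rule op_trace_bext)
    fix v assume v: "v \<in> l2 I"
    note r1 = bounded_op_range[OF bC[OF class_carrier[of q "word [Beta_star]"]] v]
    note r2 = bounded_op_range[OF bC[OF class_carrier[of q "word [Beta]"]] r1]
    show "(F \<circ> ?C ?b \<circ> ?C ?b') v = coord (app ?T (Ell2 v))"
      unfolding T using v r1 r2
      by (simp add: coord_bext[OF b(1)[OF class_carrier]] coord_bext[OF bC[OF class_carrier]] coord_Ell2')
  next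
    have "com (module_rep q I \<rho> ?b') * cproj I = com (module_rep q I \<rho> ?b')"
      unfolding com_def using RQ[OF class_carrier] FQ by (simp add: left_diff_distrib mult.assoc)
    then show "?T * cproj I = ?T" by (simp add: mult.assoc)
  qed
  then have tr: "trace ?T = 2 * chern_cocycle (pullback (to_enveloping (SUq2 q)) M) ?b ?b'"
    by (simp add: chern_cocycle_def pullback_def MI)
  have ind: "module_index q M = of_real ((1 - q * q) / 4) * trace ?T"
    unfolding module_index_def MI prod.case by (rule index_hs[OF hs])
  have "complex_of_real ((1 - q * q) / 4) * (2 * c) = of_real ((1 - q * q) / 2) * c" for c
    by simp
  then show ?thesis unfolding ind tr by simp
qed

subsection \<open>The index on odd K-homology\<close>

definition frag_index :: "real \<Rightarrow> ((nat \<Rightarrow> suq2) set ktriple \<Rightarrow>\<^sub>0 int) \<Rightarrow> complex" where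
  "frag_index q = lin_ext (\<lambda>M n. of_int n * module_index q M)"

lemma frag_index_add: "frag_index q (x + y) = frag_index q x + frag_index q y"
  unfolding frag_index_def by (rule lin_ext_add) (auto simp: distrib_right)

lemma frag_index_uminus: "frag_index q (- x) = - frag_index q x"
  using frag_index_add[of q x "-x"] by (simp add: frag_index_def add_eq_0_iff)

lemma frag_index_of: "frag_index q (frag_of M) = module_index q M"
  unfolding frag_index_def by (subst lin_ext_single) auto

text \<open>Ensures that the relators generate a subgroup of the free group on modules, which
  commutativity then makes normal.\<close>

lemma K1_relators_keys: "K1_relators (env q) \<subseteq> carrier (free_Abelian_group (odd_fredholm_modules (env q)))"
proof -
  interpret group "free_Abelian_group (odd_fredholm_modules (env q))" by simp
  have f: "frag_of M \<in> carrier (free_Abelian_group (odd_fredholm_modules (env q)))" if "M \<in> odd_fredholm_modules (env q)" for M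
    using that by simp
  have d: "x - y \<in> carrier (free_Abelian_group S)"
    if "x \<in> carrier (free_Abelian_group S)" "y \<in> carrier (free_Abelian_group S)" for x y :: "'b \<Rightarrow>\<^sub>0 int" and S
    using that keys_diff[of x y] by auto
  show ?thesis
    unfolding K1_relators_def by (auto intro!: d f ktriple_sum_module simp del: carrier_free_Abelian_group_iff)
qed

lemma frag_index_K1_relators: "x \<in> K1_relators (env q) \<Longrightarrow> frag_index q x = 0"
proof -
  have d: "frag_index q (x - y) = frag_index q x - frag_index q y" for x y
    using frag_index_add[of q x "-y"] by (simp add: frag_index_uminus)
  show "x \<in> K1_relators (env q) \<Longrightarrow> frag_index q x = 0"
    unfolding K1_relators_def
    by (auto simp: d frag_index_of module_index_sum dest: module_index_unitary module_index_homotopy)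
qed

lemma K1_subgroup_normal: "K1_subgroup (env q) \<lhd> free_Abelian_group (odd_fredholm_modules (env q))"
  unfolding K1_subgroup_def
  by (intro comm_group.subgroup_imp_normal abelian_free_Abelian_group group.generate_is_subgroup[OF _ K1_relators_keys]) simp

lemma frag_index_K1_subgroup:
  assumes "x \<in> K1_subgroup (env q)" shows "frag_index q x = 0"
  using assms unfolding K1_subgroup_def
proof (induction rule: generate.induct)
  case one
  show ?case by (simp add: frag_index_def)
next
  case (incl h)
  then show ?case by (rule frag_index_K1_relators)
next
  case (inv h)
  have "Poly_Mapping.keys h \<subseteq> odd_fredholm_modules (env q)"
    using subsetD[OF K1_relators_keys inv] by simp
  then show ?case using frag_index_K1_relators[OF inv] by (simp add: frag_index_uminus)
next
  case (eng x y)
  then show ?case by (simp add: frag_index_add)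
qed

lemma K1_class_mem: "x \<in> K1_class (env q) M \<longleftrightarrow> x - frag_of M \<in> K1_subgroup (env q)"
  unfolding K1_class_def r_coset_def by (auto intro!: bexI[of _ "x - frag_of M"])

text \<open>Cosets on which \<open>frag_index\<close> vanishes identically are closed under products
  and inverses, so they include everything generated by the class of M.\<close>

lemma module_index_generator:
  assumes M: "M \<in> odd_fredholm_modules (env q)" and N: "N \<in> odd_fredholm_modules (env q)"
    and gen: "generate (K1 (env q)) {K1_class (env q) M} = carrier (K1 (env q))"
    and zero: "module_index q M = 0"
  shows "module_index q N = 0"
proof -
  let ?G = "free_Abelian_group (odd_fredholm_modules (env q))"
  interpret normal "K1_subgroup (env q)" ?G by (rule K1_subgroup_normal)
  have Mc: "K1_class (env q) M \<in> carrier (K1 (env q))" and Nc: "K1_class (env q) N \<in> carrier (K1 (env q))"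
    unfolding K1_def K1_class_def carrier_FactGroup using M N by auto
  have sub: "X \<subseteq> carrier ?G" if "X \<in> carrier (K1 (env q))" for X
    using that rcosets_part_G[OF subgroup_axioms] unfolding K1_def FactGroup_def by auto
  have M0: "frag_index q x = 0" if "x \<in> K1_class (env q) M" for x
    using frag_index_add[of q "x - frag_of M" "frag_of M"] that zero
    by (simp add: K1_class_mem frag_index_K1_subgroup frag_index_of)
  have "\<forall>x\<in>X. frag_index q x = 0" if "X \<in> generate (K1 (env q)) {K1_class (env q) M}" for X
    using that
  proof (induction rule: generate.induct)
    case one
    then show ?case by (simp add: K1_def frag_index_K1_subgroup)
  next
    case (incl X)
    then show ?case using M0 by auto
  next
    case (inv X)
    then have "inv\<^bsub>K1 (env q)\<^esub> X = set_inv\<^bsub>?G\<^esub> (K1_class (env q) M)"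
      using Mc inv_FactGroup unfolding K1_def by auto
    moreover have "frag_index q (inv\<^bsub>?G\<^esub> x) = 0" if "x \<in> K1_class (env q) M" for x
      using that sub[OF Mc] M0[OF that] by (auto simp: frag_index_uminus)
    ultimately show ?case by (auto simp: SET_INV_def)
  next
    case (eng X Y)
    then show ?case by (auto simp: K1_def FactGroup_def set_mult_def frag_index_add)
  qed
  then have "\<forall>x\<in>K1_class (env q) N. frag_index q x = 0" using Nc gen by blast
  moreover have "frag_of N \<in> K1_class (env q) N"
    using subgroup.one_closed[OF subgroup_axioms] by (simp add: K1_class_mem)
  ultimately show ?thesis by (metis frag_index_of)
qed

theorem theorem3p3:
  fixes q :: real and c :: complex
    and M :: "(nat \<Rightarrow> suq2) set ktriple"
    and \<tau> :: "suq2 \<Rightarrow> suq2 \<Rightarrow> complex"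
  assumes "0 < q" and "q < 1"
    and "M \<in> odd_fredholm_modules (enveloping (SUq2 q))"
    and "generate (K1 (enveloping (SUq2 q))) {K1_class (enveloping (SUq2 q)) M}
           = carrier (K1 (enveloping (SUq2 q)))"
    and "hilbert_schmidt_module (SUq2 q) (pullback (to_enveloping (SUq2 q)) M)"
    and "c \<noteq> 0"
    and "\<tau> = (\<lambda>a\<^sub>0 a\<^sub>1. c * chern_cocycle (pullback (to_enveloping (SUq2 q)) M) a\<^sub>0 a\<^sub>1)"
  shows "\<not> invariant_class q (HC1_class (SUq2 q) \<tau>)"
proof
  let ?A = "SUq2 q" and ?b = "suq2_class q (word [Beta])" and ?b' = "suq2_class q (word [Beta_star])"
  let ?\<chi> = "chern_cocycle (pullback (to_enveloping ?A) M)"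
  assume "invariant_class q (HC1_class ?A \<tau>)"
  then obtain \<phi> where \<phi>: "cyclic_1_cocycle ?A \<phi>" "invariant_functional q \<phi>" "HC1_class ?A \<phi> = HC1_class ?A \<tau>"
    by (auto simp: invariant_class_def)
  \<comment> \<open>The zero functional places the cocycle in its own class, which turns equality of
    classes into a coboundary relation.\<close>
  have "\<phi> \<in> HC1_class ?A \<phi>"
    using \<phi>(1) by (auto simp: HC1_class_def cohomologous_def linear_functional_def intro!: exI[of _ "\<lambda>_. 0"])
  then have "\<phi> \<in> HC1_class ?A \<tau>" using \<phi>(3) by simp
  then have "cohomologous ?A \<phi> \<tau>" by (simp add: HC1_class_def)
  then obtain \<xi> where \<xi>: "\<phi> a b - \<tau> a b = \<xi> (a \<otimes>\<^bsub>?A\<^esub> b) - \<xi> (b \<otimes>\<^bsub>?A\<^esub> a)"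
    if "a \<in> carrier ?A" "b \<in> carrier ?A" for a b
    by (auto simp: cohomologous_def)
  have "?b \<otimes>\<^bsub>?A\<^esub> ?b' = ?b' \<otimes>\<^bsub>?A\<^esub> ?b"
    using class_relations(5)[of q] by (simp add: mult_single)
  then have eq: "\<phi> ?b ?b' = \<tau> ?b ?b'" using \<xi>[of ?b ?b'] by simp
  have "\<phi> a b = - \<phi> b a" if "a \<in> carrier ?A" "b \<in> carrier ?A" for a b
    using \<phi>(1) that unfolding cyclic_1_cocycle_def by blast
  then have "\<phi> ?b ?b' = 0"
    by (rule invariant_antisymmetric_zero[OF assms(1,2) \<phi>(2) _ vacuum[OF assms(1,2)]])
  with eq have "?\<chi> ?b ?b' = 0" using assms(6,7) by simp
  then have "module_index q M = 0" using index_chern[OF assms(1,2,3,5)] by simp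
  then have "module_index q N = 0" if "N \<in> odd_fredholm_modules (env q)" for N
    by (rule module_index_generator[OF assms(3) that assms(4)])
  then show False using std_module[OF assms(1,2)] by blast
qed

end
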